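(* Let $K$ be a field, $R = K[x_1,x_2,\ldots]$, and let $I = \langle f_1, \ldots, f_m\rangle_{R[\mathfrak{S}_{\infty}]}$ be the symmetric ideal of $R$ generated by polynomials $f_1,\ldots,f_m\in R$. There exists an effective algorithm (with input $f_1,\ldots,f_m$) to compute a finite minimal Gröbner basis for $I$.
   Context: Setting. $K$ is a field, $X=\{x_1,x_2,\ldots\}$ is an infinite set of indeterminates indexed by the positive integers, $R=K[X]$. $\mathfrak{S}_\infty$ is the group of all permutations of $X$ (equivalently, of the positive integers); it acts on $R$ by $\sigma f(x_1,\ldots,x_n)=f(x_{\sigma 1},\ldots,x_{\sigma n})$. $R[\mathfrak{S}_\infty]$ is the left group ring with multiplication $f\sigma\cdot g\tau = fg(\sigma\tau)$ for $f,g\in R$, $\sigma,\tau\in\mathfrak{S}_\infty$, extended linearly; $R$ is a left $R[\mathfrak{S}_\infty]$-module via the action above. An ideal $I\subseteq R$ is symmetric if $\sigma f\in I$ for all $\sigma\in\mathfrak{S}_\infty$, $f\in I$; symmetric ideals are exactly the $R[\mathfrak{S}_\infty]$-submodules of $R$. $\langle f_1,\ldots,f_m\rangle_{R[\mathfrak{S}_\infty]}$ denotes the $R[\mathfrak{S}_\infty]$-submodule generated by $f_1,\ldots,f_m$, i.e. the ideal of $R$ generated by all $\sigma f_i$. "Effective algorithm" refers to algorithms that operate on polynomials with coefficients in $K$, using the field operations and equality test of $K$. Monomial orders. $\Omega$ is the set of monomials in $x_1,x_2,\ldots$, including $1$. Order $x_1<x_2<\cdots$ and let $\leq$ be the induced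 lexicographic total well-ordering of $\Omega$ (two distinct monomials are compared by their exponents at the largest index where the exponents differ). For nonzero $f\in R$, $\operatorname{lm}(f)$ is its leading monomial with respect to $\leq$. The symmetric cancellation partial ordering on $\Omega$: $v\preceq w$ if and only if $v\leq w$ and there exists $\sigma\in\mathfrak{S}_\infty$ such that $\sigma v\mid w$ and $\sigma u\leq\sigma v$ for all $u\in\Omega$ with $u\leq v$. Gröbner bases. For a set of polynomials $A\subseteq R$, $\operatorname{lm}(A)=\langle w\in\Omega : \operatorname{lm}(f)\preceq w \text{ for some } 0\neq f\in A\rangle_K$, the $K$-linear span. A subset $B$ of a symmetric ideal $I\subseteq R$ is a Gröbner basis for $I$ if $\operatorname{lm}(B)=\operatorname{lm}(I)$. A Gröbner basis $B$ is minimal if no leading monomial of an element of $B$ is $\preceq$-smaller than any other leading monomial of an element of $B$. *)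

theory Defs
  imports Complex_Main "HOL-Library.Poly_Mapping"
begin

section \<open>Monomials and polynomials in countably many indeterminates\<close>

text \<open>
  Monomials are written additively, as finitely supported exponent vectors, and a polynomial maps
  monomials to coefficients.  Indices start at \<open>0\<close>: index \<open>i\<close> belongs to the
  indeterminate $x_{i+1}$.
\<close>

type_synonym mon = "nat \<Rightarrow>\<^sub>0 nat"
type_synonym 'k mpoly = "mon \<Rightarrow>\<^sub>0 'k"

definition mon_divides :: "mon \<Rightarrow> mon \<Rightarrow> bool" where
  "mon_divides u w \<longleftrightarrow> (\<exists>z. w = u + z)"

text \<open>
  The order below compares exponents at the \<^emph>\<open>largest\<close> index at which they differ.  It is not
  the order \<open>\<le>\<close> of theory \<open>Poly_Mapping\<close>, which compares at the smallest such index.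
\<close>

definition mon_less :: "mon \<Rightarrow> mon \<Rightarrow> bool" where
  "mon_less u v \<longleftrightarrow>
     (\<exists>i. Poly_Mapping.lookup u i < Poly_Mapping.lookup v i \<and>
          (\<forall>j>i. Poly_Mapping.lookup u j = Poly_Mapping.lookup v j))"

definition mon_le :: "mon \<Rightarrow> mon \<Rightarrow> bool" where
  "mon_le u v \<longleftrightarrow> mon_less u v \<or> u = v"

text \<open>Only meaningful for nonzero polynomials.\<close>

definition lead_mon :: "'k::zero mpoly \<Rightarrow> mon" where
  "lead_mon f = (THE w. w \<in> Poly_Mapping.keys f \<and> (\<forall>u\<in>Poly_Mapping.keys f. mon_le u w))"


section \<open>The action of the infinite symmetric group and symmetric ideals\<close>

text \<open>
  The elements of the group are the functions \<open>\<sigma> :: nat \<Rightarrow> nat\<close> with \<open>bij \<sigma>\<close>; they need not have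
  finite support.  The action replaces each indeterminate of index \<open>i\<close> by the one of index \<open>\<sigma> i\<close>.
\<close>

definition perm_mon :: "(nat \<Rightarrow> nat) \<Rightarrow> mon \<Rightarrow> mon" where
  "perm_mon \<sigma> u =
     (\<Sum>i\<in>Poly_Mapping.keys u. Poly_Mapping.single (\<sigma> i) (Poly_Mapping.lookup u i))"

definition perm_poly :: "(nat \<Rightarrow> nat) \<Rightarrow> 'k::comm_monoid_add mpoly \<Rightarrow> 'k mpoly" where
  "perm_poly \<sigma> f =
     (\<Sum>u\<in>Poly_Mapping.keys f. Poly_Mapping.single (perm_mon \<sigma> u) (Poly_Mapping.lookup f u))"

text \<open>
  Ideals are the submodules of the polynomial ring, viewed as a module over itself.  The ideal
  generated by all images of elements of \<open>F\<close> is the submodule generated by \<open>F\<close> over the group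
  ring, see \<open>symmetric_ideal_sym_ideal_gen\<close> and \<open>sym_ideal_gen_minimal\<close> below.
\<close>

definition symmetric_ideal :: "'k::comm_ring_1 mpoly set \<Rightarrow> bool" where
  "symmetric_ideal I \<longleftrightarrow>
     module.subspace (*) I \<and> (\<forall>\<sigma>. bij \<sigma> \<longrightarrow> (\<forall>f\<in>I. perm_poly \<sigma> f \<in> I))"

definition sym_ideal_gen :: "'k::comm_ring_1 mpoly set \<Rightarrow> 'k mpoly set" where
  "sym_ideal_gen F = module.span (*) {perm_poly \<sigma> f |\<sigma> f. bij \<sigma> \<and> f \<in> F}"


lemma module_mult: "module ((*) :: 'a::comm_ring_1 \<Rightarrow> 'a \<Rightarrow> 'a)"
  by unfold_locales (simp_all add: algebra_simps)

lemma sum_single_keys: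
  fixes f :: "'a \<Rightarrow>\<^sub>0 'b::comm_monoid_add"
  shows "(\<Sum>u\<in>Poly_Mapping.keys f. Poly_Mapping.single u (Poly_Mapping.lookup f u)) = f"
proof (rule poly_mapping_eqI)
  fix w
  show "Poly_Mapping.lookup
      (\<Sum>u\<in>Poly_Mapping.keys f. Poly_Mapping.single u (Poly_Mapping.lookup f u)) w
      = Poly_Mapping.lookup f w"
    by (simp add: Poly_Mapping.lookup_sum Poly_Mapping.lookup_single when_def in_keys_iff)
qed

lemma perm_mon_add: "perm_mon \<sigma> (u + v) = perm_mon \<sigma> u + perm_mon \<sigma> v"
proof -
  let ?A = "Poly_Mapping.keys u \<union> Poly_Mapping.keys v"
  have *: "perm_mon \<sigma> w = (\<Sum>i\<in>?A. Poly_Mapping.single (\<sigma> i) (Poly_Mapping.lookup w i))"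
    if "Poly_Mapping.keys w \<subseteq> ?A" for w
    unfolding perm_mon_def
    by (rule sum.mono_neutral_left) (use that in \<open>auto simp: in_keys_iff\<close>)
  show ?thesis
    using Poly_Mapping.keys_add[of u v]
    by (simp add: * single_add sum.distrib lookup_add)
qed

lemma perm_poly_add: "perm_poly \<sigma> (f + g) = perm_poly \<sigma> f + perm_poly \<sigma> g"
proof -
  let ?A = "Poly_Mapping.keys f \<union> Poly_Mapping.keys g"
  have *: "perm_poly \<sigma> h
      = (\<Sum>u\<in>?A. Poly_Mapping.single (perm_mon \<sigma> u) (Poly_Mapping.lookup h u))"
    if "Poly_Mapping.keys h \<subseteq> ?A" for h :: "'a mpoly"
    unfolding perm_poly_def
    by (rule sum.mono_neutral_left) (use that in \<open>auto simp: in_keys_iff\<close>)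
  show ?thesis
    using Poly_Mapping.keys_add[of f g]
    by (simp add: * single_add sum.distrib lookup_add)
qed

lemma perm_poly_0: "perm_poly \<sigma> 0 = 0"
  by (simp add: perm_poly_def)

lemma perm_poly_single:
  "perm_poly \<sigma> (Poly_Mapping.single u c) = Poly_Mapping.single (perm_mon \<sigma> u) c"
  by (cases "c = 0") (simp_all add: perm_poly_def)

lemma perm_poly_sum: "perm_poly \<sigma> (sum h A) = (\<Sum>x\<in>A. perm_poly \<sigma> (h x))"
  by (induction A rule: infinite_finite_induct) (simp_all add: perm_poly_0 perm_poly_add)

lemma perm_poly_mult:
  fixes f g :: "'k::comm_ring_1 mpoly"
  shows "perm_poly \<sigma> (f * g) = perm_poly \<sigma> f * perm_poly \<sigma> g"
proof -
  let ?s = "\<lambda>f u. Poly_Mapping.single u (Poly_Mapping.lookup f u) :: 'k mpoly"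
  let ?f = "\<Sum>u\<in>Poly_Mapping.keys f. ?s f u" and ?g = "\<Sum>v\<in>Poly_Mapping.keys g. ?s g v"
  have "perm_poly \<sigma> (?f * ?g) = perm_poly \<sigma> ?f * perm_poly \<sigma> ?g"
    by (simp add: sum_product perm_poly_sum mult_single perm_poly_single perm_mon_add)
  then show ?thesis by (simp add: sum_single_keys)
qed

lemma perm_mon_comp: "perm_mon \<sigma> (perm_mon \<tau> u) = perm_mon (\<sigma> \<circ> \<tau>) u"
proof -
  have single: "perm_mon \<sigma> (Poly_Mapping.single i e) = Poly_Mapping.single (\<sigma> i) e" for i e
    by (cases "e = 0") (simp_all add: perm_mon_def)
  have "perm_mon \<sigma> (sum h A) = (\<Sum>x\<in>A. perm_mon \<sigma> (h x))" for h :: "nat \<Rightarrow> mon" and A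
    by (induction A rule: infinite_finite_induct) (simp_all add: perm_mon_def[of _ 0] perm_mon_add)
  then show ?thesis
    by (simp add: perm_mon_def[of \<tau>] perm_mon_def[of "\<sigma> \<circ> \<tau>"] single)
qed

lemma perm_poly_comp: "perm_poly \<sigma> (perm_poly \<tau> f) = perm_poly (\<sigma> \<circ> \<tau>) f"
  by (simp add: perm_poly_def[of \<tau>] perm_poly_def[of "\<sigma> \<circ> \<tau>"] perm_poly_sum perm_poly_single
      perm_mon_comp)

lemma perm_poly_id: "perm_poly id f = f"
proof -
  have "perm_mon id u = u" for u
    unfolding perm_mon_def id_apply by (rule sum_single_keys)
  then show ?thesis by (simp add: perm_poly_def sum_single_keys)
qed

lemma symmetric_ideal_sym_ideal_gen: "symmetric_ideal (sym_ideal_gen F)"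
  unfolding symmetric_ideal_def
proof (intro conjI allI impI ballI)
  let ?S = "{perm_poly \<sigma> f |\<sigma> f. bij \<sigma> \<and> f \<in> F}"
  show "module.subspace (*) (sym_ideal_gen F)"
    unfolding sym_ideal_gen_def by (rule module.subspace_span[OF module_mult])
  fix \<sigma> :: "nat \<Rightarrow> nat" and g
  assume \<sigma>: "bij \<sigma>" and "g \<in> sym_ideal_gen F"
  then have "g \<in> module.span (*) ?S" by (simp add: sym_ideal_gen_def)
  then have "perm_poly \<sigma> g \<in> module.span (*) ?S"
  proof (induction rule: module.span_induct_alt[OF module_mult, consumes 1])
    case 1
    then show ?case by (simp add: perm_poly_0 module.span_zero[OF module_mult])
  next
    case (2 r h g)
    then obtain \<tau> f where "bij \<tau>" "f \<in> F" "h = perm_poly \<tau> f" by blast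
    then have "perm_poly \<sigma> h \<in> ?S"
      using bij_comp[OF \<open>bij \<tau>\<close> \<sigma>] by (auto simp: perm_poly_comp)
    then have "perm_poly \<sigma> r * perm_poly \<sigma> h \<in> module.span (*) ?S"
      by (intro module.span_scale[OF module_mult] module.span_base[OF module_mult])
    then show ?case
      unfolding perm_poly_add perm_poly_mult
      using 2 by (intro module.span_add[OF module_mult])
  qed
  then show "perm_poly \<sigma> g \<in> sym_ideal_gen F" by (simp add: sym_ideal_gen_def)
qed

lemma sym_ideal_gen_superset: "F \<subseteq> sym_ideal_gen F"
proof
  fix f assume "f \<in> F"
  then have "f \<in> {perm_poly \<sigma> f |\<sigma> f. bij \<sigma> \<and> f \<in> F}"
    using perm_poly_id[of f] bij_id by (metis (mono_tags, lifting) mem_Collect_eq)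
  then show "f \<in> sym_ideal_gen F"
    unfolding sym_ideal_gen_def by (rule module.span_base[OF module_mult])
qed

lemma sym_ideal_gen_minimal:
  assumes "symmetric_ideal I" "F \<subseteq> I"
  shows "sym_ideal_gen F \<subseteq> I"
  unfolding sym_ideal_gen_def
  by (rule module.span_minimal[OF module_mult]) (use assms in \<open>auto simp: symmetric_ideal_def\<close>)


section \<open>Symmetric cancellation order and Groebner bases\<close>

definition sym_le :: "mon \<Rightarrow> mon \<Rightarrow> bool" where
  "sym_le v w \<longleftrightarrow>
     mon_le v w \<and>
     (\<exists>\<sigma>. bij \<sigma> \<and> mon_divides (perm_mon \<sigma> v) w \<and>
          (\<forall>u. mon_le u v \<longrightarrow> mon_le (perm_mon \<sigma> u) (perm_mon \<sigma> v)))"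

definition poly_scale :: "'k::comm_ring_1 \<Rightarrow> 'k mpoly \<Rightarrow> 'k mpoly" where
  "poly_scale c f = Poly_Mapping.single 0 c * f"

lemma module_poly_scale: "module poly_scale"
proof -
  have "poly_scale (1 :: 'a) f = f" for f :: "'a mpoly"
    by (simp add: poly_scale_def)
  then show ?thesis
    by unfold_locales
      (simp_all add: poly_scale_def algebra_simps single_add mult_single flip: mult.assoc)
qed

definition lm_span :: "'k::field mpoly set \<Rightarrow> 'k mpoly set" where
  "lm_span A =
     module.span poly_scale
       {Poly_Mapping.single w 1 |w. \<exists>f\<in>A. f \<noteq> 0 \<and> sym_le (lead_mon f) w}"

definition groebner_basis :: "'k::field mpoly set \<Rightarrow> 'k mpoly set \<Rightarrow> bool" where
  "groebner_basis B I \<longleftrightarrow> symmetric_ideal I \<and> B \<subseteq> I \<and> lm_span B = lm_span I"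

text \<open>
  Two different elements with the same leading monomial are excluded, as the cancellation order is
  reflexive; so is the zero polynomial, which has no leading monomial.
\<close>

definition minimal_groebner_basis :: "'k::field mpoly set \<Rightarrow> 'k mpoly set \<Rightarrow> bool" where
  "minimal_groebner_basis B I \<longleftrightarrow>
     groebner_basis B I \<and> 0 \<notin> B \<and>
     (\<forall>f\<in>B. \<forall>g\<in>B. f \<noteq> g \<longrightarrow> \<not> sym_le (lead_mon f) (lead_mon g))"


section \<open>Algorithms over a field\<close>

text \<open>
  An algorithm is a program, a finite syntactic object that does not depend on the field, for a
  machine whose data are binary trees with leaves in the field.  It may use the constants
  \<open>0\<close> and \<open>1\<close>, the field operations and the equality test of the field; apart from these it may
  build and decompose trees, branch and loop.  This is computability over a structure in the sense of
  Moschovakis (prime computability) or of while programs with stacks; over an effectively presented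
  field it is ordinary computability.
\<close>

datatype 'k data = Null | Scalar 'k | Node "'k data" "'k data"

datatype prog =
    PId
  | PSeq prog prog
  | PNull
  | PNode prog prog
  | PLeft
  | PRight
  | PZero
  | POne
  | PAdd
  | PMult
  | PNeg
  | PInv
  | PEq
  | PIf prog prog prog
  | PWhile prog prog

text \<open>
  \<open>run p d e\<close>: on input \<open>d\<close> the program \<open>p\<close> halts with output \<open>e\<close>.  There is no such \<open>e\<close> if \<open>p\<close>
  does not halt or applies an operation to data of the wrong shape.  In conditions, \<open>Null\<close> is false
  and everything else is true.
\<close>

inductive run :: "prog \<Rightarrow> 'k::field data \<Rightarrow> 'k data \<Rightarrow> bool" where
  run_Id: "run PId d d"
| run_Seq: "run p d d' \<Longrightarrow> run q d' e \<Longrightarrow> run (PSeq p q) d e"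
| run_Null: "run PNull d Null"
| run_Node: "run p d a \<Longrightarrow> run q d b \<Longrightarrow> run (PNode p q) d (Node a b)"
| run_Left: "run PLeft (Node a b) a"
| run_Right: "run PRight (Node a b) b"
| run_Zero: "run PZero d (Scalar 0)"
| run_One: "run POne d (Scalar 1)"
| run_Add: "run PAdd (Node (Scalar x) (Scalar y)) (Scalar (x + y))"
| run_Mult: "run PMult (Node (Scalar x) (Scalar y)) (Scalar (x * y))"
| run_Neg: "run PNeg (Scalar x) (Scalar (- x))"
| run_Inv: "x \<noteq> 0 \<Longrightarrow> run PInv (Scalar x) (Scalar (inverse x))"
| run_Eq: "run PEq (Node (Scalar x) (Scalar y)) (if x = y then Node Null Null else Null)"
| run_If_true: "run b d c \<Longrightarrow> c \<noteq> Null \<Longrightarrow> run p d e \<Longrightarrow> run (PIf b p q) d e"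
| run_If_false: "run b d Null \<Longrightarrow> run q d e \<Longrightarrow> run (PIf b p q) d e"
| run_While_true:
    "run b d c \<Longrightarrow> c \<noteq> Null \<Longrightarrow> run p d d' \<Longrightarrow> run (PWhile b p) d' e \<Longrightarrow> run (PWhile b p) d e"
| run_While_false: "run b d Null \<Longrightarrow> run (PWhile b p) d d"

lemma run_deterministic: "run p d e \<Longrightarrow> run p d e' \<Longrightarrow> e' = e"
proof (induction arbitrary: e' rule: run.induct)
  case (run_Seq p d d' q e)
  from run_Seq.prems show ?case by cases (use run_Seq.IH in metis)
next
  case (run_Node p d a q b)
  from run_Node.prems show ?case by cases (use run_Node.IH in metis)
next
  case (run_If_true b d c p e q)
  from run_If_true.prems show ?case
    by cases (use run_If_true.IH run_If_true.hyps in metis)+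
next
  case (run_If_false b d q e p)
  from run_If_false.prems show ?case
    by cases (use run_If_false.IH run_If_false.hyps in metis)+
next
  case (run_While_true b d c p d' e)
  from run_While_true.prems show ?case
    by cases (use run_While_true.IH run_While_true.hyps in metis)+
next
  case (run_While_false b d p)
  from run_While_false.prems show ?case
    by cases (use run_While_false.IH run_While_false.hyps in metis)+
qed (erule run.cases; simp)+


section \<open>Polynomials as data\<close>

fun list_data :: "'k data list \<Rightarrow> 'k data" where
  "list_data [] = Null"
| "list_data (d # ds) = Node d (list_data ds)"

text \<open>Natural numbers are represented in unary.\<close>

definition nat_data :: "nat \<Rightarrow> 'k data" where
  "nat_data n = list_data (replicate n Null)"

text \<open>
  A polynomial is given by a list of terms, each consisting of a coefficient and a list of exponents
  (of the indeterminates of index \<open>0, 1, 2, \<dots>\<close>).  The terms may come in any order; repeated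
  monomials, zero coefficients and trailing zero exponents are allowed.
\<close>

type_synonym 'k terms = "('k \<times> nat list) list"

definition poly_of_terms :: "'k::comm_monoid_add terms \<Rightarrow> 'k mpoly" where
  "poly_of_terms ts = (\<Sum>(c, es)\<leftarrow>ts. Poly_Mapping.single (Poly_Mapping.nth es) c)"

definition terms_data :: "'k terms \<Rightarrow> 'k data" where
  "terms_data ts = list_data (map (\<lambda>(c, es). Node (Scalar c) (list_data (map nat_data es))) ts)"

definition represents :: "'k::comm_monoid_add data \<Rightarrow> 'k mpoly list \<Rightarrow> bool" where
  "represents d fs \<longleftrightarrow>
     (\<exists>tss. d = list_data (map terms_data tss) \<and> fs = map poly_of_terms tss)"

lemma ex_exponents: "\<exists>es. Poly_Mapping.nth es = u"
proof -
  obtain N where N: "\<And>i. i \<in> Poly_Mapping.keys u \<Longrightarrow> i < N"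
    using finite_nat_set_iff_bounded[THEN iffD1, OF finite_keys] by blast
  have "Poly_Mapping.nth (map (Poly_Mapping.lookup u) [0..<N]) = u"
  proof (rule poly_mapping_eqI)
    fix i
    show "Poly_Mapping.lookup (Poly_Mapping.nth (map (Poly_Mapping.lookup u) [0..<N])) i
        = Poly_Mapping.lookup u i"
      using N[of i] by (auto simp: nth.rep_eq nth_default_def in_keys_iff)
  qed
  then show ?thesis ..
qed

lemma ex_terms: "\<exists>ts. poly_of_terms ts = f"
proof -
  obtain us where us: "set us = Poly_Mapping.keys f" "distinct us"
    using finite_distinct_list[of "Poly_Mapping.keys f"] finite_keys[of f] by auto
  define ex where "ex u = (SOME es. Poly_Mapping.nth es = u)" for u :: mon
  have ex: "Poly_Mapping.nth (ex u) = u" for u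
    unfolding ex_def by (rule someI_ex) (rule ex_exponents)
  have "poly_of_terms (map (\<lambda>u. (Poly_Mapping.lookup f u, ex u)) us)
      = (\<Sum>u\<leftarrow>us. Poly_Mapping.single u (Poly_Mapping.lookup f u))"
    by (simp add: poly_of_terms_def o_def ex)
  also have "\<dots> = (\<Sum>u\<in>Poly_Mapping.keys f. Poly_Mapping.single u (Poly_Mapping.lookup f u))"
    using us by (simp add: sum_list_distinct_conv_sum_set)
  also have "\<dots> = f"
    by (rule sum_single_keys)
  finally show ?thesis by (rule exI)
qed

lemma ex_represents: "\<exists>d. represents d fs"
proof -
  have "\<exists>tss. map poly_of_terms tss = fs"
  proof (induction fs)
    case (Cons f fs)
    obtain ts where "poly_of_terms ts = f" using ex_terms ..
    moreover obtain tss where "map poly_of_terms tss = fs" using Cons.IH ..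
    ultimately have "map poly_of_terms (ts # tss) = f # fs" by simp
    then show ?case by (rule exI)
  qed simp
  then show ?thesis unfolding represents_def by blast
qed

end

theory Submission
  imports Defs "HOL-Library.Sublist" "HOL-Library.Infinite_Set" "HOL-Library.While_Combinator"
    "HOL-Combinatorics.Permutations"
begin

text \<open>
  The orbit of a finite set under all permutations is an infinite set of polynomials, but ordinary
  Buchberger theory for it is governed by finitely many S-polynomials: two permuted copies of
  polynomials in \<open>n\<close> indeterminates involve at most \<open>2 n\<close> indeterminates, and an order preserving
  renaming, which commutes with taking leading monomials, moves these to the first \<open>2 n\<close> ones. So one
  forms all S-polynomials of the orbit under the permutations of \<open>2 n\<close> indeterminates, reduces them
  by that orbit, adds the nonzero remainders and repeats. Higman's lemma shows that this ends.
  On \<open>n\<close> indeterminates, every injective renaming is a permutation of the first \<open>2 n\<close> ones followed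
  by an order preserving renaming, and the latter only moves up in the symmetric cancellation order;
  hence the final orbit is a Groebner basis, and its minimal elements form a minimal one.
\<close>

section \<open>Higman's lemma\<close>

text \<open>A general permutation changes which monomial of a polynomial leads, so S-polynomials
  cannot be transported along the group. Strictly increasing maps of the indices do respect leading
  terms, but they need not be onto and then lie outside the group. Two facts reconcile them: on
  finitely many indeterminates an injection agrees with a permutation
  (\<open>ex_permutes_extending\<close>), and Buchberger's criterion is applied to the images under
  all injections, a family closed under increasing maps.

  The procedure reduces by plain divisibility and consults the cancellation order only to select
  minimal elements. As that order quantifies over all permutations and all monomials, it has to be
  turned into a finite test.

  A round may enlarge the number of indeterminates, so the Noetherian property of a fixed polynomial
  ring does not bound the number of rounds; hence exponent lists of varying length and Higman's
  lemma, which also makes the monomial order well-founded in infinitely many indeterminates.\<close>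

lemma ex_nondecreasing_subseq:
  fixes a :: "nat \<Rightarrow> nat"
  shows "\<exists>s::nat \<Rightarrow> nat. strict_mono s \<and> (\<forall>i j. i \<le> j \<longrightarrow> a (s i) \<le> a (s j))"
proof -
  \<comment> \<open>Beyond \<open>k\<close> the least value is attained at some \<open>n\<close>; it
    is below all later values, so indices of this kind, chosen one after another, carry a
    nondecreasing subsequence.\<close>
  have ex: "\<exists>n>k. \<forall>m\<ge>n. a n \<le> a m" for k
  proof -
    obtain n where n: "n > k" "\<And>m. m > k \<Longrightarrow> a n \<le> a m"
      using ex_has_least_nat[of "\<lambda>n. n > k" "Suc k" a] by auto
    have "a n \<le> a m" if "m \<ge> n" for m
      using n that by simp
    then show ?thesis using n(1) by blast
  qed
  have "\<exists>s. \<forall>k. (\<forall>m\<ge>s k. a (s k) \<le> a m) \<and> s k < s (Suc k)"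
  proof (rule dependent_nat_choice)
    show "\<exists>n. \<forall>m\<ge>n. a n \<le> a m" using ex[of 0] by blast
    show "\<exists>y. (\<forall>m\<ge>y. a y \<le> a m) \<and> x < y" for x n using ex[of x] by blast
  qed
  then obtain s where s: "\<And>k m. m \<ge> s k \<Longrightarrow> a (s k) \<le> a m" "\<And>k. s k < s (Suc k)"
    by blast
  then have sm: "strict_mono s" by (simp add: strict_mono_Suc_iff)
  moreover have "a (s i) \<le> a (s j)" if "i \<le> j" for i j
    using s(1) strict_mono_leD[OF sm that] .
  ultimately show ?thesis by blast
qed

text \<open>Nash-Williams: a minimal bad sequence yields a smaller bad sequence of tails.\<close>

theorem higman_nat_lists:
  fixes f :: "nat \<Rightarrow> nat list"
  shows "\<exists>i j. i < j \<and> list_emb (\<le>) (f i) (f j)"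
proof (rule ccontr)
  assume asm: "\<not> ?thesis"
  define bad where "bad g \<longleftrightarrow> (\<forall>i j. i < j \<longrightarrow> \<not> list_emb (\<le>) (g i) (g j))" for g :: "nat \<Rightarrow> nat list"
  have badD: False if "bad g" "i < j" "list_emb (\<le>) (g i) (g j)" for g i j
    using that unfolding bad_def by blast
  define least where "least n g \<longleftrightarrow>
    (\<forall>h. bad h \<longrightarrow> (\<forall>i<n. h i = g i) \<longrightarrow> length (g n) \<le> length (h n))" for n g
  have step: "\<exists>h. (bad h \<and> least n h) \<and> (\<forall>i<n. h i = g i)" if "bad g" for g n
  proof -
    have "bad g \<and> (\<forall>i<n. g i = g i)" using that by simp
    from ex_has_least_nat[where P = "\<lambda>h. bad h \<and> (\<forall>i<n. h i = g i)", OF this, of "\<lambda>h. length (h n)"]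
    obtain h where h: "bad h \<and> (\<forall>i<n. h i = g i)"
      "\<And>k. bad k \<and> (\<forall>i<n. k i = g i) \<Longrightarrow> length (h n) \<le> length (k n)"
      by metis
    then have "least n h" unfolding least_def by simp
    then show ?thesis using h(1) by blast
  qed
  have "\<exists>F. \<forall>n. (bad (F n) \<and> least n (F n)) \<and> (\<forall>i<Suc n. F (Suc n) i = F n i)"
  proof (rule dependent_nat_choice)
    have "bad f" using asm unfolding bad_def by blast
    then show "\<exists>g. bad g \<and> least 0 g" using step[of f 0] by blast
    show "\<exists>y. (bad y \<and> least (Suc n) y) \<and> (\<forall>i<Suc n. y i = x i)" if "bad x \<and> least n x" for x n
      using step[of x "Suc n"] that by blast
  qed
  then obtain F where F: "\<And>n. bad (F n)" "\<And>n. least n (F n)" "\<And>n i. i \<le> n \<Longrightarrow> F (Suc n) i = F n i"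
    by (auto simp: less_Suc_eq_le)
  \<comment> \<open>\<open>F (Suc n)\<close> leaves the positions up to \<open>n\<close> alone, so
    the diagonal agrees with \<open>F m\<close> up to position \<open>m\<close>. Badness involves
    two positions at a time and therefore passes to the diagonal.\<close>
  define h where "h i = F i i" for i
  have h: "F m i = h i" if "i \<le> m" for i m
    using that by (induction m rule: dec_induct) (simp_all add: h_def F(3))
  have badh: "bad h"
    unfolding bad_def
  proof (intro allI impI)
    fix i j :: nat assume "i < j"
    then have "\<not> list_emb (\<le>) (F j i) (F j j)" using F(1)[of j] unfolding bad_def by blast
    then show "\<not> list_emb (\<le>) (h i) (h j)" using \<open>i < j\<close> h[of i j] h[of j j] by simp
  qed
  have leasth: "length (h n) \<le> length (g n)" if "bad g" "\<And>i. i < n \<Longrightarrow> g i = h i" for g n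
  proof -
    have "\<forall>i<n. g i = F n i" using that(2) h by simp
    then show ?thesis using F(2)[of n] that(1) h[of n n] unfolding least_def by fastforce
  qed
  have ne: "h n \<noteq> []" for n
  proof
    assume "h n = []"
    then have "list_emb (\<le>) (h n) (h (Suc n))" by simp
    then show False using badD[OF badh] by blast
  qed
  obtain s :: "nat \<Rightarrow> nat" where s: "strict_mono s" "\<And>i j. i \<le> j \<Longrightarrow> hd (h (s i)) \<le> hd (h (s j))"
    using ex_nondecreasing_subseq[of "\<lambda>n. hd (h n)"] by blast
  \<comment> \<open>Along \<open>s\<close> the heads do not decrease, so an embedding of two tails
    extends to the full lists; an embedding of an earlier \<open>h i\<close> into a tail extends to
    the full list anyway. Thus \<open>g\<close> is bad, agrees with \<open>h\<close> before
    \<open>s 0\<close>, and is shorter at \<open>s 0\<close>.\<close>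
  define g where "g i = (if i < s 0 then h i else tl (h (s (i - s 0))))" for i
  have tl: "list_emb (\<le>) xs (h n)" if "list_emb (\<le>) xs (tl (h n))" for xs n
    using that ne[of n] by (cases "h n") auto
  have "bad g"
    unfolding bad_def
  proof (intro allI impI notI)
    fix i j :: nat assume ij: "i < j" and e: "list_emb (\<le>) (g i) (g j)"
    consider "j < s 0" | "i < s 0" "s 0 \<le> j" | "s 0 \<le> i" by linarith
    then show False
    proof cases
      case 1
      then have "list_emb (\<le>) (h i) (h j)" using ij e by (simp add: g_def)
      then show False using badD[OF badh] ij by blast
    next
      case 2
      have "s 0 \<le> s (j - s 0)" using s(1) by (simp add: strict_mono_less_eq)
      then have "i < s (j - s 0)" using 2 by linarith
      moreover have "list_emb (\<le>) (h i) (h (s (j - s 0)))" using 2 e by (intro tl) (simp add: g_def)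
      ultimately show False using badD[OF badh] by blast
    next
      case 3
      let ?i = "s (i - s 0)" and ?j = "s (j - s 0)"
      have "list_emb (\<le>) (tl (h ?i)) (tl (h ?j))" using 3 e ij by (simp add: g_def)
      moreover have "hd (h ?i) \<le> hd (h ?j)" using ij 3 by (intro s(2)) simp
      ultimately have "list_emb (\<le>) (h ?i) (h ?j)"
        using ne[of ?i] ne[of ?j] by (cases "h ?i"; cases "h ?j") auto
      moreover have "?i < ?j" using s(1) ij 3 by (simp add: strict_mono_less)
      ultimately show False using badD[OF badh] by blast
    qed
  qed
  then have "length (h (s 0)) \<le> length (g (s 0))" by (rule leasth) (simp add: g_def)
  then show False using ne[of "s 0"] by (cases "h (s 0)") (simp_all add: g_def)
qed

text \<open>The matching of positions is defined on all of \<open>nat\<close>, so that it can act as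
  an order preserving renaming of all indeterminates. Skipping \<open>y\<close> shifts it by one;
  matching \<open>x\<close> with \<open>y\<close> shifts it and sends \<open>0\<close> to
  \<open>0\<close>.\<close>

lemma list_emb_strict_mono:
  assumes "list_emb P xs ys"
  shows "\<exists>\<iota>. strict_mono \<iota> \<and> (\<forall>k<length xs. \<iota> k < length ys \<and> P (xs ! k) (ys ! \<iota> k))"
  using assms
proof induction
  case (list_emb_Nil ys)
  show ?case by (rule exI[of _ id]) (simp add: strict_mono_def)
next
  case (list_emb_Cons xs ys y)
  then obtain \<iota> where \<iota>: "strict_mono \<iota>" "\<And>k. k < length xs \<Longrightarrow> \<iota> k < length ys \<and> P (xs ! k) (ys ! \<iota> k)"
    by blast
  show ?case by (rule exI[of _ "\<lambda>k. Suc (\<iota> k)"]) (use \<iota> in \<open>auto simp: strict_mono_def\<close>)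
next
  case (list_emb_Cons2 x y xs ys)
  then obtain \<iota> where \<iota>: "strict_mono \<iota>" "\<And>k. k < length xs \<Longrightarrow> \<iota> k < length ys \<and> P (xs ! k) (ys ! \<iota> k)"
    by blast
  show ?case
    by (rule exI[of _ "\<lambda>k. case k of 0 \<Rightarrow> 0 | Suc l \<Rightarrow> Suc (\<iota> l)"])
      (use \<iota> list_emb_Cons2(1) in \<open>auto simp: strict_mono_def split: nat.splits\<close>)
qed

section \<open>Monomials and the symmetric cancellation order\<close>

text \<open>The complements of domain and image in \<open>{..<N}\<close> have equal size, so any
  bijection between them completes the permutation. This replaces a renaming by a group element with
  the same effect on the first \<open>m\<close> indeterminates.\<close>

lemma ex_permutes_extending:
  assumes "inj_on \<phi> {..<m}" "\<phi> ` {..<m} \<subseteq> {..<N::nat}"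
  shows "\<exists>\<sigma>. \<sigma> permutes {..<N} \<and> (\<forall>i<m. \<sigma> i = \<phi> i)"
proof -
  have mN: "m \<le> N"
    using card_inj_on_le[OF assms] by simp
  have "card ({..<N} - {..<m}) = card ({..<N} - \<phi> ` {..<m})"
    using mN assms by (simp add: card_Diff_subset card_image)
  then obtain \<psi> where \<psi>: "bij_betw \<psi> ({..<N} - {..<m}) ({..<N} - \<phi> ` {..<m})"
    using finite_same_card_bij[of "{..<N} - {..<m}" "{..<N} - \<phi> ` {..<m}"] by auto
  define \<sigma> where "\<sigma> i = (if i < m then \<phi> i else if i < N then \<psi> i else i)" for i
  have "bij_betw \<sigma> {..<m} (\<phi> ` {..<m})"
    using assms(1) by (subst bij_betw_cong[of _ _ \<phi>]) (auto simp: \<sigma>_def bij_betw_def)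
  moreover have "bij_betw \<sigma> ({..<N} - {..<m}) ({..<N} - \<phi> ` {..<m})"
    using \<psi> by (subst bij_betw_cong[of _ _ \<psi>]) (auto simp: \<sigma>_def)
  ultimately have "bij_betw \<sigma> ({..<m} \<union> ({..<N} - {..<m})) (\<phi> ` {..<m} \<union> ({..<N} - \<phi> ` {..<m}))"
    by (rule bij_betw_combine) blast
  moreover have "{..<m} \<union> ({..<N} - {..<m}) = {..<N}" using mN by auto
  moreover have "\<phi> ` {..<m} \<union> ({..<N} - \<phi> ` {..<m}) = {..<N}" using assms(2) by blast
  ultimately have "bij_betw \<sigma> {..<N} {..<N}" by simp
  then have "\<sigma> permutes {..<N}"
    by (rule bij_imp_permutes) (use mN in \<open>simp add: \<sigma>_def\<close>)
  then show ?thesis by (auto simp: \<sigma>_def)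
qed

text \<open>Padding \<open>A\<close> with all large numbers makes its increasing enumeration total.
  The members of \<open>A\<close> come first, so counting those up to \<open>a\<close> bounds the
  position of \<open>a\<close> by \<open>card A\<close>.\<close>

lemma ex_strict_mono_covering:
  fixes A :: "nat set"
  assumes "finite A" "card A \<le> N"
  shows "\<exists>\<iota>::nat \<Rightarrow> nat. strict_mono \<iota> \<and> A \<subseteq> \<iota> ` {..<N}"
proof -
  obtain M where M: "A \<subseteq> {..<M}"
    using finite_nat_iff_bounded[THEN iffD1, OF assms(1)] by auto
  define S where "S = A \<union> {M..}"
  have inf: "infinite S" by (simp add: S_def infinite_Ici)
  have "a \<in> enumerate S ` {..<N}" if a: "a \<in> A" for a
  proof -
    have "a \<in> S" using a by (simp add: S_def)
    obtain k where k: "enumerate S k = a"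
      using enumerate_Ex[OF inf \<open>a \<in> S\<close>] by blast
    have "enumerate S ` {..k} \<subseteq> A"
    proof
      fix b assume "b \<in> enumerate S ` {..k}"
      then obtain l where "l \<le> k" "b = enumerate S l" by auto
      then have "b \<le> a" "b \<in> S" using k inf by (auto simp: enumerate_in_set)
      then show "b \<in> A" using M a unfolding S_def by auto
    qed
    then have "card (enumerate S ` {..k}) \<le> card A"
      by (rule card_mono[OF assms(1)])
    then have "Suc k \<le> card A"
      using inf by (simp add: card_image inj_on_subset[OF inj_enumerate])
    then show ?thesis using assms(2) k by auto
  qed
  then show ?thesis
    using strict_mono_enumerate[OF inf] by (intro exI[of _ "enumerate S"]) blast
qed

section \<open>Renaming of monomials and divisibility\<close>

lemma lookup_perm_mon_sum:
  "Poly_Mapping.lookup (perm_mon \<sigma> u) k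
    = (\<Sum>i\<in>Poly_Mapping.keys u. if \<sigma> i = k then Poly_Mapping.lookup u i else 0)"
  by (simp add: perm_mon_def Poly_Mapping.lookup_sum Poly_Mapping.lookup_single when_def)

lemma lookup_perm_mon:
  assumes "inj \<sigma>"
  shows "Poly_Mapping.lookup (perm_mon \<sigma> u) (\<sigma> i) = Poly_Mapping.lookup u i"
  using assms by (simp add: lookup_perm_mon_sum inj_eq in_keys_iff)

lemma lookup_perm_mon_notin_range:
  "k \<notin> range \<sigma> \<Longrightarrow> Poly_Mapping.lookup (perm_mon \<sigma> u) k = 0"
  by (auto simp: lookup_perm_mon_sum intro!: sum.neutral)

lemma perm_mon_cong:
  "(\<And>i. i \<in> Poly_Mapping.keys u \<Longrightarrow> \<sigma> i = \<tau> i) \<Longrightarrow> perm_mon \<sigma> u = perm_mon \<tau> u"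
  unfolding perm_mon_def by (rule sum.cong) simp_all

lemma perm_mon_eq_iff:
  assumes "inj \<sigma>"
  shows "perm_mon \<sigma> u = perm_mon \<sigma> v \<longleftrightarrow> u = v"
  using lookup_perm_mon[OF assms] by (metis poly_mapping_eqI)

lemma perm_mon_single: "perm_mon \<sigma> (Poly_Mapping.single i e) = Poly_Mapping.single (\<sigma> i) e"
  by (cases "e = 0") (simp_all add: perm_mon_def)

lemma perm_mon_minus:
  assumes "inj \<sigma>"
  shows "perm_mon \<sigma> (u - v) = perm_mon \<sigma> u - perm_mon \<sigma> v"
proof (rule poly_mapping_eqI)
  fix k
  show "Poly_Mapping.lookup (perm_mon \<sigma> (u - v)) k = Poly_Mapping.lookup (perm_mon \<sigma> u - perm_mon \<sigma> v) k"
    using assms by (cases "k \<in> range \<sigma>")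
      (auto simp: lookup_perm_mon lookup_minus lookup_perm_mon_notin_range)
qed

lemma mon_divides_iff:
  "mon_divides u w \<longleftrightarrow> (\<forall>i. Poly_Mapping.lookup u i \<le> Poly_Mapping.lookup w i)"
proof
  assume "\<forall>i. Poly_Mapping.lookup u i \<le> Poly_Mapping.lookup w i"
  then have "w = u + (w - u)"
    by (intro poly_mapping_eqI) (simp add: lookup_add lookup_minus)
  then show "mon_divides u w" unfolding mon_divides_def by blast
qed (auto simp: mon_divides_def lookup_add)

lemma mon_divides_trans: "mon_divides u v \<Longrightarrow> mon_divides v w \<Longrightarrow> mon_divides u w"
  by (auto simp: mon_divides_iff intro: le_trans)

lemma mon_divides_perm_mon_iff:
  assumes "inj \<sigma>"
  shows "mon_divides (perm_mon \<sigma> u) w \<longleftrightarrow>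
    (\<forall>i. Poly_Mapping.lookup u i \<le> Poly_Mapping.lookup w (\<sigma> i))"
proof
  assume asm: "\<forall>i. Poly_Mapping.lookup u i \<le> Poly_Mapping.lookup w (\<sigma> i)"
  show "mon_divides (perm_mon \<sigma> u) w"
    unfolding mon_divides_iff
  proof
    fix k
    show "Poly_Mapping.lookup (perm_mon \<sigma> u) k \<le> Poly_Mapping.lookup w k"
      using asm assms by (cases "k \<in> range \<sigma>") (auto simp: lookup_perm_mon lookup_perm_mon_notin_range)
  qed
qed (metis mon_divides_iff lookup_perm_mon[OF assms])

lemma mon_divides_perm_mon:
  "mon_divides u w \<Longrightarrow> mon_divides (perm_mon \<sigma> u) (perm_mon \<sigma> w)"
  unfolding mon_divides_def by (auto simp: perm_mon_add)

section \<open>The lexicographic order and order preserving renamings\<close>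

lemma mon_less_irrefl: "\<not> mon_less u u"
  by (simp add: mon_less_def)

lemma mon_less_trans: "mon_less u v \<Longrightarrow> mon_less v w \<Longrightarrow> mon_less u w"
proof -
  assume "mon_less u v" "mon_less v w"
  then obtain i j where
    i: "Poly_Mapping.lookup u i < Poly_Mapping.lookup v i"
      "\<And>k. k > i \<Longrightarrow> Poly_Mapping.lookup u k = Poly_Mapping.lookup v k" and
    j: "Poly_Mapping.lookup v j < Poly_Mapping.lookup w j"
      "\<And>k. k > j \<Longrightarrow> Poly_Mapping.lookup v k = Poly_Mapping.lookup w k"
    unfolding mon_less_def by blast
  show "mon_less u w"
    unfolding mon_less_def
  proof (intro exI[of _ "max i j"] conjI allI impI)
    consider "i < j" | "i = j" | "j < i" by linarith
    then show "Poly_Mapping.lookup u (max i j) < Poly_Mapping.lookup w (max i j)"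
      using i j by cases (force simp: max_def)+
  qed (use i j in simp)
qed

lemma mon_less_linear: "mon_less u v \<or> u = v \<or> mon_less v u"
proof (cases "u = v")
  case False
  let ?D = "{i. Poly_Mapping.lookup u i \<noteq> Poly_Mapping.lookup v i}"
  have "?D \<subseteq> Poly_Mapping.keys u \<union> Poly_Mapping.keys v" by (auto simp: in_keys_iff)
  then have fin: "finite ?D" by (rule finite_subset) simp
  have ne: "?D \<noteq> {}" using False by (auto intro: poly_mapping_eqI)
  let ?i = "Max ?D"
  have "Poly_Mapping.lookup u ?i \<noteq> Poly_Mapping.lookup v ?i"
    using Max_in[OF fin ne] by simp
  then consider "Poly_Mapping.lookup u ?i < Poly_Mapping.lookup v ?i"
    | "Poly_Mapping.lookup v ?i < Poly_Mapping.lookup u ?i" by linarith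
  moreover have "Poly_Mapping.lookup u j = Poly_Mapping.lookup v j" if "j > ?i" for j
    using Max_ge[OF fin, of j] that by (meson leD mem_Collect_eq)
  then have "\<forall>j>?i. Poly_Mapping.lookup u j = Poly_Mapping.lookup v j"
    "\<forall>j>?i. Poly_Mapping.lookup v j = Poly_Mapping.lookup u j" by metis+
  ultimately show ?thesis
    unfolding mon_less_def by cases blast+
qed simp

lemma mon_less_asym: "mon_less u v \<Longrightarrow> \<not> mon_less v u"
  using mon_less_trans mon_less_irrefl by blast

lemma mon_le_iff_not_less: "mon_le u v \<longleftrightarrow> \<not> mon_less v u"
  unfolding mon_le_def using mon_less_linear mon_less_asym mon_less_irrefl by blast

lemma mon_le_refl: "mon_le u u"
  by (simp add: mon_le_def)

lemma mon_le_trans: "mon_le u v \<Longrightarrow> mon_le v w \<Longrightarrow> mon_le u w"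
  unfolding mon_le_def using mon_less_trans by blast

lemma mon_le_antisym: "mon_le u v \<Longrightarrow> mon_le v u \<Longrightarrow> u = v"
  unfolding mon_le_def using mon_less_asym by blast

lemma mon_less_add_cancel: "mon_less (w + u) (w + v) \<longleftrightarrow> mon_less u v"
  by (simp add: mon_less_def lookup_add)

lemma mon_le_add_cancel: "mon_le (w + u) (w + v) \<longleftrightarrow> mon_le u v"
  by (simp add: mon_le_def mon_less_add_cancel)

lemma mon_less_single:
  "mon_less (Poly_Mapping.single i (Suc 0)) (Poly_Mapping.single j (Suc 0)) \<longleftrightarrow> i < j"
proof
  assume "mon_less (Poly_Mapping.single i (Suc 0)) (Poly_Mapping.single j (Suc 0))"
  then show "i < j" unfolding mon_less_def
    by (auto simp: lookup_single when_def split: if_splits)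
next
  assume "i < j"
  then show "mon_less (Poly_Mapping.single i (Suc 0)) (Poly_Mapping.single j (Suc 0))"
    unfolding mon_less_def by (intro exI[of _ j]) (simp add: lookup_single when_def)
qed

lemma mon_divides_imp_le:
  assumes "mon_divides u w"
  shows "mon_le u w"
  unfolding mon_le_iff_not_less
  using assms unfolding mon_divides_iff mon_less_def by (metis leD)

text \<open>The last index at which \<open>u\<close> and \<open>v\<close> differ is carried to the
  last index at which the images differ; indices outside the range of \<open>\<iota>\<close> have
  exponent zero in both images. The converse follows by linearity.\<close>

lemma mon_less_perm_mon:
  assumes "strict_mono \<iota>"
  shows "mon_less (perm_mon \<iota> u) (perm_mon \<iota> v) \<longleftrightarrow> mon_less u v"
proof -
  have inj: "inj \<iota>" using assms by (rule strict_mono_imp_inj_on)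
  have imp: "mon_less (perm_mon \<iota> u) (perm_mon \<iota> v)" if uv: "mon_less u v" for u v
  proof -
    obtain i where i: "Poly_Mapping.lookup u i < Poly_Mapping.lookup v i"
      "\<And>k. k > i \<Longrightarrow> Poly_Mapping.lookup u k = Poly_Mapping.lookup v k"
      using uv unfolding mon_less_def by blast
    have "Poly_Mapping.lookup (perm_mon \<iota> u) k = Poly_Mapping.lookup (perm_mon \<iota> v) k"
      if "k > \<iota> i" for k
      using that i(2) assms inj
      by (cases "k \<in> range \<iota>") (auto simp: lookup_perm_mon lookup_perm_mon_notin_range strict_mono_less)
    then show ?thesis
      unfolding mon_less_def using i(1) inj by (metis lookup_perm_mon)
  qed
  then show ?thesis
    using mon_less_linear[of u v] mon_less_asym mon_less_irrefl by blast
qed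

section \<open>The symmetric cancellation order as a condition on indices\<close>

text \<open>Replacing one factor of index \<open>j\<close> in \<open>v\<close> by one of index
  \<open>i < j\<close> gives a smaller monomial, and comparing the images compares
  \<open>\<sigma> i\<close> with \<open>\<sigma> j\<close>. Conversely, the last index
  \<open>j\<close> at which a smaller \<open>u\<close> differs from \<open>v\<close> lies in the
  support of \<open>v\<close>; all lower indices land below \<open>\<sigma> j\<close>, so beyond
  \<open>\<sigma> j\<close> the images agree.\<close>

lemma perm_mon_le_iff_increasing:
  assumes "inj \<sigma>"
  shows "(\<forall>u. mon_le u v \<longrightarrow> mon_le (perm_mon \<sigma> u) (perm_mon \<sigma> v)) \<longleftrightarrow>
    (\<forall>j\<in>Poly_Mapping.keys v. \<forall>i<j. \<sigma> i < \<sigma> j)"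
proof (intro iffI ballI allI impI)
  fix i j
  assume asm: "\<forall>u. mon_le u v \<longrightarrow> mon_le (perm_mon \<sigma> u) (perm_mon \<sigma> v)"
    and j: "j \<in> Poly_Mapping.keys v" and ij: "i < j"
  define w where "w = v - Poly_Mapping.single j 1"
  have v: "v = w + Poly_Mapping.single j 1"
  proof (rule poly_mapping_eqI)
    fix k show "Poly_Mapping.lookup v k = Poly_Mapping.lookup (w + Poly_Mapping.single j 1) k"
      using j by (auto simp: w_def lookup_add lookup_minus lookup_single when_def in_keys_iff)
  qed
  have "mon_le (w + Poly_Mapping.single i 1) v"
    using ij by (subst v) (simp add: mon_le_def mon_less_add_cancel mon_less_single)
  then have "mon_le (perm_mon \<sigma> (w + Poly_Mapping.single i 1)) (perm_mon \<sigma> v)" using asm by blast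
  then have "mon_le (Poly_Mapping.single (\<sigma> i) 1) (Poly_Mapping.single (\<sigma> j) (1::nat))"
    by (subst (asm) v) (simp only: perm_mon_add perm_mon_single mon_le_add_cancel)
  then have "\<not> \<sigma> j < \<sigma> i" by (simp add: mon_le_iff_not_less mon_less_single)
  then show "\<sigma> i < \<sigma> j"
    using ij assms by (metis inj_eq linorder_neqE_nat order_less_irrefl)
next
  fix u
  assume asm: "\<forall>j\<in>Poly_Mapping.keys v. \<forall>i<j. \<sigma> i < \<sigma> j" and "mon_le u v"
  then consider "u = v" | "mon_less u v" unfolding mon_le_def by blast
  then show "mon_le (perm_mon \<sigma> u) (perm_mon \<sigma> v)"
  proof cases
    case 2
    then obtain j where j: "Poly_Mapping.lookup u j < Poly_Mapping.lookup v j"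
      "\<And>k. k > j \<Longrightarrow> Poly_Mapping.lookup u k = Poly_Mapping.lookup v k"
      unfolding mon_less_def by blast
    have "j \<in> Poly_Mapping.keys v" using j(1) by (simp add: in_keys_iff)
    have "Poly_Mapping.lookup (perm_mon \<sigma> u) k = Poly_Mapping.lookup (perm_mon \<sigma> v) k"
      if k: "k > \<sigma> j" for k
    proof (cases "k \<in> range \<sigma>")
      case True
      then obtain l where l: "k = \<sigma> l" by blast
      then have "l > j" using asm \<open>j \<in> _\<close> k
        by (metis linorder_neqE_nat not_less_iff_gr_or_eq)
      then show ?thesis using j(2) assms l by (simp add: lookup_perm_mon)
    qed (simp add: lookup_perm_mon_notin_range)
    then have "mon_less (perm_mon \<sigma> u) (perm_mon \<sigma> v)"
      unfolding mon_less_def using j(1) assms by (metis lookup_perm_mon)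
    then show ?thesis by (simp add: mon_le_def)
  qed (simp add: mon_le_refl)
qed

text \<open>Since \<open>{..<j}\<close> is injected into \<open>{..<\<sigma> j}\<close>, no index of
  the support moves down. If \<open>l\<close> were the last index at which the image is smaller than
  \<open>v\<close>, then \<open>\<sigma>\<close> would permute the finite set of support indices
  above \<open>l\<close>; but it also sends \<open>l\<close> into that set, against
  injectivity.\<close>

lemma mon_le_perm_mon_increasing:
  assumes inj: "inj \<sigma>" and incr: "\<And>i j. j \<in> Poly_Mapping.keys v \<Longrightarrow> i < j \<Longrightarrow> \<sigma> i < \<sigma> j"
  shows "mon_le v (perm_mon \<sigma> v)"
proof (rule ccontr)
  assume "\<not> ?thesis"
  then obtain l where
    l: "Poly_Mapping.lookup (perm_mon \<sigma> v) l < Poly_Mapping.lookup v l"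
      "\<And>k. k > l \<Longrightarrow> Poly_Mapping.lookup (perm_mon \<sigma> v) k = Poly_Mapping.lookup v k"
    unfolding mon_le_iff_not_less mon_less_def by blast
  have ge: "j \<le> \<sigma> j" if "j \<in> Poly_Mapping.keys v" for j
  proof -
    have "\<sigma> ` {..<j} \<subseteq> {..<\<sigma> j}" using incr[OF that] by blast
    then have "card (\<sigma> ` {..<j}) \<le> card {..<\<sigma> j}" by (rule card_mono[rotated]) simp
    then show ?thesis using inj by (simp add: card_image inj_on_subset)
  qed
  define S where "S = {j \<in> Poly_Mapping.keys v. j > l}"
  have in_S: "\<sigma> j \<in> S" if "j \<in> Poly_Mapping.keys v" "\<sigma> j > l" for j
    using that l(2)[of "\<sigma> j"] inj by (simp add: S_def lookup_perm_mon in_keys_iff)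
  have "\<sigma> ` S \<subseteq> S"
    using in_S ge unfolding S_def by fastforce
  then have S: "\<sigma> ` S = S"
    using inj by (intro endo_inj_surj) (auto simp: S_def intro: inj_on_subset)
  have lv: "l \<in> Poly_Mapping.keys v" using l(1) by (simp add: in_keys_iff)
  have "\<sigma> l \<noteq> l" using l(1) inj by (metis lookup_perm_mon less_irrefl)
  then have "\<sigma> l \<in> S" using in_S lv ge[OF lv] by simp
  then have "l \<in> S" using S inj by (metis imageE injD)
  then show False by (simp add: S_def)
qed

text \<open>Only pairs of indices are quantified here, which is what \<open>exps_sym_le\<close>
  later tests. In the backward direction \<open>mon_le v w\<close> comes from passing through the
  renamed copy of \<open>v\<close>, which divides \<open>w\<close>.\<close>

lemma sym_le_iff:
  "sym_le v w \<longleftrightarrow> (\<exists>\<sigma>. bij \<sigma> \<and> mon_divides (perm_mon \<sigma> v) w \<and>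
      (\<forall>j\<in>Poly_Mapping.keys v. \<forall>i<j. \<sigma> i < \<sigma> j))"
  unfolding sym_le_def
  using perm_mon_le_iff_increasing[OF bij_is_inj] mon_le_perm_mon_increasing[OF bij_is_inj]
    mon_divides_imp_le mon_le_trans
  by meson

lemma perm_mon_id: "perm_mon id u = u"
  unfolding perm_mon_def id_apply by (rule sum_single_keys)

lemma sym_le_refl: "sym_le v v"
  unfolding sym_le_def
  by (intro conjI exI[of _ id]) (simp_all add: perm_mon_id mon_le_refl mon_divides_iff)

text \<open>The permutations compose: \<open>perm_mon \<sigma> u\<close> divides \<open>v\<close>,
  so \<open>\<sigma>\<close> takes the support of \<open>u\<close> into that of \<open>v\<close>,
  where the monotonicity of \<open>\<tau>\<close> is available.\<close>

lemma sym_le_trans: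
  assumes "sym_le u v" "sym_le v w"
  shows "sym_le u w"
proof -
  obtain \<sigma> where \<sigma>: "bij \<sigma>" "mon_divides (perm_mon \<sigma> u) v"
    "\<And>i j. j \<in> Poly_Mapping.keys u \<Longrightarrow> i < j \<Longrightarrow> \<sigma> i < \<sigma> j"
    using assms(1) unfolding sym_le_iff by auto
  obtain \<tau> where \<tau>: "bij \<tau>" "mon_divides (perm_mon \<tau> v) w"
    "\<And>i j. j \<in> Poly_Mapping.keys v \<Longrightarrow> i < j \<Longrightarrow> \<tau> i < \<tau> j"
    using assms(2) unfolding sym_le_iff by auto
  have "mon_divides (perm_mon (\<tau> \<circ> \<sigma>) u) w"
    using mon_divides_perm_mon[OF \<sigma>(2), of \<tau>] \<tau>(2) mon_divides_trans
    by (simp add: perm_mon_comp)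
  moreover have "(\<tau> \<circ> \<sigma>) i < (\<tau> \<circ> \<sigma>) j" if "j \<in> Poly_Mapping.keys u" "i < j" for i j
  proof -
    have "0 < Poly_Mapping.lookup u j" using that by (simp add: in_keys_iff)
    also have "\<dots> \<le> Poly_Mapping.lookup v (\<sigma> j)"
      using \<sigma>(1,2) by (simp add: mon_divides_perm_mon_iff bij_is_inj)
    finally have "\<sigma> j \<in> Poly_Mapping.keys v" by (simp add: in_keys_iff)
    then show ?thesis using \<sigma>(3)[OF that] \<tau>(3) by simp
  qed
  ultimately show ?thesis
    unfolding sym_le_iff using bij_comp[OF \<sigma>(1) \<tau>(1)] by blast
qed

lemma sym_le_divides: "sym_le u v \<Longrightarrow> mon_divides v w \<Longrightarrow> sym_le u w"
  unfolding sym_le_iff using mon_divides_trans by blast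

text \<open>\<open>\<iota>\<close> need not be onto. A permutation that agrees with it up to the
  last index of \<open>u\<close> has the same effect on \<open>u\<close>, and the monotonicity
  condition looks at no further indices.\<close>

lemma sym_le_perm_mon_strict_mono:
  assumes "strict_mono \<iota>"
  shows "sym_le u (perm_mon \<iota> u)"
proof -
  obtain m where m: "Poly_Mapping.keys u \<subseteq> {..<m}"
    using finite_nat_iff_bounded[THEN iffD1, OF finite_keys] by auto
  obtain N where N: "\<iota> ` {..<m} \<subseteq> {..<N}"
    using finite_nat_iff_bounded[THEN iffD1, OF finite_imageI[OF finite_lessThan]] by meson
  obtain \<sigma> where \<sigma>: "\<sigma> permutes {..<N}" "\<And>i. i < m \<Longrightarrow> \<sigma> i = \<iota> i"
    using ex_permutes_extending[OF inj_on_subset[OF strict_mono_imp_inj_on[OF assms]] N] by auto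
  have "perm_mon \<sigma> u = perm_mon \<iota> u"
    using m \<sigma>(2) by (intro perm_mon_cong) blast
  moreover have "\<sigma> i < \<sigma> j" if "j \<in> Poly_Mapping.keys u" "i < j" for i j
  proof -
    have "j < m" using that m by blast
    then show ?thesis using that(2) \<sigma>(2) assms by (simp add: strict_mono_less)
  qed
  ultimately show ?thesis
    unfolding sym_le_iff using permutes_bij[OF \<sigma>(1)] by (auto simp: mon_divides_iff intro!: exI[of _ \<sigma>])
qed

text \<open>Higman's order on exponent lists is divisibility after an order preserving renaming;
  past position \<open>m\<close> the exponents of \<open>u\<close> vanish. The bound
  \<open>\<iota> k < n\<close> is recorded because the renamed monomial has to fit into the
  indeterminates of a given round of the completion.\<close>

lemma list_emb_imp_divides:
  assumes "list_emb (\<le>) (map (Poly_Mapping.lookup u) [0..<m]) (map (Poly_Mapping.lookup w) [0..<n])"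
    and "Poly_Mapping.keys u \<subseteq> {..<m}"
  shows "\<exists>\<iota>. strict_mono \<iota> \<and> (\<forall>k<m. \<iota> k < n) \<and> mon_divides (perm_mon \<iota> u) w"
proof -
  obtain \<iota> where \<iota>: "strict_mono \<iota>"
    "\<And>k. k < m \<Longrightarrow> \<iota> k < n \<and> map (Poly_Mapping.lookup u) [0..<m] ! k \<le> map (Poly_Mapping.lookup w) [0..<n] ! \<iota> k"
    using list_emb_strict_mono[OF assms(1)] by auto
  have "Poly_Mapping.lookup u k \<le> Poly_Mapping.lookup w (\<iota> k)" for k
  proof (cases "k < m")
    case False
    then have "Poly_Mapping.lookup u k = 0" using assms(2) by (auto simp: in_keys_iff)
    then show ?thesis by simp
  next
    case True
    then have "\<iota> k < n" using \<iota>(2) by blast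
    then show ?thesis using \<iota>(2)[OF True, THEN conjunct2] True by simp
  qed
  then have "mon_divides (perm_mon \<iota> u) w"
    using mon_divides_perm_mon_iff[OF strict_mono_imp_inj_on[OF \<iota>(1)]] by blast
  then show ?thesis using \<iota> by blast
qed

text \<open>By Higman's lemma, an infinite descending chain would contain two members comparable the other
  way round.\<close>

lemma wf_mon_less: "wf {(u, v). mon_less u v}"
  unfolding wf_iff_no_infinite_down_chain
proof
  assume "\<exists>f. \<forall>i. (f (Suc i), f i) \<in> {(u, v). mon_less u v}"
  then obtain f where "\<forall>i. (f (Suc i), f i) \<in> {(u, v). mon_less u v}" ..
  then have f: "mon_less (f (Suc i)) (f i)" for i by simp
  have desc: "mon_less (f j) (f i)" if "i < j" for i j
    using that
  proof (induction j)
    case (Suc j)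
    then show ?case using f[of j] mon_less_trans[OF f[of j], of "f i"] by (cases "i = j") auto
  qed simp
  \<comment> \<open>\<open>Poly_Mapping.degree\<close> is not the total degree but one more than the
    largest index of the support, so the list contains all nonzero exponents.\<close>
  let ?d = "\<lambda>u::mon. Poly_Mapping.degree u"
  obtain i j where ij: "i < j" "list_emb (\<le>)
      (map (Poly_Mapping.lookup (f i)) [0..<?d (f i)]) (map (Poly_Mapping.lookup (f j)) [0..<?d (f j)])"
    using higman_nat_lists[of "\<lambda>i. map (Poly_Mapping.lookup (f i)) [0..<?d (f i)]"] by blast
  have "Poly_Mapping.keys (f i) \<subseteq> {..<?d (f i)}" using in_keys_less_degree by blast
  from list_emb_imp_divides[OF ij(2) this] obtain \<iota>
    where \<iota>: "strict_mono \<iota>" "mon_divides (perm_mon \<iota> (f i)) (f j)" by blast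
  have "sym_le (f i) (f j)"
    using sym_le_perm_mon_strict_mono[OF \<iota>(1)] \<iota>(2) sym_le_divides by blast
  then have "mon_le (f i) (f j)" by (simp add: sym_le_def)
  then show False using desc[OF ij(1)] by (simp add: mon_le_iff_not_less)
qed

section \<open>S-polynomials and Buchberger's criterion\<close>

interpretation poly_vs: module poly_scale
  by (rule module_poly_scale)

interpretation poly_ideal: module "(*) :: 'a::comm_ring_1 \<Rightarrow> 'a \<Rightarrow> 'a"
  by (rule module_mult)

section \<open>Leading monomials and leading coefficients\<close>

lemma ex_mon_greatest:
  assumes "finite A" "A \<noteq> {}"
  shows "\<exists>w\<in>A. \<forall>u\<in>A. mon_le u w"
  using assms
proof (induction A rule: finite_ne_induct)
  case (insert x A)
  then obtain w where w: "w \<in> A" "\<forall>u\<in>A. mon_le u w" by auto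
  show ?case
  proof (cases "mon_le x w")
    case True
    then show ?thesis using w by auto
  next
    case False
    then have "mon_le w x" unfolding mon_le_iff_not_less using mon_less_asym by blast
    then have "\<forall>u\<in>insert x A. mon_le u x" using w(2) mon_le_trans mon_le_refl by blast
    then show ?thesis by blast
  qed
qed (simp add: mon_le_refl)

text \<open>\<open>lead_mon 0\<close> is unspecified; fixing the value \<open>0\<close> there makes the equations below
  unconditional.\<close>

definition lm :: "'k::zero mpoly \<Rightarrow> mon" where
  "lm f = (if f = 0 then 0 else lead_mon f)"

definition lc :: "'k::zero mpoly \<Rightarrow> 'k" where
  "lc f = Poly_Mapping.lookup f (lm f)"

lemma lm_eqI:
  assumes "w \<in> Poly_Mapping.keys f" "\<And>u. u \<in> Poly_Mapping.keys f \<Longrightarrow> mon_le u w"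
  shows "lm f = w"
proof -
  have "lead_mon f = w"
    unfolding lead_mon_def
    by (rule the_equality) (use assms mon_le_antisym in auto)
  then show ?thesis using assms(1) by (auto simp: lm_def)
qed

lemma lm_greatest:
  assumes "f \<noteq> 0"
  shows "lm f \<in> Poly_Mapping.keys f \<and> (\<forall>u\<in>Poly_Mapping.keys f. mon_le u (lm f))"
proof -
  have "Poly_Mapping.keys f \<noteq> {}"
    using assms by (metis Poly_Mapping.poly_mapping_eqI empty_iff in_keys_iff lookup_zero)
  then obtain w where w: "w \<in> Poly_Mapping.keys f" "\<forall>u\<in>Poly_Mapping.keys f. mon_le u w"
    using ex_mon_greatest[OF finite_keys] by auto
  then show ?thesis using lm_eqI[of w f] by auto
qed

lemma lm_in_keys: "f \<noteq> 0 \<Longrightarrow> lm f \<in> Poly_Mapping.keys f"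
  using lm_greatest by blast

lemma lm_max: "u \<in> Poly_Mapping.keys f \<Longrightarrow> mon_le u (lm f)"
  using lm_greatest[of f] by (cases "f = 0") auto

lemma lc_eq_0_iff: "lc f = 0 \<longleftrightarrow> f = 0"
  using lm_in_keys[of f] by (auto simp: lc_def in_keys_iff)

lemma lookup_single_times:
  fixes f :: "'k::comm_ring_1 mpoly"
  shows "Poly_Mapping.lookup (Poly_Mapping.single m c * f) (m + u) = c * Poly_Mapping.lookup f u"
proof -
  have "Poly_Mapping.single m c * f
      = Poly_Mapping.single m c * (\<Sum>u\<in>Poly_Mapping.keys f. Poly_Mapping.single u (Poly_Mapping.lookup f u))"
    by (simp only: sum_single_keys)
  also have "\<dots> = (\<Sum>u\<in>Poly_Mapping.keys f. Poly_Mapping.single (m + u) (c * Poly_Mapping.lookup f u))"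
    by (simp add: sum_distrib_left mult_single)
  finally show ?thesis
    by (simp add: Poly_Mapping.lookup_sum Poly_Mapping.lookup_single when_def in_keys_iff)
qed

lemma keys_single_times:
  fixes f :: "'k::comm_ring_1 mpoly"
  shows "Poly_Mapping.keys (Poly_Mapping.single m c * f) \<subseteq> (+) m ` Poly_Mapping.keys f"
  using keys_mult[of "Poly_Mapping.single m c" f] by (auto split: if_splits)

lemma lookup_poly_scale:
  "Poly_Mapping.lookup (poly_scale c f) u = c * Poly_Mapping.lookup f u"
  using lookup_single_times[of 0 c f u] by (simp add: poly_scale_def)

lemma single_times_eq_poly_scale:
  "Poly_Mapping.single m c * f = poly_scale c (Poly_Mapping.single m 1 * f)"
  by (simp add: poly_scale_def mult_single flip: mult.assoc)

lemma single_times_poly_scale: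
  "Poly_Mapping.single m c * poly_scale d f = poly_scale d (Poly_Mapping.single m c * f)"
  unfolding poly_scale_def by (rule mult.left_commute)

lemma lm_single_times:
  fixes f :: "'k::field mpoly"
  assumes "c \<noteq> 0" "f \<noteq> 0"
  shows "lm (Poly_Mapping.single m c * f) = m + lm f"
proof (rule lm_eqI)
  show "m + lm f \<in> Poly_Mapping.keys (Poly_Mapping.single m c * f)"
    using lm_in_keys[OF assms(2)] assms(1) by (simp add: in_keys_iff lookup_single_times)
  show "mon_le u (m + lm f)" if "u \<in> Poly_Mapping.keys (Poly_Mapping.single m c * f)" for u
    using that keys_single_times[of m c f] lm_max[of _ f] by (auto simp: mon_le_add_cancel)
qed

text \<open>Truncated subtraction makes \<open>(lm g - lm f) + lm f\<close> the least common multiple of the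
  leading monomials. If \<open>lm g\<close> divides \<open>lm f\<close>, then \<open>spol f g\<close> is, up to a nonzero scalar, the
  result of cancelling the leading term of \<open>f\<close> by a multiple of \<open>g\<close>.\<close>

definition spol :: "'k::field mpoly \<Rightarrow> 'k mpoly \<Rightarrow> 'k mpoly" where
  "spol f g = Poly_Mapping.single (lm g - lm f) (lc g) * f
            - Poly_Mapping.single (lm f - lm g) (lc f) * g"

lemma mon_lcm_commute: "(v - u) + u = (u - v) + (v :: mon)"
  by (rule poly_mapping_eqI) (simp add: lookup_add lookup_minus)

lemma mon_lcm_dvd: "mon_divides v u \<Longrightarrow> (v - u) + u = u"
  by (rule poly_mapping_eqI) (simp add: lookup_add lookup_minus mon_divides_iff)

lemma mon_lcm_least:
  assumes "mon_divides u w" "mon_divides v w"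
  shows "w = (w - ((v - u) + u)) + (v - u) + u"
proof (rule poly_mapping_eqI)
  fix k
  have "Poly_Mapping.lookup u k \<le> Poly_Mapping.lookup w k" "Poly_Mapping.lookup v k \<le> Poly_Mapping.lookup w k"
    using assms by (simp_all add: mon_divides_iff)
  then show "Poly_Mapping.lookup w k = Poly_Mapping.lookup ((w - ((v - u) + u)) + (v - u) + u) k"
    by (simp add: lookup_add lookup_minus)
qed

text \<open>Both multiples lead with the least common multiple, and both have the coefficient
  \<open>lc f * lc g\<close> there, which cancels.\<close>

lemma keys_spol:
  assumes "u \<in> Poly_Mapping.keys (spol f g)"
  shows "mon_less u ((lm g - lm f) + lm f)"
proof -
  let ?l = "(lm g - lm f) + lm f"
  have "u \<in> (+) (lm g - lm f) ` Poly_Mapping.keys f \<union> (+) (lm f - lm g) ` Poly_Mapping.keys g"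
    using assms keys_diff[of "Poly_Mapping.single (lm g - lm f) (lc g) * f"] keys_single_times
    unfolding spol_def by blast
  then have "mon_le u ?l"
  proof
    assume "u \<in> (+) (lm f - lm g) ` Poly_Mapping.keys g"
    then show ?thesis using lm_max[of _ g] unfolding mon_lcm_commute[of "lm g"] by (auto simp: mon_le_add_cancel)
  qed (use lm_max[of _ f] in \<open>auto simp: mon_le_add_cancel\<close>)
  moreover have "Poly_Mapping.lookup (spol f g) ?l = 0"
    using lookup_single_times[of "lm f - lm g" "lc f" g "lm g"]
      lookup_single_times[of "lm g - lm f" "lc g" f "lm f"] mon_lcm_commute[of "lm g" "lm f"]
    by (simp add: spol_def lookup_minus lc_def)
  ultimately show ?thesis
    using assms unfolding mon_le_def by (auto simp: in_keys_iff)
qed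

section \<open>Representations below a monomial and the ordinary criterion\<close>

text \<open>Taken at the least common multiple of two leading monomials, this is the weak form of a
  standard representation: every summand leads strictly below the cancelled term, though not
  necessarily below the leading monomial of the sum.\<close>

definition span_below :: "'k::field mpoly set \<Rightarrow> mon \<Rightarrow> 'k mpoly set" where
  "span_below G w =
     poly_vs.span {Poly_Mapping.single m 1 * g |m g. g \<in> G \<and> mon_less (m + lm g) w}"

lemma single_times_span_below:
  assumes "f \<in> span_below G w"
  shows "Poly_Mapping.single d 1 * f \<in> span_below G (d + w)"
  using assms unfolding span_below_def
proof (induction rule: poly_vs.span_induct_alt)
  case (step c x y)
  then obtain m g where x: "x = Poly_Mapping.single m 1 * g" "g \<in> G" "mon_less (m + lm g) w"
    by auto
  have "Poly_Mapping.single d 1 * x = Poly_Mapping.single (d + m) 1 * g"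
    by (simp add: x mult_single flip: mult.assoc)
  moreover have "mon_less (d + m + lm g) (d + w)"
    using x(3) by (simp add: mon_less_add_cancel add.assoc)
  ultimately have "Poly_Mapping.single d 1 * x \<in>
      {Poly_Mapping.single m 1 * g |m g. g \<in> G \<and> mon_less (m + lm g) (d + w)}"
    using x(2) by blast
  then show ?case
    using step.IH unfolding distrib_left single_times_poly_scale
    by (intro poly_vs.span_add[OF poly_vs.span_scale[OF poly_vs.span_base]])
qed (simp add: poly_vs.span_zero)

text \<open>For each monomial \<open>w\<close> that leads some multiple of an element of
  \<open>G\<close>, one such multiple \<open>h w\<close> is fixed. By induction along the monomial
  order all multiples lie in the linear span of the chosen ones. These have pairwise different
  leading monomials, so in a combination the greatest one survives. This takes the place of the
  usual choice of a representation with least top monomial.\<close>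

theorem buchberger:
  fixes G :: "'k::field mpoly set"
  assumes G0: "0 \<notin> G"
    and spol: "\<And>g h. g \<in> G \<Longrightarrow> h \<in> G \<Longrightarrow> spol g h \<in> span_below G ((lm h - lm g) + lm g)"
    and f: "f \<in> poly_ideal.span G" "f \<noteq> 0"
  shows "\<exists>g\<in>G. mon_divides (lm g) (lm f)"
proof -
  define U where "U = {m + lm g |m g. g \<in> G}"
  have "\<forall>w\<in>U. \<exists>x. \<exists>m. \<exists>g\<in>G. x = Poly_Mapping.single m 1 * g \<and> w = m + lm g"
    unfolding U_def by blast
  then obtain h where h: "\<forall>w\<in>U. \<exists>m. \<exists>g\<in>G. h w = Poly_Mapping.single m 1 * g \<and> w = m + lm g"
    by (rule bchoice[THEN exE])
  have lm_h: "lm (h w) = w" if w: "w \<in> U" for w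
  proof -
    obtain m g where "g \<in> G" "h w = Poly_Mapping.single m 1 * g" "w = m + lm g"
      using h w by auto
    then show ?thesis using G0 by (metis lm_single_times zero_neq_one)
  qed
  let ?V = "poly_vs.span (h ` U)"
  have mult_in: "Poly_Mapping.single m 1 * g \<in> ?V" if "g \<in> G" "m + lm g = w" for m g w
    using that
  proof (induction w arbitrary: m g rule: wf_induct_rule[OF wf_mon_less])
    case (1 w)
    have w: "w \<in> U" using 1(2,3) unfolding U_def by blast
    then obtain m' g' where g': "g' \<in> G" "h w = Poly_Mapping.single m' 1 * g'" "w = m' + lm g'"
      using h by auto
    let ?l = "(lm g' - lm g) + lm g"
    define d where "d = w - ?l"
    have "mon_divides (lm g) w"
      unfolding 1(3)[symmetric] by (simp add: mon_divides_iff lookup_add)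
    moreover have "mon_divides (lm g') w"
      unfolding g'(3) by (simp add: mon_divides_iff lookup_add)
    ultimately have wl: "w = d + (lm g' - lm g) + lm g"
      unfolding d_def by (rule mon_lcm_least)
    have m: "m = d + (lm g' - lm g)"
      using wl 1(3) by simp
    have "m' + lm g' = d + (lm g - lm g') + lm g'"
      using wl g'(3) mon_lcm_commute[of "lm g'" "lm g"] by (simp add: add.assoc)
    then have m': "m' = d + (lm g - lm g')"
      by simp
    \<comment> \<open>Shifted by \<open>d\<close>, the S-polynomial equals \<open>lc g'\<close>
      times the given multiple minus \<open>lc g\<close> times the chosen one. Its representation
      involves only multiples leading below \<open>w\<close>, to which the induction hypothesis
      applies.\<close>
    have "Poly_Mapping.single d 1 * spol g g' \<in> span_below G (d + ?l)"
      by (rule single_times_span_below[OF spol[OF 1(2) g'(1)]])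
    also have "span_below G (d + ?l) \<subseteq> ?V"
      unfolding span_below_def
    proof (rule poly_vs.span_minimal)
      show "{Poly_Mapping.single m 1 * g |m g. g \<in> G \<and> mon_less (m + lm g) (d + ?l)} \<subseteq> ?V"
        using 1(1) wl by (auto simp: add.assoc)
    qed (rule poly_vs.subspace_span)
    finally have "Poly_Mapping.single m (lc g') * g - poly_scale (lc g) (h w) \<in> ?V"
      unfolding spol_def right_diff_distrib m
      by (simp add: g'(2) m' mult_single poly_scale_def flip: mult.assoc)
    moreover have "poly_scale (lc g) (h w) \<in> ?V"
      using w by (intro poly_vs.span_scale poly_vs.span_base) simp
    ultimately have "Poly_Mapping.single m (lc g') * g \<in> ?V"
      using poly_vs.span_add by fastforce
    then have "poly_scale (inverse (lc g')) (Poly_Mapping.single m (lc g') * g) \<in> ?V"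
      by (rule poly_vs.span_scale)
    moreover have "lc g' \<noteq> 0" using g'(1) G0 by (auto simp: lc_eq_0_iff)
    then have "poly_scale (inverse (lc g')) (Poly_Mapping.single m (lc g') * g) = Poly_Mapping.single m 1 * g"
      by (simp add: poly_scale_def mult_single flip: mult.assoc)
    ultimately show ?case by simp
  qed
  have "f \<in> ?V"
    using f(1)
  proof (induction rule: poly_ideal.span_induct_alt)
    case (step r g y)
    have "r * g = (\<Sum>u\<in>Poly_Mapping.keys r. Poly_Mapping.single u (Poly_Mapping.lookup r u)) * g"
      by (simp only: sum_single_keys)
    also have "\<dots> = (\<Sum>u\<in>Poly_Mapping.keys r. Poly_Mapping.single u (Poly_Mapping.lookup r u) * g)"
      by (rule sum_distrib_right)
    also have "\<dots> = (\<Sum>u\<in>Poly_Mapping.keys r. poly_scale (Poly_Mapping.lookup r u) (Poly_Mapping.single u 1 * g))"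
      by (rule sum.cong[OF refl]) (rule single_times_eq_poly_scale)
    also have "\<dots> \<in> ?V"
      using step(1) mult_in by (intro poly_vs.span_sum poly_vs.span_scale) blast
    finally show ?case using step(2) by (rule poly_vs.span_add)
  qed (rule poly_vs.span_zero)
  then obtain t r where t: "finite t" "t \<subseteq> h ` U" "f = (\<Sum>a\<in>t. poly_scale (r a) a)"
    unfolding poly_vs.span_explicit by auto
  \<comment> \<open>Summands with coefficient zero are dropped, so that the greatest leading
    monomial is taken among those actually present.\<close>
  define t' where "t' = {a \<in> t. r a \<noteq> 0}"
  have f': "f = (\<Sum>a\<in>t'. poly_scale (r a) a)"
    unfolding t(3) t'_def by (rule sum.mono_neutral_right) (use t(1) in \<open>auto simp: poly_vs.scale_zero_left\<close>)
  have fin': "finite t'" using t(1) by (simp add: t'_def)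
  have "t' \<noteq> {}" using f(2) f' by auto
  then obtain a where a: "a \<in> t'" "\<forall>b\<in>t'. mon_le (lm b) (lm a)"
    using ex_mon_greatest[of "lm ` t'"] fin' by auto
  \<comment> \<open>A chosen multiple is determined by its leading monomial; hence
    \<open>lm a\<close> occurs in no other summand and cannot cancel.\<close>
  have inj: "b = a" if "b \<in> t'" "lm b = lm a" for b
  proof -
    have "a \<in> h ` U" "b \<in> h ` U" using a(1) that(1) t(2) by (auto simp: t'_def)
    then show ?thesis using that(2) lm_h by auto
  qed
  have "a \<noteq> 0"
  proof -
    obtain w where w: "w \<in> U" "a = h w" using a(1) t(2) by (auto simp: t'_def)
    then obtain m g where "g \<in> G" "a = Poly_Mapping.single m 1 * g"
      using bspec[OF h w(1)] w(2) by auto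
    then have "Poly_Mapping.lookup a (m + lm g) = lc g" "lc g \<noteq> 0"
      using G0 by (auto simp: lookup_single_times lc_eq_0_iff) (simp add: lc_def)
    then show ?thesis by auto
  qed
  have lookup_f: "Poly_Mapping.lookup f u = (\<Sum>b\<in>t'. r b * Poly_Mapping.lookup b u)" for u
    by (simp add: f' lookup_sum lookup_poly_scale)
  have "lm f = lm a"
  proof (rule lm_eqI)
    have "r b * Poly_Mapping.lookup b (lm a) = 0" if "b \<in> t' - {a}" for b
    proof -
      have "lm a \<notin> Poly_Mapping.keys b"
        using lm_max[of "lm a" b] a(2) that inj mon_le_antisym by blast
      then show ?thesis by (simp add: in_keys_iff)
    qed
    then have "(\<Sum>b\<in>t' - {a}. r b * Poly_Mapping.lookup b (lm a)) = 0"
      by (intro sum.neutral) blast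
    then have "Poly_Mapping.lookup f (lm a) = r a * lc a"
      using sum.remove[OF fin' a(1), of "\<lambda>b. r b * Poly_Mapping.lookup b (lm a)"]
      by (simp add: lookup_f lc_def)
    then show "lm a \<in> Poly_Mapping.keys f"
      using a(1) \<open>a \<noteq> 0\<close> by (simp add: in_keys_iff t'_def lc_eq_0_iff)
    show "mon_le u (lm a)" if "u \<in> Poly_Mapping.keys f" for u
    proof -
      have "\<exists>b\<in>t'. Poly_Mapping.lookup b u \<noteq> 0"
        using that sum.neutral[of t' "\<lambda>b. r b * Poly_Mapping.lookup b u"]
        unfolding in_keys_iff lookup_f by auto
      then obtain b where "b \<in> t'" "u \<in> Poly_Mapping.keys b" by (auto simp: in_keys_iff)
      then show ?thesis using lm_max[of u b] a(2) mon_le_trans by blast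
    qed
  qed
  moreover have "lm a \<in> U"
    using a(1) t(2) lm_h by (auto simp: t'_def)
  ultimately show ?thesis
    unfolding U_def mon_divides_def by (auto simp: add.commute)
qed

lemma lm_spol_less:
  assumes "mon_divides (lm p) (lm f)" "spol f p \<noteq> 0"
  shows "mon_less (lm (spol f p)) (lm f)"
  using keys_spol[OF lm_in_keys[OF assms(2)]] mon_lcm_dvd[OF assms(1)] by simp

text \<open>A reduction step read backwards: \<open>spol f p\<close> is \<open>lc p\<close> times
  \<open>f\<close> minus a multiple of \<open>p\<close> that leads with \<open>lm f\<close>, which
  is below \<open>w\<close>, and \<open>lc p\<close> is invertible.\<close>

lemma span_below_spol:
  assumes "mon_divides (lm p) (lm f)" "p \<in> G" "p \<noteq> 0" "mon_less (lm f) w"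
    "spol f p \<in> span_below G w"
  shows "f \<in> span_below G w"
proof -
  let ?m = "lm f - lm p"
  have "lm p - lm f = 0"
    using assms(1) by (intro poly_mapping_eqI) (simp add: lookup_minus mon_divides_iff)
  then have spol: "spol f p = poly_scale (lc p) f - poly_scale (lc f) (Poly_Mapping.single ?m 1 * p)"
    unfolding spol_def by (simp add: poly_scale_def mult_single flip: mult.assoc)
  have "?m + lm p = lm f"
    using mon_lcm_commute[of "lm f" "lm p"] mon_lcm_dvd[OF assms(1)] by simp
  then have "poly_scale (lc f) (Poly_Mapping.single ?m 1 * p) \<in> span_below G w"
    unfolding span_below_def using assms(2,4)
    by (intro poly_vs.span_scale poly_vs.span_base CollectI exI[of _ ?m] exI[of _ p]) simp
  then have "poly_scale (lc p) f \<in> span_below G w"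
    using assms(5) poly_vs.span_add unfolding spol span_below_def by fastforce
  then have "poly_scale (inverse (lc p)) (poly_scale (lc p) f) \<in> span_below G w"
    unfolding span_below_def by (rule poly_vs.span_scale)
  then show ?thesis
    using assms(3) by (simp add: poly_vs.scale_scale lc_eq_0_iff)
qed

section \<open>Buchberger's criterion for symmetric ideals\<close>

definition vars :: "'k::zero mpoly \<Rightarrow> nat set" where
  "vars f = (\<Union>u\<in>Poly_Mapping.keys f. Poly_Mapping.keys u)"

lemma vars_diff: "vars (f - g) \<subseteq> vars f \<union> vars (g :: 'k::ab_group_add mpoly)"
  using keys_diff[of f g] unfolding vars_def by blast

lemma vars_single_times:
  fixes f :: "'k::comm_ring_1 mpoly"
  shows "vars (Poly_Mapping.single m c * f) \<subseteq> Poly_Mapping.keys m \<union> vars f"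
  using keys_single_times[of m c f] Poly_Mapping.keys_add[of m] unfolding vars_def by fastforce

lemma keys_lm: "Poly_Mapping.keys (lm f) \<subseteq> vars f"
proof (cases "f = 0")
  case False
  then show ?thesis using lm_in_keys[OF False] unfolding vars_def by blast
qed (simp add: lm_def)

text \<open>Each multiplier divides the leading monomial of the other polynomial and so brings in no
  new indeterminates.\<close>

lemma vars_spol: "vars (spol f g) \<subseteq> vars f \<union> vars g"
proof -
  have keys: "Poly_Mapping.keys (u - v) \<subseteq> Poly_Mapping.keys u" for u v :: mon
    by (auto simp: in_keys_iff lookup_minus)
  have "vars (spol f g) \<subseteq> vars (Poly_Mapping.single (lm g - lm f) (lc g) * f)
      \<union> vars (Poly_Mapping.single (lm f - lm g) (lc f) * g)"
    unfolding spol_def by (rule vars_diff)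
  also have "\<dots> \<subseteq> vars f \<union> vars g"
    using vars_single_times[of "lm g - lm f" "lc g" f] vars_single_times[of "lm f - lm g" "lc f" g]
      keys[of "lm g" "lm f"] keys[of "lm f" "lm g"] keys_lm[of f] keys_lm[of g]
    by blast
  finally show ?thesis .
qed

lemma perm_poly_cong:
  assumes "\<And>i. i \<in> vars f \<Longrightarrow> \<sigma> i = \<tau> i"
  shows "perm_poly \<sigma> f = perm_poly \<tau> f"
proof -
  have "perm_mon \<sigma> u = perm_mon \<tau> u" if "u \<in> Poly_Mapping.keys f" for u
    using that assms by (intro perm_mon_cong) (auto simp: vars_def)
  then show ?thesis unfolding perm_poly_def by (intro sum.cong) simp_all
qed

lemma perm_poly_diff:
  fixes f g :: "'k::ab_group_add mpoly"
  shows "perm_poly \<sigma> (f - g) = perm_poly \<sigma> f - perm_poly \<sigma> g"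
  using perm_poly_add[of \<sigma> "f - g" g] by (simp add: eq_diff_eq)

lemma lookup_perm_poly:
  assumes "inj \<sigma>"
  shows "Poly_Mapping.lookup (perm_poly \<sigma> f) (perm_mon \<sigma> u) = Poly_Mapping.lookup f u"
  by (simp add: perm_poly_def Poly_Mapping.lookup_sum Poly_Mapping.lookup_single when_def
      perm_mon_eq_iff[OF assms] in_keys_iff)

lemma keys_perm_poly:
  assumes "inj \<sigma>"
  shows "Poly_Mapping.keys (perm_poly \<sigma> f) = perm_mon \<sigma> ` Poly_Mapping.keys f"
proof
  show "Poly_Mapping.keys (perm_poly \<sigma> f) \<subseteq> perm_mon \<sigma> ` Poly_Mapping.keys f"
  proof
    fix w assume "w \<in> Poly_Mapping.keys (perm_poly \<sigma> f)"
    then have "(\<Sum>u\<in>Poly_Mapping.keys f. Poly_Mapping.lookup f u when perm_mon \<sigma> u = w) \<noteq> 0"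
      by (simp add: perm_poly_def Poly_Mapping.lookup_sum Poly_Mapping.lookup_single in_keys_iff)
    then obtain u where "u \<in> Poly_Mapping.keys f" "(Poly_Mapping.lookup f u when perm_mon \<sigma> u = w) \<noteq> 0"
      by (rule sum.not_neutral_contains_not_neutral)
    then show "w \<in> perm_mon \<sigma> ` Poly_Mapping.keys f" by (auto simp: when_def split: if_splits)
  qed
  show "perm_mon \<sigma> ` Poly_Mapping.keys f \<subseteq> Poly_Mapping.keys (perm_poly \<sigma> f)"
    by (auto simp: in_keys_iff lookup_perm_poly[OF assms])
qed

lemma perm_poly_eq_0_iff:
  assumes "inj \<sigma>"
  shows "perm_poly \<sigma> f = 0 \<longleftrightarrow> f = 0"
proof
  assume "perm_poly \<sigma> f = 0"
  then have "Poly_Mapping.lookup f u = 0" for u using lookup_perm_poly[OF assms, of f u] by simp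
  then show "f = 0" by (intro poly_mapping_eqI) simp
qed (simp add: perm_poly_0)

lemma keys_perm_mon:
  assumes "inj \<sigma>"
  shows "Poly_Mapping.keys (perm_mon \<sigma> u) = \<sigma> ` Poly_Mapping.keys u"
proof (intro set_eqI)
  fix k
  show "k \<in> Poly_Mapping.keys (perm_mon \<sigma> u) \<longleftrightarrow> k \<in> \<sigma> ` Poly_Mapping.keys u"
    using assms by (cases "k \<in> range \<sigma>")
      (auto simp: in_keys_iff lookup_perm_mon lookup_perm_mon_notin_range image_iff inj_eq)
qed

lemma vars_perm_poly: "inj \<sigma> \<Longrightarrow> vars (perm_poly \<sigma> f) = \<sigma> ` vars f"
  by (auto simp: vars_def keys_perm_poly keys_perm_mon)

lemma lm_perm_poly:
  assumes "strict_mono \<iota>"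
  shows "lm (perm_poly \<iota> f) = perm_mon \<iota> (lm f)"
proof (cases "f = 0")
  case True
  then show ?thesis by (simp add: perm_poly_0 lm_def perm_mon_def)
next
  case False
  have inj: "inj \<iota>" using assms by (rule strict_mono_imp_inj_on)
  show ?thesis
  proof (rule lm_eqI)
    show "perm_mon \<iota> (lm f) \<in> Poly_Mapping.keys (perm_poly \<iota> f)"
      using lm_in_keys[OF False] by (simp add: keys_perm_poly[OF inj])
    show "mon_le u (perm_mon \<iota> (lm f))" if "u \<in> Poly_Mapping.keys (perm_poly \<iota> f)" for u
      using that lm_max[of _ f]
      by (auto simp: keys_perm_poly[OF inj] mon_le_iff_not_less mon_less_perm_mon[OF assms])
  qed
qed

lemma lc_perm_poly: "strict_mono \<iota> \<Longrightarrow> lc (perm_poly \<iota> f) = lc f"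
  by (simp add: lc_def lm_perm_poly lookup_perm_poly strict_mono_imp_inj_on)

text \<open>Leading monomials, leading coefficients and truncated differences all commute with an
  order preserving renaming. For a general permutation this fails, as another monomial may come to
  lead.\<close>

lemma spol_perm_poly:
  assumes "strict_mono \<iota>"
  shows "spol (perm_poly \<iota> f) (perm_poly \<iota> g) = perm_poly \<iota> (spol f g)"
  using assms by (simp add: spol_def lm_perm_poly lc_perm_poly perm_poly_diff perm_poly_mult
      perm_poly_single perm_mon_minus strict_mono_imp_inj_on)

lemma perm_poly_span_below:
  assumes \<iota>: "strict_mono \<iota>" and sub: "perm_poly \<iota> ` F \<subseteq> G" and f: "f \<in> span_below F w"
  shows "perm_poly \<iota> f \<in> span_below G (perm_mon \<iota> w)"
  using f unfolding span_below_def
proof (induction rule: poly_vs.span_induct_alt)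
  case (step c x y)
  then obtain m g where x: "x = Poly_Mapping.single m 1 * g" "g \<in> F" "mon_less (m + lm g) w"
    by auto
  have "perm_poly \<iota> x = Poly_Mapping.single (perm_mon \<iota> m) 1 * perm_poly \<iota> g"
    by (simp add: x perm_poly_mult perm_poly_single)
  moreover have "mon_less (perm_mon \<iota> m + lm (perm_poly \<iota> g)) (perm_mon \<iota> w)"
    using x(3) \<iota> by (simp add: lm_perm_poly mon_less_perm_mon flip: perm_mon_add)
  moreover have "perm_poly \<iota> g \<in> G" using x(2) sub by blast
  ultimately have "perm_poly \<iota> x \<in>
      {Poly_Mapping.single m 1 * g |m g. g \<in> G \<and> mon_less (m + lm g) (perm_mon \<iota> w)}"
    by blast
  moreover have "perm_poly \<iota> (poly_scale c x) = poly_scale c (perm_poly \<iota> x)"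
    by (simp add: poly_scale_def perm_poly_mult perm_poly_single) (simp add: perm_mon_def)
  ultimately show ?case
    using step.IH unfolding perm_poly_add
    by (simp only:) (intro poly_vs.span_add[OF poly_vs.span_scale[OF poly_vs.span_base]])
qed (simp add: perm_poly_0 poly_vs.span_zero)

section \<open>Finite orbits and the symmetric criterion\<close>

definition orbit :: "nat \<Rightarrow> 'k::comm_monoid_add mpoly set \<Rightarrow> 'k mpoly set" where
  "orbit N B = {perm_poly \<sigma> b |\<sigma> b. \<sigma> permutes {..<N} \<and> b \<in> B}"

text \<open>Both images use only indices from \<open>?A\<close>, which has at most
  \<open>2 * n\<close> elements. It is essential that one \<open>\<iota>\<close> serves both
  polynomials: only then is the S-polynomial of the pair the image of an S-polynomial of the
  orbit.\<close>

lemma ex_orbit_representatives: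
  assumes n: "vars b \<subseteq> {..<n}" "vars b' \<subseteq> {..<n}" and N: "2 * n \<le> N"
    and B: "b \<in> B" "b' \<in> B" and inj: "inj \<sigma>" "inj \<tau>"
  shows "\<exists>\<iota> p q. strict_mono \<iota> \<and> p \<in> orbit N B \<and> q \<in> orbit N B \<and>
    perm_poly \<sigma> b = perm_poly \<iota> p \<and> perm_poly \<tau> b' = perm_poly \<iota> q"
proof -
  let ?A = "\<sigma> ` {..<n} \<union> \<tau> ` {..<n}"
  have "card ?A \<le> card (\<sigma> ` {..<n}) + card (\<tau> ` {..<n})" by (rule card_Un_le)
  also have "\<dots> \<le> N"
    using N card_image_le[of "{..<n}" \<sigma>] card_image_le[of "{..<n}" \<tau>] by simp
  finally obtain \<iota> where \<iota>: "strict_mono \<iota>" "?A \<subseteq> \<iota> ` {..<N}"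
    using ex_strict_mono_covering[of ?A N] by auto
  have inj_\<iota>: "inj \<iota>" using \<iota>(1) by (rule strict_mono_imp_inj_on)
  have rep: "\<exists>p\<in>orbit N B. perm_poly \<rho> c = perm_poly \<iota> p"
    if \<rho>: "inj \<rho>" "\<rho> ` {..<n} \<subseteq> ?A" and c: "vars c \<subseteq> {..<n}" "c \<in> B" for \<rho> c
  proof -
    \<comment> \<open>\<open>\<rho>\<close> is read back through \<open>\<iota>\<close>. A
      permutation extending the result, followed by \<open>\<iota>\<close>, restores
      \<open>\<rho>\<close> on the indeterminates of \<open>c\<close>.\<close>
    let ?\<phi> = "inv_into {..<N} \<iota> \<circ> \<rho>"
    have im: "\<rho> i \<in> \<iota> ` {..<N}" if "i < n" for i using \<rho>(2) \<iota>(2) that by blast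
    have \<phi>: "?\<phi> i \<in> {..<N}" "\<iota> (?\<phi> i) = \<rho> i" if "i < n" for i
      using inv_into_into[OF im[OF that]] f_inv_into_f[OF im[OF that]] by simp_all
    have "inj_on ?\<phi> {..<n}"
    proof (rule inj_onI)
      fix i j assume "i \<in> {..<n}" "j \<in> {..<n}" "?\<phi> i = ?\<phi> j"
      then have "\<rho> i = \<rho> j" using \<phi>(2)[of i] \<phi>(2)[of j] by (metis lessThan_iff)
      then show "i = j" using \<rho>(1) by (simp add: inj_eq)
    qed
    moreover have "?\<phi> ` {..<n} \<subseteq> {..<N}" using \<phi>(1) by blast
    ultimately obtain \<pi> where \<pi>: "\<pi> permutes {..<N}" "\<forall>i<n. \<pi> i = ?\<phi> i"
      using ex_permutes_extending by blast
    have "perm_poly \<rho> c = perm_poly (\<iota> \<circ> \<pi>) c"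
    proof (rule perm_poly_cong)
      fix i assume "i \<in> vars c"
      then have "i < n" using c(1) by blast
      then show "\<rho> i = (\<iota> \<circ> \<pi>) i" using \<phi>(2)[of i] \<pi>(2) by simp
    qed
    then have "perm_poly \<rho> c = perm_poly \<iota> (perm_poly \<pi> c)" by (simp add: perm_poly_comp)
    then show ?thesis using \<pi>(1) c(2) unfolding orbit_def by blast
  qed
  obtain p where p: "p \<in> orbit N B" "perm_poly \<sigma> b = perm_poly \<iota> p"
    using rep[OF inj(1) Un_upper1 n(1) B(1)] by auto
  obtain q where q: "q \<in> orbit N B" "perm_poly \<tau> b' = perm_poly \<iota> q"
    using rep[OF inj(2) Un_upper2 n(2) B(2)] by auto
  show ?thesis using \<iota>(1) p q by blast
qed

lemma orbit_subset_sym_ideal_gen: "orbit N B \<subseteq> sym_ideal_gen (B :: 'k::comm_ring_1 mpoly set)"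
proof
  fix p assume "p \<in> orbit N B"
  then obtain \<sigma> b where "\<sigma> permutes {..<N}" "b \<in> B" "p = perm_poly \<sigma> b"
    unfolding orbit_def by blast
  then have "p \<in> {perm_poly \<sigma> f |\<sigma> f. bij \<sigma> \<and> f \<in> B}" using permutes_bij by blast
  then show "p \<in> sym_ideal_gen B" unfolding sym_ideal_gen_def by (rule poly_ideal.span_base)
qed

text \<open>Every pair in the infinite family \<open>G\<close> is the common increasing image of a
  pair from the finite orbit, and S-polynomials and their representations travel along that map. So
  the assumption on the orbit yields the ordinary criterion for \<open>G\<close>.\<close>

theorem symmetric_buchberger:
  fixes B :: "'k::field mpoly set"
  assumes n: "\<And>b. b \<in> B \<Longrightarrow> vars b \<subseteq> {..<n}" and N: "2 * n \<le> N"
    and spol: "\<And>p q. p \<in> orbit N B - {0} \<Longrightarrow> q \<in> orbit N B - {0} \<Longrightarrow>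
      spol p q \<in> span_below (orbit N B - {0}) ((lm q - lm p) + lm p)"
    and f: "f \<in> sym_ideal_gen B" "f \<noteq> 0"
  shows "\<exists>p\<in>orbit N B - {0}. sym_le (lm p) (lm f)"
proof -
  \<comment> \<open>Injections instead of bijections: an increasing map following a permutation is
    injective but in general not onto, and \<open>G\<close> must contain these composites.\<close>
  define G where "G = {perm_poly \<sigma> b |\<sigma> b. inj \<sigma> \<and> b \<in> B \<and> b \<noteq> 0}"
  have G0: "0 \<notin> G"
    unfolding G_def by (auto simp: perm_poly_eq_0_iff dest: sym)
  have rep: "\<exists>\<iota> p q. strict_mono \<iota> \<and> p \<in> orbit N B - {0} \<and> q \<in> orbit N B - {0} \<and>
    g = perm_poly \<iota> p \<and> h = perm_poly \<iota> q" if gh: "g \<in> G" "h \<in> G" for g h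
  proof -
    obtain \<sigma> b where b: "inj \<sigma>" "b \<in> B" "g = perm_poly \<sigma> b" using gh(1) unfolding G_def by blast
    obtain \<tau> c where c: "inj \<tau>" "c \<in> B" "h = perm_poly \<tau> c" using gh(2) unfolding G_def by blast
    obtain \<iota> p q where \<iota>: "strict_mono \<iota>" "p \<in> orbit N B" "q \<in> orbit N B"
      "g = perm_poly \<iota> p" "h = perm_poly \<iota> q"
      using ex_orbit_representatives[OF n[OF b(2)] n[OF c(2)] N b(2) c(2) b(1) c(1)] b(3) c(3) by auto
    have "p \<noteq> 0" "q \<noteq> 0" using \<iota>(4,5) gh G0 perm_poly_0[of \<iota>] by metis+
    then show ?thesis using \<iota> by blast
  qed
  have sub: "perm_poly \<iota> ` (orbit N B - {0}) \<subseteq> G" if "strict_mono \<iota>" for \<iota>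
  proof
    fix g assume "g \<in> perm_poly \<iota> ` (orbit N B - {0})"
    then obtain \<sigma> b where b: "\<sigma> permutes {..<N}" "b \<in> B" "perm_poly \<sigma> b \<noteq> 0" "g = perm_poly \<iota> (perm_poly \<sigma> b)"
      unfolding orbit_def by blast
    have "inj (\<iota> \<circ> \<sigma>)"
      using strict_mono_imp_inj_on[OF that] permutes_inj[OF b(1)] by (rule inj_compose)
    moreover have "b \<noteq> 0" using b(3) perm_poly_0 by blast
    ultimately show "g \<in> G" unfolding G_def b(4) perm_poly_comp using b(2) by blast
  qed
  have spolG: "spol g h \<in> span_below G ((lm h - lm g) + lm g)" if gh: "g \<in> G" "h \<in> G" for g h
  proof -
    obtain \<iota> p q where \<iota>: "strict_mono \<iota>" "p \<in> orbit N B - {0}" "q \<in> orbit N B - {0}"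
      "g = perm_poly \<iota> p" "h = perm_poly \<iota> q"
      using rep[OF gh] by auto
    show ?thesis
      using perm_poly_span_below[OF \<iota>(1) sub[OF \<iota>(1)] spol[OF \<iota>(2,3)]] \<iota>(1)
      by (simp add: \<iota>(4,5) spol_perm_poly lm_perm_poly perm_mon_add perm_mon_minus strict_mono_imp_inj_on)
  qed
  have "f \<in> poly_ideal.span G"
  proof -
    have "{perm_poly \<sigma> f |\<sigma> f. bij \<sigma> \<and> f \<in> B} \<subseteq> poly_ideal.span G"
    proof
      fix x assume "x \<in> {perm_poly \<sigma> f |\<sigma> f. bij \<sigma> \<and> f \<in> B}"
      then obtain \<sigma> b where b: "bij \<sigma>" "b \<in> B" "x = perm_poly \<sigma> b" by blast
      show "x \<in> poly_ideal.span G"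
      proof (cases "b = 0")
        case True
        then show ?thesis by (simp add: b(3) perm_poly_0 poly_ideal.span_zero)
      next
        case False
        then have "x \<in> G" unfolding G_def using b bij_is_inj by blast
        then show ?thesis by (rule poly_ideal.span_base)
      qed
    qed
    then have "poly_ideal.span {perm_poly \<sigma> f |\<sigma> f. bij \<sigma> \<and> f \<in> B} \<subseteq> poly_ideal.span G"
      by (rule poly_ideal.span_minimal) (rule poly_ideal.subspace_span)
    then show ?thesis using f(1) unfolding sym_ideal_gen_def by blast
  qed
  then obtain g where g: "g \<in> G" "mon_divides (lm g) (lm f)"
    using buchberger[OF G0 spolG] f(2) by blast
  obtain \<iota> p where p: "strict_mono \<iota>" "p \<in> orbit N B - {0}" "g = perm_poly \<iota> p"
    using rep[OF g(1) g(1)] by auto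
  \<comment> \<open>Plain divisibility by \<open>g\<close> becomes the cancellation order here, as
    \<open>g\<close> is an increasing image of a member of the finite orbit.\<close>
  have "sym_le (lm p) (lm g)"
    using sym_le_perm_mon_strict_mono[OF p(1)] by (simp add: p(3) lm_perm_poly[OF p(1)])
  then show ?thesis using sym_le_divides g(2) p(2) by blast
qed

text \<open>By transitivity the monomials above leading monomials of \<open>B\<close> are those
  above leading monomials of \<open>I\<close>, so both spans have the same generators.\<close>

lemma minimal_groebner_basisI:
  fixes I :: "'k::field mpoly set"
  assumes "symmetric_ideal I" "B \<subseteq> I - {0}"
    and lead: "\<And>f. f \<in> I \<Longrightarrow> f \<noteq> 0 \<Longrightarrow> \<exists>b\<in>B. sym_le (lm b) (lm f)"
    and min: "\<And>b c. b \<in> B \<Longrightarrow> c \<in> B \<Longrightarrow> b \<noteq> c \<Longrightarrow> \<not> sym_le (lm b) (lm c)"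
  shows "minimal_groebner_basis B I"
proof -
  have lm: "f \<noteq> 0 \<Longrightarrow> lead_mon f = lm f" for f :: "'k mpoly" by (simp add: lm_def)
  have "(\<exists>f\<in>B. f \<noteq> 0 \<and> sym_le (lead_mon f) w) \<longleftrightarrow> (\<exists>f\<in>I. f \<noteq> 0 \<and> sym_le (lead_mon f) w)" for w
  proof
    assume "\<exists>f\<in>I. f \<noteq> 0 \<and> sym_le (lead_mon f) w"
    then obtain f where f: "f \<in> I" "f \<noteq> 0" "sym_le (lm f) w" using lm by metis
    then obtain b where b: "b \<in> B" "sym_le (lm b) (lm f)" using lead by blast
    then have "b \<noteq> 0" using assms(2) by blast
    then show "\<exists>f\<in>B. f \<noteq> 0 \<and> sym_le (lead_mon f) w"
      using b f(3) lm sym_le_trans by metis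
  qed (use assms(2) in blast)
  then have "lm_span B = lm_span I" unfolding lm_span_def by simp
  moreover have "\<not> sym_le (lead_mon b) (lead_mon c)" if "b \<in> B" "c \<in> B" "b \<noteq> c" for b c
    using min[OF that] that assms(2) lm by (metis Diff_iff insertI1 subsetD)
  ultimately show ?thesis
    using assms(1,2) unfolding minimal_groebner_basis_def groebner_basis_def by blast
qed

section \<open>Computable functions on data\<close>

text \<open>One program serves all arguments and halts on each of them. The argument
  \<open>x\<close> plays the role of an environment: the closure rules compute an expression from
  the code of \<open>x\<close>, and a bound variable is handled by pairing its value with the
  environment.\<close>

definition computes :: "('a \<Rightarrow> 'k::field data) \<Rightarrow> ('b \<Rightarrow> 'k data) \<Rightarrow> ('a \<Rightarrow> 'b) \<Rightarrow> bool" where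
  "computes ea eb f \<longleftrightarrow> (\<exists>p. \<forall>x. run p (ea x) (eb (f x)))"

fun pair_data :: "('a \<Rightarrow> 'k data) \<Rightarrow> ('b \<Rightarrow> 'k data) \<Rightarrow> 'a \<times> 'b \<Rightarrow> 'k data" where
  "pair_data ea eb (x, y) = Node (ea x) (eb y)"

definition lists_data :: "('a \<Rightarrow> 'k data) \<Rightarrow> 'a list \<Rightarrow> 'k data" where
  "lists_data e xs = list_data (map e xs)"

definition bool_data :: "bool \<Rightarrow> 'k data" where
  "bool_data b = (if b then Node Null Null else Null)"

definition unit_data :: "unit \<Rightarrow> 'k data" where
  "unit_data u = Null"

named_theorems computes_intros

lemma lists_data_simps [simp]:
  "lists_data e [] = Null" "lists_data e (x # xs) = Node (e x) (lists_data e xs)"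
  by (simp_all add: lists_data_def)

lemma nat_data_simps [simp]: "nat_data 0 = Null" "nat_data (Suc n) = Node Null (nat_data n)"
  by (simp_all add: nat_data_def)

lemma computes_id [computes_intros]: "computes e e (\<lambda>x. x)"
  unfolding computes_def using run_Id by blast

lemma computes_comp: "computes e e' f \<Longrightarrow> computes e' e'' g \<Longrightarrow> computes e e'' (\<lambda>x. g (f x))"
  unfolding computes_def using run_Seq by meson

lemma computes_Pair [computes_intros]:
  "computes e a f \<Longrightarrow> computes e b g \<Longrightarrow> computes e (pair_data a b) (\<lambda>x. (f x, g x))"
  unfolding computes_def pair_data.simps using run_Node by meson

lemma computes_fst [computes_intros]:
  assumes "computes e (pair_data a b) f"
  shows "computes e a (\<lambda>x. fst (f x))"
proof (rule computes_comp[OF assms])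
  show "computes (pair_data a b) a fst"
    unfolding computes_def by (intro exI[of _ PLeft]) (simp add: split_paired_all run_Left)
qed

lemma computes_snd [computes_intros]:
  assumes "computes e (pair_data a b) f"
  shows "computes e b (\<lambda>x. snd (f x))"
proof (rule computes_comp[OF assms])
  show "computes (pair_data a b) b snd"
    unfolding computes_def by (intro exI[of _ PRight]) (simp add: split_paired_all run_Right)
qed

lemma computes_If [computes_intros]:
  assumes "computes e bool_data b" "computes e e' f" "computes e e' g"
  shows "computes e e' (\<lambda>x. if b x then f x else g x)"
proof -
  obtain pb pf pg where p: "\<And>x. run pb (e x) (bool_data (b x))" "\<And>x. run pf (e x) (e' (f x))"
    "\<And>x. run pg (e x) (e' (g x))"
    using assms unfolding computes_def by auto
  have "run (PIf pb pf pg) (e x) (e' (if b x then f x else g x))" for x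
    using p(1)[of x] p(2)[of x] p(3)[of x]
    by (cases "b x") (auto simp: bool_data_def intro: run_If_true run_If_false)
  then show ?thesis unfolding computes_def by blast
qed

lemma computes_True [computes_intros]: "computes e bool_data (\<lambda>x. True)"
  unfolding computes_def bool_data_def
  by (intro exI[of _ "PNode PNull PNull"]) (auto intro: run_Node run_Null)

lemma computes_False [computes_intros]: "computes e bool_data (\<lambda>x. False)"
  unfolding computes_def bool_data_def
  by (intro exI[of _ PNull]) (auto intro: run_Null)

lemma computes_conj [computes_intros]:
  assumes "computes e bool_data f" "computes e bool_data g"
  shows "computes e bool_data (\<lambda>x. f x \<and> g x)"
proof -
  have "(\<lambda>x. f x \<and> g x) = (\<lambda>x. if f x then g x else False)" by auto
  then show ?thesis using computes_If[OF assms computes_False] by simp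
qed

lemma computes_not [computes_intros]:
  assumes "computes e bool_data f"
  shows "computes e bool_data (\<lambda>x. \<not> f x)"
proof -
  have "(\<lambda>x. \<not> f x) = (\<lambda>x. if f x then False else True)" by auto
  then show ?thesis using computes_If[OF assms computes_False computes_True] by simp
qed

lemma computes_imp [computes_intros]:
  assumes "computes e bool_data f" "computes e bool_data g"
  shows "computes e bool_data (\<lambda>x. f x \<longrightarrow> g x)"
proof -
  have "(\<lambda>x. f x \<longrightarrow> g x) = (\<lambda>x. if f x then g x else True)" by auto
  then show ?thesis using computes_If[OF assms computes_True] by simp
qed

lemma computes_zero [computes_intros]: "computes e Scalar (\<lambda>x. 0)"
  unfolding computes_def by (intro exI[of _ PZero]) (auto intro: run_Zero)

lemma computes_add [computes_intros]:
  assumes "computes e Scalar f" "computes e Scalar g"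
  shows "computes e Scalar (\<lambda>x. f x + g x)"
proof -
  have "computes (pair_data Scalar Scalar) Scalar (\<lambda>z. fst z + snd z)"
    unfolding computes_def by (intro exI[of _ PAdd]) (simp add: split_paired_all run_Add)
  from computes_comp[OF computes_Pair[OF assms] this] show ?thesis by simp
qed

lemma computes_mult [computes_intros]:
  assumes "computes e Scalar f" "computes e Scalar g"
  shows "computes e Scalar (\<lambda>x. f x * g x)"
proof -
  have "computes (pair_data Scalar Scalar) Scalar (\<lambda>z. fst z * snd z)"
    unfolding computes_def by (intro exI[of _ PMult]) (simp add: split_paired_all run_Mult)
  from computes_comp[OF computes_Pair[OF assms] this] show ?thesis by simp
qed

lemma computes_uminus [computes_intros]:
  assumes "computes e Scalar f"
  shows "computes e Scalar (\<lambda>x. - f x)"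
proof (rule computes_comp[OF assms])
  show "computes Scalar Scalar uminus"
    unfolding computes_def by (intro exI[of _ PNeg]) (simp add: run_Neg)
qed

lemma computes_scalar_eq [computes_intros]:
  assumes "computes e Scalar f" "computes e Scalar g"
  shows "computes e bool_data (\<lambda>x. f x = g x)"
proof -
  have "computes (pair_data Scalar Scalar) bool_data (\<lambda>z. fst z = snd z)"
    unfolding computes_def bool_data_def
    by (intro exI[of _ PEq]) (simp only: split_paired_All pair_data.simps fst_conv snd_conv run_Eq simp_thms)
  from computes_comp[OF computes_Pair[OF assms] this] show ?thesis by simp
qed

lemma computes_Nil [computes_intros]: "computes e (lists_data a) (\<lambda>x. [])"
  unfolding computes_def by (intro exI[of _ PNull]) (auto intro: run_Null)

lemma computes_Cons [computes_intros]:
  "computes e a f \<Longrightarrow> computes e (lists_data a) g \<Longrightarrow> computes e (lists_data a) (\<lambda>x. f x # g x)"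
  unfolding computes_def lists_data_simps using run_Node by meson

section \<open>Case distinction and loops\<close>

text \<open>The list is placed beside the environment. A nonempty list is a \<open>Node\<close>,
  hence true as a condition, and then the pair is already the input that the second branch
  expects.\<close>

lemma computes_case_list [computes_intros]:
  assumes "computes e (lists_data a) l" "computes e b f"
    "computes (pair_data e (pair_data a (lists_data a))) b (\<lambda>z. g (fst z) (fst (snd z)) (snd (snd z)))"
  shows "computes e b (\<lambda>x. case l x of [] \<Rightarrow> f x | y # ys \<Rightarrow> g x y ys)"
proof -
  obtain pl pf where p: "\<And>x. run pl (e x) (lists_data a (l x))" "\<And>x. run pf (e x) (b (f x))"
    using assms unfolding computes_def by auto
  obtain pg where "\<forall>z. run pg (pair_data e (pair_data a (lists_data a)) z) (b (g (fst z) (fst (snd z)) (snd (snd z))))"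
    using assms(3) unfolding computes_def by auto
  then have pg: "run pg (Node (e x) (Node (a y) (lists_data a ys))) (b (g x y ys))" for x y ys
    by (auto simp: split_paired_all)
  have "run (PSeq (PNode PId pl) (PIf PRight pg (PSeq PLeft pf))) (e x)
      (b (case l x of [] \<Rightarrow> f x | y # ys \<Rightarrow> g x y ys))" for x
  proof (rule run_Seq)
    show "run (PNode PId pl) (e x) (Node (e x) (lists_data a (l x)))"
      using p(1) run_Id by (intro run_Node)
    show "run (PIf PRight pg (PSeq PLeft pf)) (Node (e x) (lists_data a (l x)))
      (b (case l x of [] \<Rightarrow> f x | y # ys \<Rightarrow> g x y ys))"
    proof (cases "l x")
      case Nil
      then show ?thesis using run_Seq[OF run_Left p(2)]
        by (auto intro: run_If_false run_Right)
    next
      case (Cons y ys)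
      then show ?thesis using pg by (auto intro: run_If_true run_Right)
    qed
  qed
  then show ?thesis unfolding computes_def by blast
qed

text \<open>The loop runs on environment, accumulator and remaining list; the remaining list is
  itself the loop condition, being \<open>Null\<close> exactly at the end.\<close>

lemma computes_foldl [computes_intros]:
  assumes "computes (pair_data e (pair_data s a)) s (\<lambda>z. step (fst z) (fst (snd z)) (snd (snd z)))"
    "computes e s init" "computes e (lists_data a) l"
  shows "computes e s (\<lambda>x. foldl (step x) (init x) (l x))"
proof -
  obtain pi pl where p: "\<And>x. run pi (e x) (s (init x))" "\<And>x. run pl (e x) (lists_data a (l x))"
    using assms unfolding computes_def by auto
  obtain ps where "\<forall>z. run ps (pair_data e (pair_data s a) z) (s (step (fst z) (fst (snd z)) (snd (snd z))))"
    using assms(1) unfolding computes_def by auto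
  then have ps: "run ps (Node (e x) (Node (s acc) (a y))) (s (step x acc y))" for x acc y
    by (auto simp: split_paired_all)
  \<comment> \<open>The body keeps the environment, runs \<open>ps\<close> on environment,
    accumulator and head, and drops the head.\<close>
  define body where "body = PNode PLeft
    (PNode (PSeq (PNode PLeft (PNode (PSeq PRight PLeft) (PSeq PRight (PSeq PRight PLeft)))) ps)
      (PSeq PRight (PSeq PRight PRight)))"
  have body: "run body (Node (e x) (Node (s acc) (Node (a y) d))) (Node (e x) (Node (s (step x acc y)) d))"
    for x acc y d
    unfolding body_def by (rule run_Node run_Seq run_Left run_Right ps)+
  define loop where "loop = PWhile (PSeq PRight PRight) body"
  have cond: "run (PSeq PRight PRight) (Node (e x) (Node (s acc) d)) d" for x acc d
    by (rule run_Seq run_Right)+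
  have loop: "run loop (Node (e x) (Node (s acc) (lists_data a ys)))
      (Node (e x) (Node (s (foldl (step x) acc ys)) Null))" for x acc ys
  proof (induction ys arbitrary: acc)
    case Nil
    show ?case using run_While_false[OF cond] by (simp add: loop_def)
  next
    case (Cons y ys)
    show ?case
      using run_While_true[OF cond _ body Cons.IH[unfolded loop_def]] by (simp add: loop_def)
  qed
  have "run (PSeq (PNode PId (PNode pi pl)) (PSeq loop (PSeq PRight PLeft))) (e x)
      (s (foldl (step x) (init x) (l x)))" for x
    by (intro run_Seq[OF _ run_Seq[OF loop run_Seq[OF run_Right run_Left]]] run_Node run_Id p)
  then show ?thesis unfolding computes_def by blast
qed

text \<open>The state is paired with the environment, which the body copies unchanged. Termination
  is demanded for every \<open>x\<close>, as the program must halt on every input.\<close>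

lemma computes_while [computes_intros]:
  assumes "computes (pair_data e s) bool_data (\<lambda>z. b (fst z) (snd z))"
    "computes (pair_data e s) s (\<lambda>z. c (fst z) (snd z))"
    "computes e s init"
    "\<And>x. \<exists>t. while_option (b x) (c x) (init x) = Some t"
  shows "computes e s (\<lambda>x. the (while_option (b x) (c x) (init x)))"
proof -
  obtain pb pc where p: "\<forall>z. run pb (pair_data e s z) (bool_data (b (fst z) (snd z)))"
    "\<forall>z. run pc (pair_data e s z) (s (c (fst z) (snd z)))"
    using assms(1,2) unfolding computes_def by auto
  have pb: "run pb (Node (e x) (s y)) (bool_data (b x y))"
    and pc: "run pc (Node (e x) (s y)) (s (c x y))" for x y
    using p[THEN spec, of "(x, y)"] by simp_all
  obtain pi where pi: "\<And>x. run pi (e x) (s (init x))"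
    using assms(3) unfolding computes_def by auto
  define loop where "loop = PWhile pb (PNode PLeft pc)"
  \<comment> \<open>Here \<open>k\<close> is any number of iterations after which the test fails,
    not the least one; so the loop may also stop at once in the successor case.\<close>
  have loop: "run loop (Node (e x) (s y)) (Node (e x) (s t))"
    if "\<not> b x ((c x ^^ k) y)" "while_option (b x) (c x) y = Some t" for x y t k
    using that
  proof (induction k arbitrary: y)
    case 0
    then have "t = y" "run pb (Node (e x) (s y)) Null"
      using pb[of x y] by (simp_all add: while_option_unfold[of _ _ y] bool_data_def)
    then show ?case unfolding loop_def by (auto intro: run_While_false)
  next
    case (Suc k)
    show ?case
    proof (cases "b x y")
      case True
      then have "run loop (Node (e x) (s (c x y))) (Node (e x) (s t))"
        using Suc by (intro Suc.IH) (simp_all add: while_option_unfold[of _ _ y] funpow_swap1)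
      moreover have "run pb (Node (e x) (s y)) (Node Null Null)"
        using pb[of x y] True by (simp add: bool_data_def)
      ultimately show ?thesis
        unfolding loop_def using pc run_Left by (blast intro: run_While_true run_Node)
    next
      case False
      then have "t = y" "run pb (Node (e x) (s y)) Null"
        using pb[of x y] Suc.prems(2) by (simp_all add: while_option_unfold[of _ _ y] bool_data_def)
      then show ?thesis unfolding loop_def by (auto intro: run_While_false)
    qed
  qed
  have "run (PSeq (PNode PId pi) (PSeq loop PRight)) (e x)
      (s (the (while_option (b x) (c x) (init x))))" for x
  proof -
    obtain t where t: "while_option (b x) (c x) (init x) = Some t" using assms(4) by auto
    then obtain k where "t = (c x ^^ k) (init x) \<and> \<not> b x t" using while_option_stop2 by metis
    then have "run loop (Node (e x) (s (init x))) (Node (e x) (s t))" using loop t by auto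
    then show ?thesis using t pi by (auto intro: run_Seq run_Node run_Id run_Right)
  qed
  then show ?thesis unfolding computes_def by blast
qed

lemma computes_cong: "computes e e' f \<Longrightarrow> (\<And>x. f x = g x) \<Longrightarrow> computes e e' g"
  by (simp add: computes_def)

section \<open>List operations\<close>

lemma computes_is_Nil [computes_intros]:
  assumes "computes e (lists_data a) l"
  shows "computes e bool_data (\<lambda>x. l x = [])"
proof -
  have "computes e bool_data (\<lambda>x. case l x of [] \<Rightarrow> True | y # ys \<Rightarrow> False)"
    by (rule computes_intros assms)+
  then show ?thesis by (rule computes_cong) (simp split: list.split)
qed

lemma computes_tl [computes_intros]:
  assumes "computes e (lists_data a) l"
  shows "computes e (lists_data a) (\<lambda>x. tl (l x))"
proof -
  have "computes e (lists_data a) (\<lambda>x. case l x of [] \<Rightarrow> [] | y # ys \<Rightarrow> ys)"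
    by (rule computes_intros assms)+
  then show ?thesis by (rule computes_cong) (simp split: list.split)
qed

lemma computes_rev [computes_intros]:
  fixes l :: "'c \<Rightarrow> 'b list"
  assumes "computes e (lists_data a) l"
  shows "computes e (lists_data a) (\<lambda>x. rev (l x))"
proof -
  have "computes e (lists_data a) (\<lambda>x. foldl (\<lambda>acc y. y # acc) [] (l x))"
    by (rule computes_intros assms)+
  moreover have "foldl (\<lambda>acc y. y # acc) xs ys = rev ys @ xs" for xs ys :: "'b list"
    by (induction ys arbitrary: xs) simp_all
  ultimately show ?thesis by simp
qed

lemma computes_append [computes_intros]:
  fixes l :: "'c \<Rightarrow> 'b list"
  assumes "computes e (lists_data a) l" "computes e (lists_data a) m"
  shows "computes e (lists_data a) (\<lambda>x. l x @ m x)"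
proof -
  have "computes e (lists_data a) (\<lambda>x. foldl (\<lambda>acc y. y # acc) (m x) (rev (l x)))"
    by (rule computes_intros assms)+
  moreover have "foldl (\<lambda>acc y. y # acc) xs ys = rev ys @ xs" for xs ys :: "'b list"
    by (induction ys arbitrary: xs) simp_all
  ultimately show ?thesis by simp
qed

text \<open>Folding builds the result in reverse order, hence the final \<open>rev\<close>. During
  the fold the environment of \<open>f\<close> is extended by the accumulator, which the auxiliary
  fact \<open>f\<close> skips.\<close>

lemma computes_map [computes_intros]:
  assumes "computes (pair_data e a) b (\<lambda>z. f (fst z) (snd z))" "computes e (lists_data a) l"
  shows "computes e (lists_data b) (\<lambda>x. map (f x) (l x))"
proof -
  have f: "computes (pair_data e (pair_data (lists_data b) a)) b (\<lambda>z. f (fst z) (snd (snd z)))"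
    by (rule computes_comp[OF _ assms(1), of _ "\<lambda>z. (fst z, snd (snd z))", simplified])
      (rule computes_intros)+
  have "computes e (lists_data b) (\<lambda>x. rev (foldl (\<lambda>acc y. f x y # acc) [] (l x)))"
    by (rule computes_intros f assms(2))+
  moreover have "foldl (\<lambda>acc y. f x y # acc) xs ys = rev (map (f x) ys) @ xs" for x xs ys
    by (induction ys arbitrary: xs) simp_all
  ultimately show ?thesis by simp
qed

lemma computes_filter [computes_intros]:
  assumes "computes (pair_data e a) bool_data (\<lambda>z. P (fst z) (snd z))" "computes e (lists_data a) l"
  shows "computes e (lists_data a) (\<lambda>x. filter (P x) (l x))"
proof -
  have f: "computes (pair_data e (pair_data (lists_data a) a)) bool_data (\<lambda>z. P (fst z) (snd (snd z)))"
    by (rule computes_comp[OF _ assms(1), of _ "\<lambda>z. (fst z, snd (snd z))", simplified])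
      (rule computes_intros)+
  have "computes e (lists_data a)
      (\<lambda>x. rev (foldl (\<lambda>acc y. if P x y then y # acc else acc) [] (l x)))"
    by (rule computes_intros f assms(2))+
  moreover have "foldl (\<lambda>acc y. if P x y then y # acc else acc) xs ys = rev (filter (P x) ys) @ xs" for x xs ys
    by (induction ys arbitrary: xs) simp_all
  ultimately show ?thesis by simp
qed

lemma computes_list_all [computes_intros]:
  assumes "computes (pair_data e a) bool_data (\<lambda>z. P (fst z) (snd z))" "computes e (lists_data a) l"
  shows "computes e bool_data (\<lambda>x. list_all (P x) (l x))"
proof -
  have "computes e bool_data (\<lambda>x. filter (\<lambda>y. \<not> P x y) (l x) = [])"
    by (rule computes_intros assms)+
  then show ?thesis by (rule computes_cong) (simp add: list_all_iff filter_empty_conv)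
qed

lemma computes_list_ex [computes_intros]:
  assumes "computes (pair_data e a) bool_data (\<lambda>z. P (fst z) (snd z))" "computes e (lists_data a) l"
  shows "computes e bool_data (\<lambda>x. list_ex (P x) (l x))"
proof -
  have "computes e bool_data (\<lambda>x. \<not> filter (P x) (l x) = [])"
    by (rule computes_intros assms)+
  then show ?thesis by (rule computes_cong) (simp add: list_ex_iff filter_empty_conv)
qed

lemma computes_concat [computes_intros]:
  fixes l :: "'c \<Rightarrow> 'b list list"
  assumes "computes e (lists_data (lists_data a)) l"
  shows "computes e (lists_data a) (\<lambda>x. concat (l x))"
proof -
  have "computes e (lists_data a) (\<lambda>x. foldl (\<lambda>acc y. acc @ y) [] (l x))"
    by (rule computes_intros assms)+
  moreover have "foldl (\<lambda>acc y. acc @ y) xs ys = xs @ concat ys" for xs :: "'b list" and ys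
    by (induction ys arbitrary: xs) simp_all
  ultimately show ?thesis by simp
qed

section \<open>Natural numbers in unary and indexing\<close>

lemma computes_0 [computes_intros]: "computes e nat_data (\<lambda>x. 0)"
  unfolding computes_def by (intro exI[of _ PNull]) (auto intro: run_Null)

lemma computes_Suc [computes_intros]:
  "computes e nat_data f \<Longrightarrow> computes e nat_data (\<lambda>x. Suc (f x))"
  unfolding computes_def nat_data_simps using run_Node[OF run_Null] by meson

text \<open>In unary notation, a natural number is a list of units.\<close>

lemma lists_data_replicate_unit: "lists_data unit_data (replicate n ()) = nat_data n"
  by (induction n) (simp_all add: unit_data_def)

lemma computes_replicate_unit:
  "computes e nat_data f \<Longrightarrow> computes e (lists_data unit_data) (\<lambda>x. replicate (f x) ())"
  by (simp add: computes_def lists_data_replicate_unit)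

lemma computes_length [computes_intros]:
  fixes l :: "'c \<Rightarrow> 'b list"
  assumes "computes e (lists_data a) l"
  shows "computes e nat_data (\<lambda>x. length (l x))"
proof -
  have "computes e nat_data (\<lambda>x. foldl (\<lambda>n y. Suc n) 0 (l x))"
    by (rule computes_intros assms)+
  moreover have "foldl (\<lambda>n y. Suc n) k ys = k + length ys" for k and ys :: "'b list"
    by (induction ys arbitrary: k) simp_all
  ultimately show ?thesis by simp
qed

text \<open>A unary number drives the loop: iteration is a fold over that many units.\<close>

lemma computes_funpow [computes_intros]:
  assumes "computes (pair_data e s) s (\<lambda>z. f (fst z) (snd z))" "computes e nat_data n" "computes e s init"
  shows "computes e s (\<lambda>x. (f x ^^ n x) (init x))"
proof -
  have f: "computes (pair_data e (pair_data s unit_data)) s (\<lambda>z. f (fst z) (fst (snd z)))"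
    by (rule computes_comp[OF _ assms(1), of _ "\<lambda>z. (fst z, fst (snd z))", simplified])
      (rule computes_intros)+
  have "computes e s (\<lambda>x. foldl (\<lambda>acc y. f x acc) (init x) (replicate (n x) ()))"
    by (rule computes_intros computes_replicate_unit f assms)+
  moreover have "foldl (\<lambda>acc y. f x acc) i (replicate k ()) = (f x ^^ k) i" for x i k
    by (induction k arbitrary: i) (simp_all add: funpow_swap1)
  ultimately show ?thesis by simp
qed

lemma computes_nat_add [computes_intros]:
  assumes "computes e nat_data f" "computes e nat_data g"
  shows "computes e nat_data (\<lambda>x. f x + g x)"
proof -
  have "computes e nat_data (\<lambda>x. ((\<lambda>n. Suc n) ^^ f x) (g x))"
    by (rule computes_intros assms)+
  moreover have "((\<lambda>n. Suc n) ^^ k) m = k + m" for k m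
    by (induction k) simp_all
  ultimately show ?thesis by simp
qed

lemma computes_nat_diff [computes_intros]:
  assumes "computes e nat_data f" "computes e nat_data g"
  shows "computes e nat_data (\<lambda>x. f x - g x)"
proof -
  have *: "computes nat_data nat_data (\<lambda>n. n - 1)"
    unfolding computes_def
  proof (intro exI allI)
    fix n :: nat
    \<comment> \<open>\<open>PRight\<close> has no result on \<open>Null\<close>, so zero is tested
      first; a unary number serves as its own truth value.\<close>
    show "run (PIf PId PRight PNull) (nat_data n) (nat_data (n - 1))"
      by (cases n) (auto intro: run_If_true run_If_false run_Id run_Right run_Null)
  qed
  have "computes e nat_data (\<lambda>x. ((\<lambda>n. n - 1) ^^ g x) (f x))"
    by (rule computes_funpow computes_comp[OF _ *] computes_intros assms)+
  moreover have "((\<lambda>n. n - 1) ^^ k) m = m - k" for k m :: nat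
    by (induction k) simp_all
  ultimately show ?thesis by simp
qed

lemma computes_nat_le [computes_intros]:
  assumes "computes e nat_data f" "computes e nat_data g"
  shows "computes e bool_data (\<lambda>x. f x \<le> g x)"
proof -
  have "computes e bool_data (\<lambda>x. replicate (f x - g x) () = [])"
    by (rule computes_intros computes_replicate_unit assms)+
  then show ?thesis by (rule computes_cong) simp
qed

lemma computes_nat_less [computes_intros]:
  assumes "computes e nat_data f" "computes e nat_data g"
  shows "computes e bool_data (\<lambda>x. f x < g x)"
proof -
  have "computes e bool_data (\<lambda>x. \<not> g x \<le> f x)" by (rule computes_intros assms)+
  then show ?thesis by (rule computes_cong) auto
qed

lemma computes_nat_eq [computes_intros]:
  assumes "computes e nat_data f" "computes e nat_data g"
  shows "computes e bool_data (\<lambda>x. f x = g x)"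
proof -
  have "computes e bool_data (\<lambda>x. f x \<le> g x \<and> g x \<le> f x)" by (rule computes_intros assms)+
  then show ?thesis by (rule computes_cong) auto
qed

lemma computes_nat_max [computes_intros]:
  assumes "computes e nat_data f" "computes e nat_data g"
  shows "computes e nat_data (\<lambda>x. max (f x) (g x))"
proof -
  have "computes e nat_data (\<lambda>x. f x + (g x - f x))" by (rule computes_intros assms)+
  then show ?thesis by (rule computes_cong) auto
qed

lemma computes_upt [computes_intros]:
  assumes "computes e nat_data n"
  shows "computes e (lists_data nat_data) (\<lambda>x. [0..<n x])"
proof -
  have "computes e (lists_data nat_data) (\<lambda>x. ((\<lambda>l. l @ [length l]) ^^ n x) [])"
    by (rule computes_intros assms)+
  moreover have "((\<lambda>l. l @ [length l]) ^^ k) [] = [0..<k]" for k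
    by (induction k) simp_all
  ultimately show ?thesis by simp
qed

text \<open>Iterated \<open>tl\<close> stays at the empty list once the index is past the end, and
  the default is returned there.\<close>

lemma computes_nth_default [computes_intros]:
  fixes l :: "'c \<Rightarrow> 'b list"
  assumes "computes e a d" "computes e (lists_data a) l" "computes e nat_data n"
  shows "computes e a (\<lambda>x. nth_default (d x) (l x) (n x))"
proof -
  have "computes e a (\<lambda>x. case ((\<lambda>l. tl l) ^^ n x) (l x) of [] \<Rightarrow> d x | y # ys \<Rightarrow> y)"
    by (rule computes_intros assms)+
  moreover have "(tl ^^ k) ys = drop k ys" for k and ys :: "'b list"
    by (induction k) (simp_all add: drop_Suc tl_drop)
  moreover have "(case drop k ys of [] \<Rightarrow> c | y # _ \<Rightarrow> y) = nth_default c ys k" for k c and ys :: "'b list"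
    by (cases "k < length ys") (simp_all add: Cons_nth_drop_Suc[symmetric] nth_default_def)
  ultimately show ?thesis by simp
qed

lemma computes_sum_list:
  fixes l :: "'c \<Rightarrow> 'b::monoid_add list"
  assumes "computes (pair_data a a) a (\<lambda>z. fst z + snd z)" "computes e a (\<lambda>x. 0)" "computes e (lists_data a) l"
  shows "computes e a (\<lambda>x. sum_list (l x))"
proof -
  have f: "computes (pair_data e (pair_data a a)) a (\<lambda>z. fst (snd z) + snd (snd z))"
    by (rule computes_comp[OF _ assms(1), of _ "\<lambda>z. snd z", simplified]) (rule computes_intros)+
  have "computes e a (\<lambda>x. foldl (\<lambda>acc y. acc + y) 0 (l x))"
    by (rule computes_foldl f assms)+
  moreover have "foldl (\<lambda>acc y. acc + y) c ys = c + sum_list ys" for c :: 'b and ys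
    by (induction ys arbitrary: c) (simp_all add: add.assoc)
  ultimately show ?thesis by simp
qed

lemmas computes_sum_list_scalar [computes_intros] =
  computes_sum_list[where a = Scalar, OF computes_add[OF computes_fst[OF computes_id] computes_snd[OF computes_id]] computes_zero]

lemmas computes_sum_list_nat [computes_intros] =
  computes_sum_list[where a = nat_data, OF computes_nat_add[OF computes_fst[OF computes_id] computes_snd[OF computes_id]] computes_0]

lemma computes_n_lists [computes_intros]:
  fixes l :: "'c \<Rightarrow> 'b list"
  assumes "computes e (lists_data a) l" "computes e nat_data n"
  shows "computes e (lists_data (lists_data a)) (\<lambda>x. List.n_lists (n x) (l x))"
proof -
  have f: "computes (pair_data (pair_data e (lists_data (lists_data a))) (lists_data a)) (lists_data a) (\<lambda>z. l (fst (fst z)))"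
    by (rule computes_comp[OF _ assms(1), of _ "\<lambda>z. fst (fst z)", simplified]) (rule computes_intros)+
  have "computes e (lists_data (lists_data a))
      (\<lambda>x. ((\<lambda>yss. concat (map (\<lambda>ys. map (\<lambda>y. y # ys) (l x)) yss)) ^^ n x) [[]])"
    by (rule computes_intros f assms)+
  moreover have "((\<lambda>yss. concat (map (\<lambda>ys. map (\<lambda>y. y # ys) xs) yss)) ^^ k) [[]] = List.n_lists k xs"
    for k and xs :: "'b list"
    by (induction k) simp_all
  ultimately show ?thesis by simp
qed

section \<open>Reduction of polynomials given by terms\<close>

text \<open>Exponent lists are determined only up to trailing zeros. Therefore entries are read with
  default zero, up to the greater length, and equality of monomials is the relation
  \<open>exps_eq\<close> instead of equality of lists.\<close>

definition exps_add :: "nat list \<Rightarrow> nat list \<Rightarrow> nat list" where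
  "exps_add xs ys = map (\<lambda>i. nth_default 0 xs i + nth_default 0 ys i) [0..<max (length xs) (length ys)]"

definition exps_diff :: "nat list \<Rightarrow> nat list \<Rightarrow> nat list" where
  "exps_diff xs ys = map (\<lambda>i. nth_default 0 xs i - nth_default 0 ys i) [0..<max (length xs) (length ys)]"

definition exps_eq :: "nat list \<Rightarrow> nat list \<Rightarrow> bool" where
  "exps_eq xs ys \<longleftrightarrow> list_all (\<lambda>i. nth_default 0 xs i = nth_default 0 ys i) [0..<max (length xs) (length ys)]"

definition exps_dvd :: "nat list \<Rightarrow> nat list \<Rightarrow> bool" where
  "exps_dvd xs ys \<longleftrightarrow> list_all (\<lambda>i. nth_default 0 xs i \<le> nth_default 0 ys i) [0..<length xs]"

definition exps_less :: "nat list \<Rightarrow> nat list \<Rightarrow> bool" where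
  "exps_less xs ys \<longleftrightarrow> list_ex (\<lambda>i. nth_default 0 xs i < nth_default 0 ys i \<and>
     list_all (\<lambda>j. i < j \<longrightarrow> nth_default 0 xs j = nth_default 0 ys j) [0..<max (length xs) (length ys)])
     [0..<max (length xs) (length ys)]"

lemma nth_exps_add: "Poly_Mapping.nth (exps_add xs ys) = Poly_Mapping.nth xs + Poly_Mapping.nth ys"
  by (rule poly_mapping_eqI) (auto simp: exps_add_def lookup_add nth_default_def)

lemma nth_exps_diff: "Poly_Mapping.nth (exps_diff xs ys) = Poly_Mapping.nth xs - Poly_Mapping.nth ys"
  by (rule poly_mapping_eqI) (auto simp: exps_diff_def lookup_minus nth_default_def)

lemma exps_eq_iff: "exps_eq xs ys \<longleftrightarrow> Poly_Mapping.nth xs = Poly_Mapping.nth ys"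
proof
  assume eq: "exps_eq xs ys"
  show "Poly_Mapping.nth xs = Poly_Mapping.nth ys"
  proof (rule poly_mapping_eqI)
    fix i
    show "Poly_Mapping.lookup (Poly_Mapping.nth xs) i = Poly_Mapping.lookup (Poly_Mapping.nth ys) i"
      using eq by (cases "i < max (length xs) (length ys)") (auto simp: exps_eq_def list_all_iff nth_default_def)
  qed
next
  assume "Poly_Mapping.nth xs = Poly_Mapping.nth ys"
  then have "Poly_Mapping.lookup (Poly_Mapping.nth xs) = Poly_Mapping.lookup (Poly_Mapping.nth ys)" by (rule arg_cong)
  then show "exps_eq xs ys" by (simp add: exps_eq_def list_all_iff)
qed

lemma exps_dvd_iff: "exps_dvd xs ys \<longleftrightarrow> mon_divides (Poly_Mapping.nth xs) (Poly_Mapping.nth ys)"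
proof -
  have "nth_default 0 xs i = 0" if "\<not> i < length xs" for i using that by (simp add: nth_default_def)
  then show ?thesis
    unfolding exps_dvd_def list_all_iff mon_divides_iff lookup_nth
    by (metis atLeast0LessThan atLeast_upt lessThan_iff zero_le)
qed

lemma exps_less_iff: "exps_less xs ys \<longleftrightarrow> mon_less (Poly_Mapping.nth xs) (Poly_Mapping.nth ys)"
proof -
  let ?L = "max (length xs) (length ys)"
  have out: "nth_default 0 xs i = 0" "nth_default 0 ys i = 0" if "\<not> i < ?L" for i
    using that by (simp_all add: nth_default_def less_max_iff_disj)
  have tail: "list_all (\<lambda>j. i < j \<longrightarrow> nth_default 0 xs j = nth_default 0 ys j) [0..<?L] \<longleftrightarrow>
    (\<forall>j>i. nth_default 0 xs j = nth_default 0 ys j)" for i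
    unfolding list_all_iff using out by (metis atLeast0LessThan atLeast_upt lessThan_iff)
  have "i < ?L" if "nth_default 0 xs i < nth_default 0 ys i" for i
    using out[of i] that by (cases "i < ?L") simp_all
  then show ?thesis
    unfolding exps_less_def mon_less_def lookup_nth tail list_ex_iff by auto
qed

section \<open>Leading terms and S-polynomials of term lists\<close>

text \<open>A monomial may occur several times and with different trailing zeros, so its true
  coefficient is a sum over the list.\<close>

definition terms_coeff :: "'k::field terms \<Rightarrow> nat list \<Rightarrow> 'k" where
  "terms_coeff ts es = sum_list (map (\<lambda>t. if exps_eq (snd t) es then fst t else 0) ts)"

text \<open>Listed monomials whose coefficients sum to zero must not count. For the zero polynomial
  the outcome is the empty list, which stands for the monomial \<open>1\<close>, in accordance with
  \<open>lm 0 = 0\<close>.\<close>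

definition terms_lm :: "'k::field terms \<Rightarrow> nat list" where
  "terms_lm ts = (case filter (\<lambda>es. \<not> terms_coeff ts es = 0 \<and>
       list_all (\<lambda>fs. \<not> terms_coeff ts fs = 0 \<longrightarrow> \<not> exps_less es fs) (map (\<lambda>t. snd t) ts))
     (map (\<lambda>t. snd t) ts) of [] \<Rightarrow> [] | es # _ \<Rightarrow> es)"

definition terms_lc :: "'k::field terms \<Rightarrow> 'k" where
  "terms_lc ts = terms_coeff ts (terms_lm ts)"

definition terms_scale :: "'k::field \<Rightarrow> nat list \<Rightarrow> 'k terms \<Rightarrow> 'k terms" where
  "terms_scale c m ts = map (\<lambda>t. (c * fst t, exps_add m (snd t))) ts"

text \<open>Terms are only collected, never merged; the cancellation shows up when
  \<open>terms_coeff\<close> sums.\<close>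

definition terms_spol :: "'k::field terms \<Rightarrow> 'k terms \<Rightarrow> 'k terms" where
  "terms_spol f g = terms_scale (terms_lc g) (exps_diff (terms_lm g) (terms_lm f)) f
     @ terms_scale (- terms_lc f) (exps_diff (terms_lm f) (terms_lm g)) g"

lemma poly_of_terms_simps [simp]:
  "poly_of_terms [] = 0"
  "poly_of_terms (t # ts) = Poly_Mapping.single (Poly_Mapping.nth (snd t)) (fst t) + poly_of_terms ts"
  "poly_of_terms (ts @ us) = poly_of_terms ts + poly_of_terms us"
  by (simp_all add: poly_of_terms_def case_prod_beta)

lemma lookup_poly_of_terms:
  "Poly_Mapping.lookup (poly_of_terms ts) (Poly_Mapping.nth es) = terms_coeff ts es"
  by (induction ts) (auto simp: terms_coeff_def lookup_add lookup_single exps_eq_iff when_def)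

lemma keys_poly_of_terms: "Poly_Mapping.keys (poly_of_terms ts) \<subseteq> Poly_Mapping.nth ` snd ` set ts"
proof (induction ts)
  case (Cons t ts)
  then show ?case
    using Poly_Mapping.keys_add[of "Poly_Mapping.single (Poly_Mapping.nth (snd t)) (fst t)" "poly_of_terms ts"]
    by (auto split: if_splits)
qed simp

text \<open>All monomials of the polynomial are listed, so searching the list finds the leading one,
  and the search is empty only for the zero polynomial.\<close>

lemma nth_terms_lm: "Poly_Mapping.nth (terms_lm ts) = lm (poly_of_terms ts)"
proof -
  let ?f = "poly_of_terms ts"
  have ex: "\<exists>es\<in>snd ` set ts. u = Poly_Mapping.nth es" if "u \<in> Poly_Mapping.keys ?f" for u
    using that keys_poly_of_terms[of ts] by blast
  have keys: "Poly_Mapping.nth es \<in> Poly_Mapping.keys ?f \<longleftrightarrow> terms_coeff ts es \<noteq> 0" for es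
    by (simp add: in_keys_iff lookup_poly_of_terms)
  define P where "P es \<longleftrightarrow> \<not> terms_coeff ts es = 0 \<and>
       list_all (\<lambda>fs. \<not> terms_coeff ts fs = 0 \<longrightarrow> \<not> exps_less es fs) (map (\<lambda>t. snd t) ts)" for es
  have P1: "Poly_Mapping.nth es = lm ?f" if "P es" for es
  proof (rule lm_eqI[symmetric])
    show "Poly_Mapping.nth es \<in> Poly_Mapping.keys ?f" using that keys by (simp add: P_def)
    fix u assume u: "u \<in> Poly_Mapping.keys ?f"
    then obtain fs where fs: "fs \<in> snd ` set ts" "u = Poly_Mapping.nth fs" using ex by blast
    then have "\<not> exps_less es fs"
      using that u keys by (auto simp: P_def list_all_iff)
    then show "mon_le u (Poly_Mapping.nth es)"
      by (simp add: fs(2) exps_less_iff mon_le_iff_not_less)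
  qed
  have P2: "P es" if "?f \<noteq> 0" "Poly_Mapping.nth es = lm ?f" for es
  proof -
    have "\<not> exps_less es fs" if "terms_coeff ts fs \<noteq> 0" for fs
      using lm_max[of "Poly_Mapping.nth fs" ?f] keys[of fs] that \<open>Poly_Mapping.nth es = lm ?f\<close>
      by (simp add: exps_less_iff mon_le_iff_not_less)
    moreover have "terms_coeff ts es \<noteq> 0"
      using lm_in_keys[OF that(1)] keys[of es] that(2) by simp
    ultimately show ?thesis by (simp add: P_def list_all_iff)
  qed
  show ?thesis
  proof (cases "filter P (map (\<lambda>t. snd t) ts)")
    case Nil
    have "?f = 0"
    proof (rule ccontr)
      assume "?f \<noteq> 0"
      then obtain es where "es \<in> snd ` set ts" "lm ?f = Poly_Mapping.nth es"
        using ex[OF lm_in_keys] by auto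
      then show False using Nil P2[OF \<open>?f \<noteq> 0\<close>, of es] by (auto simp: filter_empty_conv)
    qed
    then show ?thesis using Nil by (simp add: terms_lm_def P_def[abs_def] lm_def)
  next
    case (Cons es ess)
    then have "es \<in> set (filter P (map (\<lambda>t. snd t) ts))" by simp
    then have "P es" by simp
    then show ?thesis using P1[of es] Cons by (simp add: terms_lm_def P_def[abs_def])
  qed
qed

lemma terms_lc_eq: "terms_lc ts = lc (poly_of_terms ts)"
  by (simp add: terms_lc_def lc_def nth_terms_lm flip: lookup_poly_of_terms)

lemma terms_lc_eq_0_iff: "terms_lc ts = 0 \<longleftrightarrow> poly_of_terms ts = 0"
  by (simp add: terms_lc_eq lc_eq_0_iff)

lemma poly_of_terms_scale:
  "poly_of_terms (terms_scale c m ts) = Poly_Mapping.single (Poly_Mapping.nth m) c * poly_of_terms ts"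
  by (induction ts) (simp_all add: terms_scale_def nth_exps_add mult_single distrib_left)

lemma poly_of_terms_spol:
  "poly_of_terms (terms_spol f g) = spol (poly_of_terms f) (poly_of_terms g)"
  by (simp add: terms_spol_def spol_def poly_of_terms_scale nth_exps_diff nth_terms_lm terms_lc_eq single_uminus)

section \<open>Reduction to a remainder\<close>

text \<open>The zero polynomial must have no reducers: as \<open>lm 0 = 0\<close>, a nonzero
  constant would reduce it to itself forever.\<close>

definition reducers :: "'k::field terms list \<Rightarrow> 'k terms \<Rightarrow> 'k terms list" where
  "reducers ps g = filter (\<lambda>p. \<not> terms_lc p = 0 \<and> \<not> terms_lc g = 0 \<and>
     exps_dvd (terms_lm p) (terms_lm g)) ps"

definition reduce_step :: "'k::field terms list \<Rightarrow> 'k terms \<Rightarrow> 'k terms" where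
  "reduce_step ps g = (case reducers ps g of [] \<Rightarrow> g | p # _ \<Rightarrow> terms_spol g p)"

definition reduce :: "'k::field terms list \<Rightarrow> 'k terms \<Rightarrow> 'k terms" where
  "reduce ps f = the (while_option (\<lambda>g. \<not> reducers ps g = []) (\<lambda>g. reduce_step ps g) f)"

lemma in_reducers_iff:
  "p \<in> set (reducers ps g) \<longleftrightarrow> p \<in> set ps \<and> poly_of_terms p \<noteq> 0 \<and> poly_of_terms g \<noteq> 0 \<and>
    mon_divides (lm (poly_of_terms p)) (lm (poly_of_terms g))"
  by (auto simp: reducers_def terms_lc_eq_0_iff exps_dvd_iff nth_terms_lm)

lemma reduce_step_cases:
  assumes "\<not> reducers ps g = []"
  obtains p where "p \<in> set ps" "poly_of_terms p \<noteq> 0" "poly_of_terms g \<noteq> 0"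
    "mon_divides (lm (poly_of_terms p)) (lm (poly_of_terms g))"
    "poly_of_terms (reduce_step ps g) = spol (poly_of_terms g) (poly_of_terms p)"
proof -
  obtain p qs where p: "reducers ps g = p # qs" using assms by (cases "reducers ps g") auto
  have "p \<in> set (reducers ps g)" by (simp add: p)
  moreover have "poly_of_terms (reduce_step ps g) = spol (poly_of_terms g) (poly_of_terms p)"
    by (simp add: reduce_step_def p poly_of_terms_spol)
  ultimately show ?thesis using that unfolding in_reducers_iff by blast
qed

text \<open>A step lowers the leading monomial or produces zero. The first component of the measure
  covers the second possibility, since passing from a nonzero constant to zero leaves
  \<open>lm\<close> at \<open>0\<close>.\<close>

lemma reduce_terminates:
  "\<exists>t. while_option (\<lambda>g. \<not> reducers ps g = []) (\<lambda>g. reduce_step ps g) f = Some t"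
proof (rule wf_while_option_Some[where P = "\<lambda>_. True"])
  let ?m = "\<lambda>g. (if poly_of_terms g = 0 then 0 else 1 :: nat, lm (poly_of_terms g))"
  have wf: "wf (inv_image (less_than <*lex*> {(u, v). mon_less u v}) ?m)"
    by (intro wf_inv_image wf_lex_prod wf_less_than wf_mon_less)
  have dec: "(reduce_step ps g, g) \<in> inv_image (less_than <*lex*> {(u, v). mon_less u v}) ?m"
    if "\<not> reducers ps g = []" for g
    using that
  proof (rule reduce_step_cases)
    fix p
    assume p: "p \<in> set ps" "poly_of_terms p \<noteq> 0" "poly_of_terms g \<noteq> 0"
      "mon_divides (lm (poly_of_terms p)) (lm (poly_of_terms g))"
      "poly_of_terms (reduce_step ps g) = spol (poly_of_terms g) (poly_of_terms p)"
    show ?thesis using lm_spol_less[OF p(4)] p(3) by (auto simp: p(5))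
  qed
  show "wf {(t, s). (True \<and> \<not> reducers ps s = []) \<and> t = reduce_step ps s}"
    by (rule wf_subset[OF wf]) (use dec in blast)
qed simp_all

lemma reduce_induct:
  assumes "P f" "\<And>g. P g \<Longrightarrow> \<not> reducers ps g = [] \<Longrightarrow> P (reduce_step ps g)"
  shows "P (reduce ps f)"
proof -
  obtain t where t: "while_option (\<lambda>g. \<not> reducers ps g = []) (\<lambda>g. reduce_step ps g) f = Some t"
    using reduce_terminates by blast
  have "P t" by (rule while_option_rule[OF _ t]) (use assms in auto)
  then show ?thesis by (simp add: reduce_def t)
qed

lemma reducers_reduce: "reducers ps (reduce ps f) = []"
proof -
  obtain t where t: "while_option (\<lambda>g. \<not> reducers ps g = []) (\<lambda>g. reduce_step ps g) f = Some t"
    using reduce_terminates by blast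
  then show ?thesis using while_option_stop[OF t] by (simp add: reduce_def t)
qed

lemma reduce_irreducible:
  assumes "p \<in> set ps" "poly_of_terms p \<noteq> 0" "poly_of_terms (reduce ps f) \<noteq> 0"
  shows "\<not> mon_divides (lm (poly_of_terms p)) (lm (poly_of_terms (reduce ps f)))"
  using reducers_reduce[of ps f] in_reducers_iff[of p ps "reduce ps f"] assms by auto

lemma reduce_closed:
  assumes "poly_of_terms f \<in> S" "\<And>g p. g \<in> S \<Longrightarrow> p \<in> set ps \<Longrightarrow> spol g (poly_of_terms p) \<in> S"
  shows "poly_of_terms (reduce ps f) \<in> S"
  by (rule reduce_induct) (use assms in \<open>auto elim!: reduce_step_cases\<close>)

text \<open>Each step writes the current polynomial in terms of the next one and a multiple of a
  reducer; going back from remainder zero collects these multiples, all of which lead below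
  \<open>w\<close>.\<close>

lemma span_below_reduce:
  assumes "poly_of_terms (reduce ps f) = 0" "poly_of_terms f \<noteq> 0 \<longrightarrow> mon_less (lm (poly_of_terms f)) w"
  shows "poly_of_terms f \<in> span_below (poly_of_terms ` set ps - {0}) w"
proof -
  let ?S = "span_below (poly_of_terms ` set ps - {0}) w"
  \<comment> \<open>The invariant pairs the bound on the leading monomial with an implication from
    the current polynomial back to \<open>f\<close>, so the representation is assembled while
    reducing forwards.\<close>
  have "(poly_of_terms (reduce ps f) \<noteq> 0 \<longrightarrow> mon_less (lm (poly_of_terms (reduce ps f))) w) \<and>
      (poly_of_terms (reduce ps f) \<in> ?S \<longrightarrow> poly_of_terms f \<in> ?S)"
  proof (rule reduce_induct, goal_cases)
    case (2 g)
    from 2(2) show ?case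
    proof (rule reduce_step_cases)
      fix p
      assume p: "p \<in> set ps" "poly_of_terms p \<noteq> 0" "poly_of_terms g \<noteq> 0"
        "mon_divides (lm (poly_of_terms p)) (lm (poly_of_terms g))"
        "poly_of_terms (reduce_step ps g) = spol (poly_of_terms g) (poly_of_terms p)"
      have less: "mon_less (lm (poly_of_terms g)) w" using 2(1) p(3) by blast
      have "poly_of_terms p \<in> poly_of_terms ` set ps - {0}" using p(1,2) by blast
      then have "spol (poly_of_terms g) (poly_of_terms p) \<in> ?S \<Longrightarrow> poly_of_terms g \<in> ?S"
        by (rule span_below_spol[OF p(4) _ p(2) less])
      moreover have "mon_less (lm (spol (poly_of_terms g) (poly_of_terms p))) w"
        if "spol (poly_of_terms g) (poly_of_terms p) \<noteq> 0"
        using mon_less_trans[OF lm_spol_less[OF p(4) that] less] .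
      ultimately show ?thesis using 2(1) unfolding p(5) by simp
    qed
  qed (use assms(2) in blast)
  moreover have "0 \<in> ?S" by (simp add: span_below_def poly_vs.span_zero)
  ultimately show ?thesis using assms(1) by simp
qed

section \<open>The completion procedure\<close>

definition perm_lists :: "nat \<Rightarrow> nat list list" where
  "perm_lists N = filter (\<lambda>t. list_all (\<lambda>k. list_all (\<lambda>l. \<not> k = l \<longrightarrow>
     \<not> nth_default 0 t k = nth_default 0 t l) [0..<N]) [0..<N]) (List.n_lists N [0..<N])"

definition list_perm :: "nat list \<Rightarrow> nat \<Rightarrow> nat" where
  "list_perm t k = (if k < length t then t ! k else k)"

text \<open>The list \<open>t\<close> acts by the inverse of \<^term>\<open>list_perm t\<close>.\<close>

definition permute_terms :: "nat list \<Rightarrow> 'k terms \<Rightarrow> 'k terms" where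
  "permute_terms t ts = map (\<lambda>u. (fst u, map (\<lambda>i. nth_default 0 (snd u) i) t)) ts"

definition orbit_terms :: "nat \<Rightarrow> 'k terms list \<Rightarrow> 'k terms list" where
  "orbit_terms N B = concat (map (\<lambda>b. map (\<lambda>t. permute_terms t b) (perm_lists N)) B)"

lemma set_perm_lists: "set (perm_lists N) = {t. length t = N \<and> set t \<subseteq> {..<N} \<and> distinct t}"
proof -
  have "list_all (\<lambda>k. list_all (\<lambda>l. \<not> k = l \<longrightarrow> \<not> nth_default 0 t k = nth_default 0 t l) [0..<N]) [0..<N]
      \<longleftrightarrow> distinct t" if "length t = N" for t :: "nat list"
    using that by (auto simp: list_all_iff distinct_conv_nth nth_default_def)
  then show ?thesis
    by (auto simp: perm_lists_def set_n_lists)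
qed

lemma list_perm_permutes:
  assumes "t \<in> set (perm_lists N)"
  shows "list_perm t permutes {..<N}"
proof -
  have t: "length t = N" "set t \<subseteq> {..<N}" "distinct t"
    using assms by (simp_all add: set_perm_lists)
  have "set t = {..<N}"
    using t by (intro card_subset_eq) (simp_all add: distinct_card)
  then have "bij_betw ((!) t) {..<N} {..<N}"
    by (intro bij_betw_nth t(3)) (simp_all add: t(1))
  then have "bij_betw (list_perm t) {..<N} {..<N}"
    using t(1) by (subst bij_betw_cong[of _ _ "(!) t"]) (auto simp: list_perm_def)
  then show ?thesis
    by (rule bij_imp_permutes) (simp add: list_perm_def t(1))
qed

lemma ex_list_perm:
  assumes "\<sigma> permutes {..<N}"
  shows "\<exists>t\<in>set (perm_lists N). list_perm t = \<sigma>"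
proof
  show "map \<sigma> [0..<N] \<in> set (perm_lists N)"
    using permutes_inj_on[OF assms] permutes_image[OF assms]
    by (auto simp: set_perm_lists distinct_map atLeast0LessThan)
  show "list_perm (map \<sigma> [0..<N]) = \<sigma>"
    using permutes_not_in[OF assms] by (auto simp: list_perm_def fun_eq_iff)
qed

text \<open>Entry \<open>k\<close> of the new list is the exponent at index
  \<open>list_perm t k\<close>, so that index moves to \<open>k\<close>, whence the inverse. By
  \<open>length es \<le> N\<close> no exponent is cut off.\<close>

lemma nth_permute:
  assumes t: "t \<in> set (perm_lists N)" and es: "length es \<le> N"
  shows "Poly_Mapping.nth (map (\<lambda>i. nth_default 0 es i) t) = perm_mon (inv (list_perm t)) (Poly_Mapping.nth es)"
proof (rule poly_mapping_eqI)
  fix k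
  let ?\<pi> = "list_perm t"
  have \<pi>: "?\<pi> permutes {..<N}" using t by (rule list_perm_permutes)
  have "Poly_Mapping.lookup (perm_mon (inv ?\<pi>) (Poly_Mapping.nth es)) k
      = Poly_Mapping.lookup (perm_mon (inv ?\<pi>) (Poly_Mapping.nth es)) (inv ?\<pi> (?\<pi> k))"
    using permutes_inverses(2)[OF \<pi>] by simp
  also have "\<dots> = nth_default 0 es (?\<pi> k)"
    using lookup_perm_mon[OF permutes_inj[OF permutes_inv[OF \<pi>]]] by simp
  also have "\<dots> = Poly_Mapping.lookup (Poly_Mapping.nth (map (\<lambda>i. nth_default 0 es i) t)) k"
    using t es by (auto simp: set_perm_lists list_perm_def nth_default_def)
  finally show "Poly_Mapping.lookup (Poly_Mapping.nth (map (\<lambda>i. nth_default 0 es i) t)) k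
      = Poly_Mapping.lookup (perm_mon (inv ?\<pi>) (Poly_Mapping.nth es)) k" by simp
qed

lemma poly_of_permute_terms:
  assumes "t \<in> set (perm_lists N)" "\<And>u. u \<in> set ts \<Longrightarrow> length (snd u) \<le> N"
  shows "poly_of_terms (permute_terms t ts) = perm_poly (inv (list_perm t)) (poly_of_terms ts)"
  using assms(2)
proof (induction ts)
  case (Cons u ts)
  then have "poly_of_terms (permute_terms t ts) = perm_poly (inv (list_perm t)) (poly_of_terms ts)"
    by simp
  moreover have "length (snd u) \<le> N" using Cons.prems by simp
  ultimately show ?case
    by (simp add: permute_terms_def nth_permute[OF assms(1)] perm_poly_add perm_poly_single)
qed (simp add: permute_terms_def perm_poly_0)

text \<open>Permutations of \<open>{..<N}\<close> are closed under inverses, so acting by inverses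
  produces the same orbit.\<close>

lemma poly_of_orbit_terms:
  assumes "\<And>ts u. ts \<in> set B \<Longrightarrow> u \<in> set ts \<Longrightarrow> length (snd u) \<le> N"
  shows "poly_of_terms ` set (orbit_terms N B) = orbit N (poly_of_terms ` set B)"
proof (intro set_eqI iffI)
  fix p assume "p \<in> poly_of_terms ` set (orbit_terms N B)"
  then obtain ts t where t: "ts \<in> set B" "t \<in> set (perm_lists N)" "p = poly_of_terms (permute_terms t ts)"
    by (auto simp: orbit_terms_def)
  have "p = perm_poly (inv (list_perm t)) (poly_of_terms ts)"
    unfolding t(3) using t(2) assms[OF t(1)] by (rule poly_of_permute_terms)
  then show "p \<in> orbit N (poly_of_terms ` set B)"
    unfolding orbit_def using permutes_inv[OF list_perm_permutes[OF t(2)]] t(1) by blast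
next
  fix p assume "p \<in> orbit N (poly_of_terms ` set B)"
  then obtain \<sigma> ts where \<sigma>: "\<sigma> permutes {..<N}" "ts \<in> set B" "p = perm_poly \<sigma> (poly_of_terms ts)"
    unfolding orbit_def by blast
  obtain t where t: "t \<in> set (perm_lists N)" "list_perm t = inv \<sigma>"
    using ex_list_perm[OF permutes_inv[OF \<sigma>(1)]] by blast
  have "poly_of_terms (permute_terms t ts) = p"
    using poly_of_permute_terms[OF t(1) assms[OF \<sigma>(2)]] permutes_inv_inv[OF \<sigma>(1)] by (simp add: t(2) \<sigma>(3))
  moreover have "permute_terms t ts \<in> set (orbit_terms N B)"
    using t(1) \<sigma>(2) by (auto simp: orbit_terms_def)
  ultimately show "p \<in> poly_of_terms ` set (orbit_terms N B)" by blast
qed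

lemma vars_poly_of_terms:
  assumes "\<And>u. u \<in> set ts \<Longrightarrow> length (snd u) \<le> n"
  shows "vars (poly_of_terms ts) \<subseteq> {..<n}"
proof
  fix i assume "i \<in> vars (poly_of_terms ts)"
  then obtain u where u: "u \<in> set ts" "i \<in> Poly_Mapping.keys (Poly_Mapping.nth (snd u))"
    using keys_poly_of_terms[of ts] unfolding vars_def by blast
  then have "nth_default 0 (snd u) i \<noteq> 0" by (simp add: in_keys_iff del: keys_nth)
  then have "i < length (snd u)" by (auto simp: nth_default_def split: if_splits)
  then show "i \<in> {..<n}" using assms[OF u(1)] by simp
qed

section \<open>Bounds on the indeterminates of a round\<close>

definition num_vars :: "'k terms list \<Rightarrow> nat" where
  "num_vars B = sum_list (map (\<lambda>t. length (snd t)) (concat B))"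

lemma length_le_num_vars: "ts \<in> set B \<Longrightarrow> u \<in> set ts \<Longrightarrow> length (snd u) \<le> num_vars B"
  unfolding num_vars_def by (intro member_le_sum_list) auto

text \<open>Two polynomials in \<open>n\<close> indeterminates, permuted arbitrarily, involve at most \<open>2 n\<close>
  indeterminates, so S-polynomials need only be considered in that many.\<close>

definition bound :: "'k terms list \<Rightarrow> nat" where
  "bound B = num_vars B + num_vars B"

definition stage :: "'k terms list \<Rightarrow> 'k terms list" where
  "stage B = orbit_terms (bound B) B"

lemma poly_of_stage: "poly_of_terms ` set (stage B) = orbit (bound B) (poly_of_terms ` set B)"
  unfolding stage_def
proof (rule poly_of_orbit_terms)
  show "length (snd u) \<le> bound B" if "ts \<in> set B" "u \<in> set ts" for ts u
    using length_le_num_vars[OF that] by (simp add: bound_def)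
qed

lemma vars_le_num_vars: "b \<in> poly_of_terms ` set B \<Longrightarrow> vars b \<subseteq> {..<num_vars B}"
  using vars_poly_of_terms length_le_num_vars by blast

lemma vars_stage:
  assumes "p \<in> set (stage B)"
  shows "vars (poly_of_terms p) \<subseteq> {..<bound B}"
proof -
  have "poly_of_terms p \<in> orbit (bound B) (poly_of_terms ` set B)"
    using assms poly_of_stage by blast
  then obtain \<sigma> b where \<sigma>: "\<sigma> permutes {..<bound B}" "b \<in> poly_of_terms ` set B" "poly_of_terms p = perm_poly \<sigma> b"
    unfolding orbit_def by blast
  have "vars b \<subseteq> {..<bound B}"
    using vars_le_num_vars[OF \<sigma>(2)] by (auto simp: bound_def)
  then show ?thesis
    using permutes_image[OF \<sigma>(1)] by (auto simp: \<sigma>(3) vars_perm_poly[OF permutes_inj[OF \<sigma>(1)]])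
qed

section \<open>The completion loop\<close>

definition spairs :: "'k::field terms list \<Rightarrow> 'k terms list" where
  "spairs ps = concat (map (\<lambda>p. map (\<lambda>q. terms_spol p q) ps) ps)"

definition remainders :: "'k::field terms list \<Rightarrow> 'k terms list" where
  "remainders ps = filter (\<lambda>r. \<not> terms_lc r = 0) (map (\<lambda>s. reduce ps s) (spairs ps))"

definition completion_step :: "'k::field terms list \<Rightarrow> 'k terms list" where
  "completion_step B = remainders (stage B) @ B"

definition completion :: "'k::field terms list \<Rightarrow> 'k terms list" where
  "completion B = the (while_option (\<lambda>B. \<not> remainders (stage B) = []) (\<lambda>B. completion_step B) B)"

text \<open>Reduction steps are S-polynomials as well, so closure under \<open>spol\<close> is
  enough. It is used for \<open>S\<close> the ideal and for \<open>S\<close> the polynomials in the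
  first indeterminates.\<close>

lemma remainders_closed:
  assumes r: "r \<in> set (remainders ps)" and ps: "\<And>p. p \<in> set ps \<Longrightarrow> poly_of_terms p \<in> S"
    and S: "\<And>f g. f \<in> S \<Longrightarrow> g \<in> S \<Longrightarrow> spol f g \<in> S"
  shows "poly_of_terms r \<in> S"
proof -
  obtain p q where pq: "p \<in> set ps" "q \<in> set ps" "r = reduce ps (terms_spol p q)"
    using r by (auto simp: remainders_def spairs_def)
  show ?thesis
    unfolding pq(3)
    by (rule reduce_closed) (use pq ps S in \<open>auto simp: poly_of_terms_spol\<close>)
qed

lemma remainders_irreducible:
  assumes "r \<in> set (remainders ps)"
  shows "poly_of_terms r \<noteq> 0"
    and "p \<in> poly_of_terms ` set ps \<Longrightarrow> p \<noteq> 0 \<Longrightarrow> \<not> mon_divides (lm p) (lm (poly_of_terms r))"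
proof -
  show *: "poly_of_terms r \<noteq> 0" using assms by (simp add: remainders_def terms_lc_eq_0_iff)
  obtain s where "r = reduce ps s" using assms by (auto simp: remainders_def)
  then show "\<not> mon_divides (lm p) (lm (poly_of_terms r))"
    if "p \<in> poly_of_terms ` set ps" "p \<noteq> 0"
    using that * reduce_irreducible by blast
qed

lemma spol_in_ideal:
  assumes "symmetric_ideal I" "f \<in> I" "g \<in> I"
  shows "spol f g \<in> I"
proof -
  have "poly_ideal.subspace I" using assms(1) unfolding symmetric_ideal_def by blast
  then show ?thesis
    unfolding spol_def using assms(2,3) by (intro poly_ideal.subspace_diff poly_ideal.subspace_scale)
qed

lemma sym_ideal_gen_completion_step:
  "sym_ideal_gen (poly_of_terms ` set (completion_step B)) = sym_ideal_gen (poly_of_terms ` set B)"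
proof
  let ?I = "sym_ideal_gen (poly_of_terms ` set B)"
  have "poly_of_terms p \<in> ?I" if "p \<in> set (stage B)" for p
    using that poly_of_stage orbit_subset_sym_ideal_gen by blast
  then have "poly_of_terms r \<in> ?I" if "r \<in> set (remainders (stage B))" for r
    using that spol_in_ideal[OF symmetric_ideal_sym_ideal_gen] by (blast intro: remainders_closed)
  then have "poly_of_terms ` set (completion_step B) \<subseteq> ?I"
    using sym_ideal_gen_superset[of "poly_of_terms ` set B"] by (auto simp: completion_step_def)
  then show "sym_ideal_gen (poly_of_terms ` set (completion_step B)) \<subseteq> ?I"
    by (rule sym_ideal_gen_minimal[OF symmetric_ideal_sym_ideal_gen])
  have "poly_of_terms ` set B \<subseteq> sym_ideal_gen (poly_of_terms ` set (completion_step B))"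
    using sym_ideal_gen_superset[of "poly_of_terms ` set (completion_step B)"] by (auto simp: completion_step_def)
  then show "?I \<subseteq> sym_ideal_gen (poly_of_terms ` set (completion_step B))"
    by (rule sym_ideal_gen_minimal[OF symmetric_ideal_sym_ideal_gen])
qed

text \<open>Otherwise Higman's lemma provides \<open>i < j\<close> such that an order preserving renaming takes the
  leading monomial of the \<open>i\<close>-th remainder to a divisor of that of the \<open>j\<close>-th; but the renamed
  \<open>i\<close>-th remainder was available when the \<open>j\<close>-th was reduced.\<close>

lemma completion_terminates:
  fixes B :: "'k::field terms list"
  shows "\<exists>t. while_option (\<lambda>B. \<not> remainders (stage B) = []) (\<lambda>B. completion_step B) B = Some t"
proof (rule ccontr)
  assume "\<not> ?thesis"
  then have ne: "remainders (stage ((completion_step ^^ k) B)) \<noteq> []" for k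
    unfolding while_option_def by (auto split: if_splits)
  define C where "C k = (completion_step ^^ k) B" for k
  \<comment> \<open>One remainder per round suffices for the contradiction; it belongs to the list
    of every later round.\<close>
  define r where "r k = hd (remainders (stage (C k)))" for k
  define f where "f k = poly_of_terms (r k)" for k
  have r: "r k \<in> set (remainders (stage (C k)))" for k
    using ne[of k] by (simp add: r_def C_def)
  have vars_f: "vars (f k) \<subseteq> {..<bound (C k)}" for k
    using remainders_closed[OF r[of k], of "{g. vars g \<subseteq> {..<bound (C k)}}"] vars_stage[of _ "C k"]
      vars_spol by (fastforce simp: f_def)
  have C_mono: "set (C i) \<subseteq> set (C j)" if "i \<le> j" for i j
    using that by (rule lift_Suc_mono_le[rotated]) (auto simp: C_def completion_step_def)
  have r_in: "r i \<in> set (C j)" if "i < j" for i j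
    using C_mono[of "Suc i" j] r[of i] that by (auto simp: C_def completion_step_def)
  obtain i j where ij: "i < j" "list_emb (\<le>) (map (Poly_Mapping.lookup (lm (f i))) [0..<bound (C i)])
      (map (Poly_Mapping.lookup (lm (f j))) [0..<bound (C j)])"
    using higman_nat_lists[of "\<lambda>k. map (Poly_Mapping.lookup (lm (f k))) [0..<bound (C k)]"] by blast
  have "Poly_Mapping.keys (lm (f i)) \<subseteq> {..<bound (C i)}"
    using keys_lm[of "f i"] vars_f by blast
  from list_emb_imp_divides[OF ij(2) this] obtain \<iota> where
    \<iota>: "strict_mono \<iota>" "\<forall>k<bound (C i). \<iota> k < bound (C j)" "mon_divides (perm_mon \<iota> (lm (f i))) (lm (f j))"
    by blast
  \<comment> \<open>The embedding keeps all indices below \<open>bound (C j)\<close>, so on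
    \<open>f i\<close> the map \<open>\<iota>\<close> agrees with a permutation of that range. This
    puts the renamed polynomial into the orbit of round \<open>j\<close>.\<close>
  have "inj_on \<iota> {..<bound (C i)}" by (rule inj_on_subset[OF strict_mono_imp_inj_on[OF \<iota>(1)] subset_UNIV])
  moreover have "\<iota> ` {..<bound (C i)} \<subseteq> {..<bound (C j)}" using \<iota>(2) by blast
  ultimately obtain \<sigma> where \<sigma>: "\<sigma> permutes {..<bound (C j)}" "\<forall>k<bound (C i). \<sigma> k = \<iota> k"
    using ex_permutes_extending by blast
  have eq: "perm_poly \<sigma> (f i) = perm_poly \<iota> (f i)"
    using \<sigma>(2) vars_f[of i] by (intro perm_poly_cong) blast
  have "perm_poly \<sigma> (f i) \<in> orbit (bound (C j)) (poly_of_terms ` set (C j))"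
    unfolding orbit_def using \<sigma>(1) r_in[OF ij(1)] by (auto simp: f_def)
  then have "perm_poly \<iota> (f i) \<in> poly_of_terms ` set (stage (C j))"
    unfolding poly_of_stage eq .
  moreover have "perm_poly \<iota> (f i) \<noteq> 0"
    using remainders_irreducible(1)[OF r[of i]]
    by (simp add: f_def perm_poly_eq_0_iff[OF strict_mono_imp_inj_on[OF \<iota>(1)]])
  ultimately have "\<not> mon_divides (lm (perm_poly \<iota> (f i))) (lm (f j))"
    unfolding f_def[of j] by (rule remainders_irreducible(2)[OF r])
  then show False using \<iota>(3) by (simp add: lm_perm_poly[OF \<iota>(1)])
qed

lemma sym_ideal_gen_completion:
  "sym_ideal_gen (poly_of_terms ` set (completion B)) = sym_ideal_gen (poly_of_terms ` set B)"
proof -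
  obtain t where t: "while_option (\<lambda>B. \<not> remainders (stage B) = []) (\<lambda>B. completion_step B) B = Some t"
    using completion_terminates by blast
  have "sym_ideal_gen (poly_of_terms ` set t) = sym_ideal_gen (poly_of_terms ` set B)"
    by (rule while_option_rule[OF _ t, where P = "\<lambda>C. sym_ideal_gen (poly_of_terms ` set C) = sym_ideal_gen (poly_of_terms ` set B)"])
      (simp_all add: sym_ideal_gen_completion_step)
  then show ?thesis by (simp add: completion_def t)
qed

lemma remainders_completion: "remainders (stage (completion B)) = []"
proof -
  obtain t where t: "while_option (\<lambda>B. \<not> remainders (stage B) = []) (\<lambda>B. completion_step B) B = Some t"
    using completion_terminates by blast
  then show ?thesis using while_option_stop[OF t] by (simp add: completion_def t)
qed

text \<open>When the loop stops, all S-polynomials of the orbit have remainder zero. With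
  \<open>keys_spol\<close> this gives representations below the least common multiples, which is
  what the symmetric criterion asks for.\<close>

lemma completion_lm:
  assumes f: "f \<in> sym_ideal_gen (poly_of_terms ` set B)" "f \<noteq> 0"
  shows "\<exists>p\<in>set (stage (completion B)). poly_of_terms p \<noteq> 0 \<and> sym_le (lm (poly_of_terms p)) (lm f)"
proof -
  let ?C = "completion B"
  let ?O = "orbit (bound ?C) (poly_of_terms ` set ?C)"
  have spol: "spol p q \<in> span_below (?O - {0}) ((lm q - lm p) + lm p)"
    if pq: "p \<in> ?O - {0}" "q \<in> ?O - {0}" for p q
  proof -
    obtain a b where ab: "a \<in> set (stage ?C)" "p = poly_of_terms a" "b \<in> set (stage ?C)" "q = poly_of_terms b"
      using pq unfolding poly_of_stage[symmetric] by blast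
    have "terms_spol a b \<in> set (spairs (stage ?C))" using ab(1,3) by (auto simp: spairs_def)
    then have "poly_of_terms (reduce (stage ?C) (terms_spol a b)) = 0"
      using remainders_completion[of B] by (auto simp: remainders_def filter_empty_conv terms_lc_eq_0_iff)
    from span_below_reduce[OF this, of "(lm q - lm p) + lm p"] show ?thesis
      using keys_spol[OF lm_in_keys, of p q] by (simp add: poly_of_terms_spol ab(2,4) poly_of_stage)
  qed
  have "f \<in> sym_ideal_gen (poly_of_terms ` set ?C)" using f(1) by (simp add: sym_ideal_gen_completion)
  then have "\<exists>p\<in>?O - {0}. sym_le (lm p) (lm f)"
    using symmetric_buchberger[OF vars_le_num_vars _ spol _ f(2)] by (simp add: bound_def)
  then show ?thesis unfolding poly_of_stage[symmetric] by blast
qed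

section \<open>Deciding the symmetric cancellation order\<close>

text \<open>The witness for \<open>sym_le\<close> is the inverse of the listed permutation. Both
  conditions are therefore stated at the target indices \<open>k\<close> and \<open>l\<close>, the
  second one in contrapositive form.\<close>

definition exps_sym_le :: "nat \<Rightarrow> nat list \<Rightarrow> nat list \<Rightarrow> bool" where
  "exps_sym_le N u v \<longleftrightarrow> list_ex (\<lambda>t.
     list_all (\<lambda>k. nth_default 0 u (nth_default 0 t k) \<le> nth_default 0 v k) [0..<N] \<and>
     list_all (\<lambda>k. list_all (\<lambda>l. l < k \<longrightarrow> 0 < nth_default 0 u (nth_default 0 t l) \<longrightarrow>
       nth_default 0 t l < nth_default 0 t k) [0..<N]) [0..<N]) (perm_lists N)"

text \<open>A witness for \<open>sym_le\<close> may move infinitely many indices. It sends the last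
  index of \<open>u\<close> into the support of \<open>v\<close>, hence below \<open>N\<close>, and
  by monotonicity everything before that index lands below \<open>N\<close> too. This initial part
  extends to a permutation of \<open>{..<N}\<close>, and only this part matters for the two
  conditions.\<close>

lemma exps_sym_le_iff:
  assumes u: "Poly_Mapping.keys (Poly_Mapping.nth u) \<subseteq> {..<N}" and v: "Poly_Mapping.keys (Poly_Mapping.nth v) \<subseteq> {..<N}"
  shows "exps_sym_le N u v \<longleftrightarrow> sym_le (Poly_Mapping.nth u) (Poly_Mapping.nth v)"
proof -
  let ?u = "nth_default 0 u" and ?v = "nth_default 0 v"
  have u0: "?u i = 0" if "i \<ge> N" for i
    using u that by (metis in_keys_iff lessThan_iff lookup_nth not_le subsetD)
  have v0: "?v i = 0" if "i \<ge> N" for i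
    using v that by (metis in_keys_iff lessThan_iff lookup_nth not_le subsetD)
  define Q where "Q \<sigma> \<longleftrightarrow> (\<forall>i. ?u i \<le> ?v (\<sigma> i)) \<and> (\<forall>j. 0 < ?u j \<longrightarrow> (\<forall>i<j. \<sigma> i < \<sigma> j))" for \<sigma>
  have sym: "sym_le (Poly_Mapping.nth u) (Poly_Mapping.nth v) \<longleftrightarrow> (\<exists>\<sigma>. bij \<sigma> \<and> Q \<sigma>)"
    unfolding sym_le_iff Q_def
    by (intro ex_cong1 conj_cong refl) (auto simp: mon_divides_perm_mon_iff bij_is_inj in_keys_iff simp del: keys_nth)
  have list: "list_all (\<lambda>k. ?u (nth_default 0 t k) \<le> ?v k) [0..<N] \<and>
     list_all (\<lambda>k. list_all (\<lambda>l. l < k \<longrightarrow> 0 < ?u (nth_default 0 t l) \<longrightarrow>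
       nth_default 0 t l < nth_default 0 t k) [0..<N]) [0..<N] \<longleftrightarrow> Q (inv (list_perm t))"
    if t: "t \<in> set (perm_lists N)" for t
  proof -
    let ?\<pi> = "list_perm t" let ?\<sigma> = "inv ?\<pi>"
    have \<pi>: "?\<pi> permutes {..<N}" using t by (rule list_perm_permutes)
    have nth: "nth_default 0 t k = ?\<pi> k" if "k < N" for k
      using that t by (simp add: set_perm_lists list_perm_def nth_default_def)
    have lt: "?\<pi> k < N \<longleftrightarrow> k < N" for k using permutes_in_image[OF \<pi>] by simp
    have \<sigma>\<pi>: "?\<sigma> (?\<pi> k) = k" "?\<pi> (?\<sigma> k) = k" for k using permutes_inverses[OF \<pi>] by simp_all
    have lt': "?\<sigma> k < N \<longleftrightarrow> k < N" for k using lt[of "?\<sigma> k"] by (simp add: \<sigma>\<pi>)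
    have 1: "(\<forall>k<N. ?u (?\<pi> k) \<le> ?v k) \<longleftrightarrow> (\<forall>i. ?u i \<le> ?v (?\<sigma> i))"
    proof (intro iffI allI impI)
      fix i assume a: "\<forall>k<N. ?u (?\<pi> k) \<le> ?v k"
      show "?u i \<le> ?v (?\<sigma> i)"
        using a[rule_format, of "?\<sigma> i"] u0[of i] by (cases "i < N") (simp_all add: \<sigma>\<pi> lt')
    next
      fix k assume "\<forall>i. ?u i \<le> ?v (?\<sigma> i)"
      then have "?u (?\<pi> k) \<le> ?v (?\<sigma> (?\<pi> k))" by blast
      then show "?u (?\<pi> k) \<le> ?v k" by (simp add: \<sigma>\<pi>)
    qed
    have 2: "(\<forall>k<N. \<forall>l<N. l < k \<longrightarrow> 0 < ?u (?\<pi> l) \<longrightarrow> ?\<pi> l < ?\<pi> k) \<longleftrightarrow>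
        (\<forall>j. 0 < ?u j \<longrightarrow> (\<forall>i<j. ?\<sigma> i < ?\<sigma> j))"
    proof (intro iffI allI impI)
      fix i j assume a: "\<forall>k<N. \<forall>l<N. l < k \<longrightarrow> 0 < ?u (?\<pi> l) \<longrightarrow> ?\<pi> l < ?\<pi> k"
        and j: "0 < ?u j" and ij: "i < j"
      have jN: "j < N" using j u0[of j] by (cases "j < N") simp_all
      show "?\<sigma> i < ?\<sigma> j"
      proof (rule ccontr)
        assume "\<not> ?thesis"
        moreover have "?\<sigma> i \<noteq> ?\<sigma> j" using \<sigma>\<pi>(2) ij by (metis less_irrefl)
        ultimately have "?\<sigma> j < ?\<sigma> i" by simp
        then have "j < i" using a[rule_format, of "?\<sigma> i" "?\<sigma> j"] j ij jN by (simp add: \<sigma>\<pi> lt')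
        then show False using ij by simp
      qed
    next
      fix k l assume a: "\<forall>j. 0 < ?u j \<longrightarrow> (\<forall>i<j. ?\<sigma> i < ?\<sigma> j)"
        and kl: "l < k" and l: "0 < ?u (?\<pi> l)"
      show "?\<pi> l < ?\<pi> k"
      proof (rule ccontr)
        assume "\<not> ?thesis"
        moreover have "?\<pi> l \<noteq> ?\<pi> k" using \<sigma>\<pi>(1) kl by (metis less_irrefl)
        ultimately have "?\<pi> k < ?\<pi> l" by simp
        from a[rule_format, OF l this] have "k < l" by (simp add: \<sigma>\<pi>)
        then show False using kl by simp
      qed
    qed
    show ?thesis
      unfolding Q_def 1[symmetric] 2[symmetric] by (auto simp: list_all_iff nth)
  qed
  have "exps_sym_le N u v \<longleftrightarrow> (\<exists>t\<in>set (perm_lists N). Q (inv (list_perm t)))"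
    unfolding exps_sym_le_def list_ex_iff using list by blast
  also have "\<dots> \<longleftrightarrow> (\<exists>\<sigma>. bij \<sigma> \<and> Q \<sigma>)"
  proof
    assume "\<exists>t\<in>set (perm_lists N). Q (inv (list_perm t))"
    then show "\<exists>\<sigma>. bij \<sigma> \<and> Q \<sigma>"
      using list_perm_permutes permutes_inv permutes_bij by blast
  next
    assume "\<exists>\<sigma>. bij \<sigma> \<and> Q \<sigma>"
    then obtain \<sigma> where \<sigma>: "bij \<sigma>" "Q \<sigma>" by blast
    \<comment> \<open>Again one more than the last index of the support, or zero for the monomial
      \<open>1\<close>.\<close>
    define m where "m = Poly_Mapping.degree (Poly_Mapping.nth u)"
    have um: "?u i = 0" if "i \<ge> m" for i
      using beyond_degree_lookup_zero[of "Poly_Mapping.nth u" i] that by (simp add: m_def)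
    have \<sigma>N: "\<sigma> j < N" if "0 < ?u j" for j
    proof (rule ccontr)
      assume "\<not> ?thesis"
      then have "?v (\<sigma> j) = 0" using v0 by simp
      moreover have "?u j \<le> ?v (\<sigma> j)" using \<sigma>(2) by (simp add: Q_def)
      ultimately show False using that by simp
    qed
    have "\<sigma> i < N" if "i < m" for i
    proof -
      have "m > 0" using that by simp
      then have "Poly_Mapping.nth u \<noteq> 0" unfolding m_def by auto
      then have "m - 1 \<in> Poly_Mapping.keys (Poly_Mapping.nth u)"
        using degree_greater_zero_in_keys[of "Poly_Mapping.nth u"] \<open>m > 0\<close> by (simp add: m_def del: keys_nth)
      then have *: "0 < ?u (m - 1)" by (simp add: in_keys_iff del: keys_nth)
      show ?thesis
      proof (cases "i = m - 1")
        case False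
        then have "\<sigma> i < \<sigma> (m - 1)" using \<sigma>(2) * that by (simp add: Q_def)
        then show ?thesis using \<sigma>N[OF *] by simp
      qed (use \<sigma>N[OF *] in simp)
    qed
    then have "\<sigma> ` {..<m} \<subseteq> {..<N}" by blast
    moreover have "inj_on \<sigma> {..<m}" by (rule inj_on_subset[OF bij_is_inj[OF \<sigma>(1)] subset_UNIV])
    ultimately obtain \<tau> where \<tau>: "\<tau> permutes {..<N}" "\<forall>i<m. \<tau> i = \<sigma> i"
      using ex_permutes_extending by blast
    have "Q \<tau>"
      unfolding Q_def
    proof (intro conjI allI impI)
      show "?u i \<le> ?v (\<tau> i)" for i
        using um[of i] \<tau>(2) \<sigma>(2) by (cases "i < m") (simp_all add: Q_def)
      show "\<tau> i < \<tau> j" if "0 < ?u j" "i < j" for i j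
      proof -
        have "j < m" using that(1) um[of j] by (cases "j < m") simp_all
        then show ?thesis using that \<tau>(2) \<sigma>(2) by (simp add: Q_def)
      qed
    qed
    moreover obtain t where "t \<in> set (perm_lists N)" "list_perm t = inv \<tau>"
      using ex_list_perm[OF permutes_inv[OF \<tau>(1)]] by blast
    ultimately show "\<exists>t\<in>set (perm_lists N). Q (inv (list_perm t))"
      using permutes_inv_inv[OF \<tau>(1)] by (intro bexI[of _ t]) simp_all
  qed
  finally show ?thesis using sym by simp
qed

section \<open>Selecting minimal elements\<close>

text \<open>The accumulator is always an antichain. Among equivalent elements the one met first is
  kept, so different polynomials with the same leading monomial do not both survive.\<close>

definition minimals :: "('a \<Rightarrow> 'a \<Rightarrow> bool) \<Rightarrow> 'a list \<Rightarrow> 'a list" where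
  "minimals R xs = foldl (\<lambda>acc x. if list_ex (\<lambda>y. R y x) acc then acc
     else x # filter (\<lambda>y. \<not> R x y) acc) [] xs"

lemma minimals:
  assumes refl: "reflp_on (set xs) R" and trans: "transp_on (set xs) R"
  shows "set (minimals R xs) \<subseteq> set xs"
    and "x \<in> set (minimals R xs) \<Longrightarrow> y \<in> set (minimals R xs) \<Longrightarrow> x \<noteq> y \<Longrightarrow> \<not> R x y"
    and "x \<in> set xs \<Longrightarrow> \<exists>y\<in>set (minimals R xs). R y x"
proof -
  let ?step = "\<lambda>acc x. if list_ex (\<lambda>y. R y x) acc then acc else x # filter (\<lambda>y. \<not> R x y) acc"
  have "set (foldl ?step [] ys) \<subseteq> set ys \<and>
      (\<forall>x\<in>set (foldl ?step [] ys). \<forall>y\<in>set (foldl ?step [] ys). x \<noteq> y \<longrightarrow> \<not> R x y) \<and>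
      (\<forall>x\<in>set ys. \<exists>y\<in>set (foldl ?step [] ys). R y x)" if "set ys \<subseteq> set xs" for ys
    using that
  proof (induction ys rule: rev_induct)
    case (snoc z ys)
    let ?acc = "foldl ?step [] ys"
    have IH: "set ?acc \<subseteq> set ys" "\<forall>x\<in>set ?acc. \<forall>y\<in>set ?acc. x \<noteq> y \<longrightarrow> \<not> R x y"
      "\<forall>x\<in>set ys. \<exists>y\<in>set ?acc. R y x" and z: "z \<in> set xs" "R z z" "set ys \<subseteq> set xs"
      using snoc reflp_onD[OF refl] by auto
    show ?case
    proof (cases "\<exists>y\<in>set ?acc. R y z")
      case True
      then have "foldl ?step [] (ys @ [z]) = ?acc" by (simp add: list_ex_iff)
      moreover have "\<forall>x\<in>set (ys @ [z]). \<exists>y\<in>set ?acc. R y x" using True IH(3) by simp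
      moreover have "set ?acc \<subseteq> set (ys @ [z])" using IH(1) by auto
      ultimately show ?thesis using IH(2) by presburger
    next
      case False
      then have eq: "foldl ?step [] (ys @ [z]) = z # filter (\<lambda>y. \<not> R z y) ?acc" by (simp add: list_ex_iff)
      have "\<exists>y\<in>set (z # filter (\<lambda>y. \<not> R z y) ?acc). R y x" if "x \<in> set ys" for x
      proof -
        \<comment> \<open>If \<open>y\<close> is discarded because it lies above \<open>z\<close>,
          then \<open>z\<close> takes over its task by transitivity.\<close>
        obtain y where y: "y \<in> set ?acc" "R y x" using IH(3) \<open>x \<in> set ys\<close> by blast
        then have "R z y \<Longrightarrow> R z x" using transp_onD[OF trans, of z y x] z \<open>x \<in> set ys\<close> IH(1) by blast
        then show ?thesis using y by (cases "R z y") auto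
      qed
      then have "\<forall>x\<in>set (ys @ [z]). \<exists>y\<in>set (z # filter (\<lambda>y. \<not> R z y) ?acc). R y x"
        using z(2) by simp
      moreover have "\<forall>x\<in>set (z # filter (\<lambda>y. \<not> R z y) ?acc). \<forall>y\<in>set (z # filter (\<lambda>y. \<not> R z y) ?acc).
          x \<noteq> y \<longrightarrow> \<not> R x y"
        using False IH(2) by simp
      moreover have "set (z # filter (\<lambda>y. \<not> R z y) ?acc) \<subseteq> set (ys @ [z])" using IH(1) by auto
      ultimately show ?thesis unfolding eq by blast
    qed
  qed simp
  from this[OF order_refl] show "set (minimals R xs) \<subseteq> set xs"
    and "x \<in> set (minimals R xs) \<Longrightarrow> y \<in> set (minimals R xs) \<Longrightarrow> x \<noteq> y \<Longrightarrow> \<not> R x y"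
    and "x \<in> set xs \<Longrightarrow> \<exists>y\<in>set (minimals R xs). R y x"
    unfolding minimals_def by blast+
qed

text \<open>The selection runs over the whole orbit: a permuted copy may have a leading monomial
  that is not above the original one, as for \<open>x_1^2 x_2\<close> and \<open>x_1 x_2^2\<close>.
  Zero polynomials are removed because their leading monomial is a mere convention.\<close>

definition minimize :: "'k::field terms list \<Rightarrow> 'k terms list" where
  "minimize B = minimals (\<lambda>p q. exps_sym_le (bound B) (terms_lm p) (terms_lm q))
     (filter (\<lambda>p. \<not> terms_lc p = 0) (stage B))"

theorem minimal_groebner_basis_minimize_completion:
  fixes B :: "'k::field terms list"
  shows "minimal_groebner_basis (poly_of_terms ` set (minimize (completion B)))
    (sym_ideal_gen (poly_of_terms ` set B))"
proof -
  let ?C = "completion B" and ?I = "sym_ideal_gen (poly_of_terms ` set B)"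
  let ?ps = "filter (\<lambda>p. \<not> terms_lc p = 0) (stage ?C)"
  let ?R = "\<lambda>p q. exps_sym_le (bound ?C) (terms_lm p) (terms_lm q)"
  \<comment> \<open>On the orbit all leading monomials live in the first \<open>bound ?C\<close>
    indeterminates, where the finite test is exact. Reflexivity and transitivity are therefore
    claimed on this set only.\<close>
  have R: "?R p q \<longleftrightarrow> sym_le (lm (poly_of_terms p)) (lm (poly_of_terms q))"
    if "p \<in> set ?ps" "q \<in> set ?ps" for p q
  proof -
    have "Poly_Mapping.keys (Poly_Mapping.nth (terms_lm s)) \<subseteq> {..<bound ?C}" if "s \<in> set ?ps" for s
      using keys_lm[of "poly_of_terms s"] vars_stage[of s ?C] that unfolding nth_terms_lm by auto
    from exps_sym_le_iff[OF this this] show ?thesis using that by (simp add: nth_terms_lm)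
  qed
  have refl: "reflp_on (set ?ps) ?R"
    using R sym_le_refl by (intro reflp_onI) blast
  have trans: "transp_on (set ?ps) ?R"
  proof (rule transp_onI)
    fix p q r assume that: "p \<in> set ?ps" "q \<in> set ?ps" "r \<in> set ?ps" "?R p q" "?R q r"
    show "?R p r"
      using that(4,5) unfolding R[OF that(1,2)] R[OF that(2,3)] R[OF that(1,3)] by (rule sym_le_trans)
  qed
  note min = minimals[of ?ps ?R, OF refl trans, folded minimize_def]
  show ?thesis
  proof (rule minimal_groebner_basisI)
    show "symmetric_ideal ?I" by (rule symmetric_ideal_sym_ideal_gen)
    have "poly_of_terms ` set (stage ?C) \<subseteq> ?I"
      using orbit_subset_sym_ideal_gen unfolding poly_of_stage sym_ideal_gen_completion[of B, symmetric] .
    then show "poly_of_terms ` set (minimize ?C) \<subseteq> ?I - {0}"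
      using min(1) by (auto simp: terms_lc_eq_0_iff)
    fix f assume f: "f \<in> ?I" "f \<noteq> 0"
    obtain p where p: "p \<in> set ?ps" "sym_le (lm (poly_of_terms p)) (lm f)"
      using completion_lm[OF f] by (auto simp: terms_lc_eq_0_iff)
    obtain q where q: "q \<in> set (minimize ?C)" "?R q p" using min(3)[OF p(1)] by auto
    then have "sym_le (lm (poly_of_terms q)) (lm (poly_of_terms p))" using R min(1) p(1) by blast
    then show "\<exists>b\<in>poly_of_terms ` set (minimize ?C). sym_le (lm b) (lm f)"
      using q(1) p(2) sym_le_trans by blast
  next
    fix b c assume "b \<in> poly_of_terms ` set (minimize ?C)" "c \<in> poly_of_terms ` set (minimize ?C)" "b \<noteq> c"
    then obtain p q where pq: "p \<in> set (minimize ?C)" "b = poly_of_terms p"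
      "q \<in> set (minimize ?C)" "c = poly_of_terms q" "p \<noteq> q" by blast
    then show "\<not> sym_le (lm b) (lm c)" using min(2)[OF pq(1,3,5)] R min(1) by blast
  qed
qed

section \<open>Computability of the procedure\<close>

abbreviation exps_data :: "nat list \<Rightarrow> 'k data" where
  "exps_data \<equiv> lists_data nat_data"

abbreviation terms_enc :: "'k terms \<Rightarrow> 'k data" where
  "terms_enc \<equiv> lists_data (pair_data Scalar exps_data)"

text \<open>The body is computed with its own arguments as the environment and then composed with
  programs for the arguments, which makes the function available in every environment. The functions
  below follow the same pattern.\<close>

lemma computes_exps_add [computes_intros]:
  assumes "computes e exps_data f" "computes e exps_data g"
  shows "computes e exps_data (\<lambda>x. exps_add (f x) (g x))"
proof -
  have "computes (pair_data exps_data exps_data) exps_data (\<lambda>z. exps_add (fst z) (snd z))"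
    unfolding exps_add_def by (rule computes_intros)+
  from computes_comp[OF computes_Pair[OF assms] this] show ?thesis by simp
qed

lemma computes_exps_diff [computes_intros]:
  assumes "computes e exps_data f" "computes e exps_data g"
  shows "computes e exps_data (\<lambda>x. exps_diff (f x) (g x))"
proof -
  have "computes (pair_data exps_data exps_data) exps_data (\<lambda>z. exps_diff (fst z) (snd z))"
    unfolding exps_diff_def by (rule computes_intros)+
  from computes_comp[OF computes_Pair[OF assms] this] show ?thesis by simp
qed

lemma computes_exps_eq [computes_intros]:
  assumes "computes e exps_data f" "computes e exps_data g"
  shows "computes e bool_data (\<lambda>x. exps_eq (f x) (g x))"
proof -
  have "computes (pair_data exps_data exps_data) bool_data (\<lambda>z. exps_eq (fst z) (snd z))"
    unfolding exps_eq_def by (rule computes_intros)+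
  from computes_comp[OF computes_Pair[OF assms] this] show ?thesis by simp
qed

lemma computes_exps_dvd [computes_intros]:
  assumes "computes e exps_data f" "computes e exps_data g"
  shows "computes e bool_data (\<lambda>x. exps_dvd (f x) (g x))"
proof -
  have "computes (pair_data exps_data exps_data) bool_data (\<lambda>z. exps_dvd (fst z) (snd z))"
    unfolding exps_dvd_def by (rule computes_intros)+
  from computes_comp[OF computes_Pair[OF assms] this] show ?thesis by simp
qed

lemma computes_exps_less [computes_intros]:
  assumes "computes e exps_data f" "computes e exps_data g"
  shows "computes e bool_data (\<lambda>x. exps_less (f x) (g x))"
proof -
  have "computes (pair_data exps_data exps_data) bool_data (\<lambda>z. exps_less (fst z) (snd z))"
    unfolding exps_less_def by (rule computes_intros)+
  from computes_comp[OF computes_Pair[OF assms] this] show ?thesis by simp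
qed

lemma computes_terms_coeff [computes_intros]:
  assumes "computes e terms_enc f" "computes e exps_data g"
  shows "computes e Scalar (\<lambda>x. terms_coeff (f x) (g x))"
proof -
  have "computes (pair_data terms_enc exps_data) Scalar (\<lambda>z. terms_coeff (fst z) (snd z))"
    unfolding terms_coeff_def by (rule computes_intros)+
  from computes_comp[OF computes_Pair[OF assms] this] show ?thesis by simp
qed

lemma computes_terms_lm [computes_intros]:
  assumes "computes e terms_enc f"
  shows "computes e exps_data (\<lambda>x. terms_lm (f x))"
proof -
  have "computes terms_enc exps_data (\<lambda>z. terms_lm z)"
    unfolding terms_lm_def by (rule computes_intros)+
  from computes_comp[OF assms this] show ?thesis by simp
qed

lemma computes_terms_lc [computes_intros]:
  assumes "computes e terms_enc f"
  shows "computes e Scalar (\<lambda>x. terms_lc (f x))"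
proof -
  have "computes terms_enc Scalar (\<lambda>z. terms_lc z)"
    unfolding terms_lc_def by (rule computes_intros)+
  from computes_comp[OF assms this] show ?thesis by simp
qed

lemma computes_terms_scale [computes_intros]:
  assumes "computes e Scalar f" "computes e exps_data g" "computes e terms_enc h"
  shows "computes e terms_enc (\<lambda>x. terms_scale (f x) (g x) (h x))"
proof -
  have "computes (pair_data Scalar (pair_data exps_data terms_enc)) terms_enc (\<lambda>z. terms_scale (fst z) (fst (snd z)) (snd (snd z)))"
    unfolding terms_scale_def by (rule computes_intros)+
  from computes_comp[OF computes_Pair[OF assms(1) computes_Pair[OF assms(2,3)]] this] show ?thesis by simp
qed

lemma computes_terms_spol [computes_intros]:
  assumes "computes e terms_enc f" "computes e terms_enc g"
  shows "computes e terms_enc (\<lambda>x. terms_spol (f x) (g x))"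
proof -
  have "computes (pair_data terms_enc terms_enc) terms_enc (\<lambda>z. terms_spol (fst z) (snd z))"
    unfolding terms_spol_def by (rule computes_intros)+
  from computes_comp[OF computes_Pair[OF assms] this] show ?thesis by simp
qed

lemma computes_reducers [computes_intros]:
  assumes "computes e (lists_data terms_enc) f" "computes e terms_enc g"
  shows "computes e (lists_data terms_enc) (\<lambda>x. reducers (f x) (g x))"
proof -
  have "computes (pair_data (lists_data terms_enc) terms_enc) (lists_data terms_enc) (\<lambda>z. reducers (fst z) (snd z))"
    unfolding reducers_def by (rule computes_intros)+
  from computes_comp[OF computes_Pair[OF assms] this] show ?thesis by simp
qed

lemma computes_reduce_step [computes_intros]:
  assumes "computes e (lists_data terms_enc) f" "computes e terms_enc g"
  shows "computes e terms_enc (\<lambda>x. reduce_step (f x) (g x))"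
proof -
  have "computes (pair_data (lists_data terms_enc) terms_enc) terms_enc (\<lambda>z. reduce_step (fst z) (snd z))"
    unfolding reduce_step_def by (rule computes_intros)+
  from computes_comp[OF computes_Pair[OF assms] this] show ?thesis by simp
qed

lemma computes_reduce [computes_intros]:
  assumes "computes e (lists_data terms_enc) f" "computes e terms_enc g"
  shows "computes e terms_enc (\<lambda>x. reduce (f x) (g x))"
proof -
  have "computes (pair_data (lists_data terms_enc) terms_enc) terms_enc (\<lambda>z. reduce (fst z) (snd z))"
    unfolding reduce_def by (rule computes_intros reduce_terminates)+
  from computes_comp[OF computes_Pair[OF assms] this] show ?thesis by simp
qed

lemma computes_perm_lists [computes_intros]:
  assumes "computes e nat_data f"
  shows "computes e (lists_data exps_data) (\<lambda>x. perm_lists (f x))"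
proof -
  have "computes nat_data (lists_data exps_data) (\<lambda>z. perm_lists z)"
    unfolding perm_lists_def by (rule computes_intros)+
  from computes_comp[OF assms this] show ?thesis by simp
qed

lemma computes_permute_terms [computes_intros]:
  assumes "computes e exps_data f" "computes e terms_enc g"
  shows "computes e terms_enc (\<lambda>x. permute_terms (f x) (g x))"
proof -
  have "computes (pair_data exps_data terms_enc) terms_enc (\<lambda>z. permute_terms (fst z) (snd z))"
    unfolding permute_terms_def by (rule computes_intros)+
  from computes_comp[OF computes_Pair[OF assms] this] show ?thesis by simp
qed

lemma computes_orbit_terms [computes_intros]:
  assumes "computes e nat_data f" "computes e (lists_data terms_enc) g"
  shows "computes e (lists_data terms_enc) (\<lambda>x. orbit_terms (f x) (g x))"
proof -
  have "computes (pair_data nat_data (lists_data terms_enc)) (lists_data terms_enc) (\<lambda>z. orbit_terms (fst z) (snd z))"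
    unfolding orbit_terms_def by (rule computes_intros)+
  from computes_comp[OF computes_Pair[OF assms] this] show ?thesis by simp
qed

lemma computes_num_vars [computes_intros]:
  assumes "computes e (lists_data terms_enc) f"
  shows "computes e nat_data (\<lambda>x. num_vars (f x))"
proof -
  have "computes (lists_data terms_enc) nat_data (\<lambda>z. num_vars z)"
    unfolding num_vars_def by (rule computes_intros)+
  from computes_comp[OF assms this] show ?thesis by simp
qed

lemma computes_bound [computes_intros]:
  assumes "computes e (lists_data terms_enc) f"
  shows "computes e nat_data (\<lambda>x. bound (f x))"
proof -
  have "computes (lists_data terms_enc) nat_data (\<lambda>z. bound z)"
    unfolding bound_def by (rule computes_intros)+
  from computes_comp[OF assms this] show ?thesis by simp
qed

lemma computes_stage [computes_intros]:
  assumes "computes e (lists_data terms_enc) f"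
  shows "computes e (lists_data terms_enc) (\<lambda>x. stage (f x))"
proof -
  have "computes (lists_data terms_enc) (lists_data terms_enc) (\<lambda>z. stage z)"
    unfolding stage_def by (rule computes_intros)+
  from computes_comp[OF assms this] show ?thesis by simp
qed

lemma computes_spairs [computes_intros]:
  assumes "computes e (lists_data terms_enc) f"
  shows "computes e (lists_data terms_enc) (\<lambda>x. spairs (f x))"
proof -
  have "computes (lists_data terms_enc) (lists_data terms_enc) (\<lambda>z. spairs z)"
    unfolding spairs_def by (rule computes_intros)+
  from computes_comp[OF assms this] show ?thesis by simp
qed

lemma computes_remainders [computes_intros]:
  assumes "computes e (lists_data terms_enc) f"
  shows "computes e (lists_data terms_enc) (\<lambda>x. remainders (f x))"
proof -
  have "computes (lists_data terms_enc) (lists_data terms_enc) (\<lambda>z. remainders z)"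
    unfolding remainders_def by (rule computes_intros)+
  from computes_comp[OF assms this] show ?thesis by simp
qed

lemma computes_completion_step [computes_intros]:
  assumes "computes e (lists_data terms_enc) f"
  shows "computes e (lists_data terms_enc) (\<lambda>x. completion_step (f x))"
proof -
  have "computes (lists_data terms_enc) (lists_data terms_enc) (\<lambda>z. completion_step z)"
    unfolding completion_step_def by (rule computes_intros)+
  from computes_comp[OF assms this] show ?thesis by simp
qed

lemma computes_completion [computes_intros]:
  assumes "computes e (lists_data terms_enc) f"
  shows "computes e (lists_data terms_enc) (\<lambda>x. completion (f x))"
proof -
  have "computes (lists_data terms_enc) (lists_data terms_enc) (\<lambda>z. completion z)"
    \<comment> \<open>\<open>completion_terminates\<close> discharges the termination condition of
      the loop rule; at this point Higman's lemma makes the program total.\<close>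
    unfolding completion_def by (rule computes_intros completion_terminates)+
  from computes_comp[OF assms this] show ?thesis by simp
qed

lemma computes_exps_sym_le [computes_intros]:
  assumes "computes e nat_data f" "computes e exps_data g" "computes e exps_data h"
  shows "computes e bool_data (\<lambda>x. exps_sym_le (f x) (g x) (h x))"
proof -
  have "computes (pair_data nat_data (pair_data exps_data exps_data)) bool_data (\<lambda>z. exps_sym_le (fst z) (fst (snd z)) (snd (snd z)))"
    unfolding exps_sym_le_def by (rule computes_intros)+
  from computes_comp[OF computes_Pair[OF assms(1) computes_Pair[OF assms(2,3)]] this] show ?thesis by simp
qed

lemma computes_minimize [computes_intros]:
  assumes "computes e (lists_data terms_enc) f"
  shows "computes e (lists_data terms_enc) (\<lambda>x. minimize (f x))"
proof -
  have "computes (lists_data terms_enc) (lists_data terms_enc) (\<lambda>z. minimize z)"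
    unfolding minimize_def minimals_def by (rule computes_intros)+
  from computes_comp[OF assms this] show ?thesis by simp
qed

lemma terms_data_eq: "terms_data = terms_enc"
proof
  show "terms_data ts = terms_enc ts" for ts :: "'k terms"
    by (induction ts) (auto simp: terms_data_def lists_data_def)
qed

theorem theorem2p4:
  shows "\<exists>P::prog. \<forall>(fs :: 'k::field mpoly list) d. represents d fs \<longrightarrow>
           (\<exists>e gs. run P d e \<and> represents e gs \<and>
                   minimal_groebner_basis (set gs) (sym_ideal_gen (set fs)))"
proof -
  have "computes (lists_data terms_enc) (lists_data terms_enc) (\<lambda>tss :: 'k terms list. minimize (completion tss))"
    by (rule computes_intros)+
  \<comment> \<open>\<open>P\<close> is fixed before any input, so it serves all lists of generators
    and all their encodings.\<close>
  then obtain P where P: "\<And>tss :: 'k terms list.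
      run P (list_data (map terms_data tss)) (list_data (map terms_data (minimize (completion tss))))"
    unfolding computes_def terms_data_eq lists_data_def by blast
  have "\<exists>e gs. run P d e \<and> represents e gs \<and> minimal_groebner_basis (set gs) (sym_ideal_gen (set fs))"
    if repr: "represents d fs" for fs :: "'k mpoly list" and d
  proof -
    obtain tss where tss: "d = list_data (map terms_data tss)" "fs = map poly_of_terms tss"
      using repr unfolding represents_def by blast
    let ?gs = "map poly_of_terms (minimize (completion tss))"
    have "represents (list_data (map terms_data (minimize (completion tss)))) ?gs"
      unfolding represents_def by blast
    moreover have "minimal_groebner_basis (set ?gs) (sym_ideal_gen (set fs))"
      using minimal_groebner_basis_minimize_completion[of tss] by (simp add: tss(2))
    ultimately show ?thesis using P[of tss] unfolding tss(1) by blast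
  qed
  then show ?thesis by blast
qed

end
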